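(* Let $d\ge 1$. Suppose that $\{g_n\}_{n\in\mathbb{Z}}\in\ell^1(\mathbb{Z})$ and $g_0=1$. Let $T\in\mathbb{R}$ and let $u(t)$ be a solution to $i\partial_t u+\Delta u=F(u)$ on $[T,\infty)$. If $u$ satisfies $$\lim_{t\to\infty}\|u(t)-V_\lambda(t)\|_{L^2(\mathbb{R}^d)}=0,$$ $$\lim_{t\to\infty}t^{\frac{d}{2(d+2)}}\,\|u-V_\lambda\|_{L^{\frac{2(d+2)}{d}}_{t,x}([t,\infty)\times\mathbb{R}^d)}=0$$ for some $u_+\in H^{0,\frac{d}{d+2}}(\mathbb{R}^d)$ and some $\lambda\in\mathbb{R}$, where $V_\lambda(t)=V_\lambda(t,x;u_+)$, then $u_+\equiv 0$.
   Context: Nonlinearity: $F:\mathbb{C}\to\mathbb{C}$ is homogeneous of degree $1+2/d$, i.e. $F(\lambda z)=\lambda^{1+2/d}F(z)$ for all $z\in\mathbb{C}$, $\lambda>0$. Its coefficients are $g_n=\frac1{2\pi}\int_0^{2\pi}F(e^{i\theta})e^{-in\theta}\,d\theta$, $n\in\mathbb{Z}$, and $F$ is decomposed as $F(u)=\sum_{n\in\mathbb{Z}}g_nF_n(u)$ with $F_n(u)=|u|^{1+\frac2d-n}u^n$ (so $F_0(u)=|u|^{1+2/d}$, $F_1(u)=|u|^{2/d}u$). Solution: for an interval $I\subset\mathbb{R}$, a function $u:I\times\mathbb{R}^d\to\mathbb{C}$ is a solution to $i\partial_tu+\Delta u=F(u)$ on $I$ if $u\in C_t(I;L^2_x(\mathbb{R}^d))\cap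 L^{\frac{2(d+2)}{d}}_{t,\mathrm{loc}}(I;L_x^{\frac{2(d+2)}{d}}(\mathbb{R}^d))$ and $u(t_2)=U(t_2-t_1)u(t_1)-i\int_{t_1}^{t_2}U(t_2-s)F(u(s))\,ds$ in $L^2(\mathbb{R}^d)$ for all $t_1,t_2\in I$, where $U(t)=e^{it\Delta}$ is the free Schrödinger group. Weighted Sobolev space: $H^{m,s}=\{u\in\mathcal{S}'(\mathbb{R}^d):\langle i\nabla\rangle^m\langle x\rangle^su\in L^2(\mathbb{R}^d)\}$, where $\langle a\rangle=(1+|a|^2)^{1/2}$. Asymptotic profile: $\widehat{f}(\xi)=(2\pi)^{-d/2}\int_{\mathbb{R}^d}e^{-ix\cdot\xi}f(x)\,dx$; for $t\neq0$, $[M(t)f](x)=e^{i|x|^2/(4t)}f(x)$ and $[D(t)f](x)=(2t)^{-d/2}f(x/(2t))$; for $t>0$, $\lambda\in\mathbb{R}$ and $u_+\in L^2(\mathbb{R}^d)$, $$V_\lambda(t,x;u_+)=e^{-i\frac{d\pi}{4}}\big(M(t)D(t)\big[\widehat{u_+}\exp(-i\lambda|\widehat{u_+}|^{2/d}\log t)\big]\big)(x).$$ *)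

theory Defs
  imports "HOL-Analysis.Analysis"
begin

section \<open>Lebesgue spaces\<close>

text \<open>Elements of \<open>L\<^sup>p\<close> are represented by functions, and equality in \<open>L\<^sup>p\<close> is equality almost
  everywhere. Norms take values in \<^typ>\<open>ennreal\<close>, so that an infinite norm is \<^term>\<open>top\<close> and not the
  default value \<open>0\<close> of a divergent Bochner integral.\<close>

definition epowr :: "ennreal \<Rightarrow> real \<Rightarrow> ennreal" where
  \<comment> \<open>only used for positive exponents\<close>
  "epowr x p = (if x = top then top else ennreal (enn2real x powr p))"

definition eLp :: "'b measure \<Rightarrow> real \<Rightarrow> ('b \<Rightarrow> ennreal) \<Rightarrow> ennreal" where
  "eLp M p g = epowr (\<integral>\<^sup>+ x. epowr (g x) p \<partial>M) (1 / p)"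

definition Lp_norm :: "real \<Rightarrow> ('a::euclidean_space \<Rightarrow> complex) \<Rightarrow> ennreal" where
  "Lp_norm p f = eLp lebesgue p (\<lambda>x. ennreal (norm (f x)))"

definition Lp :: "real \<Rightarrow> ('a::euclidean_space \<Rightarrow> complex) set" where
  "Lp p = {f \<in> borel_measurable lebesgue. Lp_norm p f < top}"

text \<open>The norm of \<open>L\<^sup>p\<close> in time over \<open>J\<close> with values in \<open>L\<^sup>p\<close> in space, as an iterated norm. Since
  the iterated form never looks at \<open>u\<close> off a time slice, it does not depend on the representatives
  chosen for the individual slices; for jointly measurable \<open>u\<close> it is the \<open>L\<^sup>p\<close> norm over the product
  of \<open>J\<close> with the whole space.\<close>

definition spacetime_norm ::
    "real \<Rightarrow> real set \<Rightarrow> (real \<Rightarrow> 'a::euclidean_space \<Rightarrow> complex) \<Rightarrow> ennreal" where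
  "spacetime_norm p J u = eLp (lebesgue_on J) p (\<lambda>t. Lp_norm p (u t))"

section \<open>Schwartz functions and tempered distributions\<close>

fun iter_deriv :: "'a list \<Rightarrow> ('a::euclidean_space \<Rightarrow> complex) \<Rightarrow> 'a \<Rightarrow> complex" where
  "iter_deriv [] f = f"
| "iter_deriv (v # vs) f = (\<lambda>x. frechet_derivative (iter_deriv vs f) (at x) v)"

definition schwartz :: "('a::euclidean_space \<Rightarrow> complex) set" where
  "schwartz = {\<phi>. \<forall>vs \<in> lists Basis.
     (\<forall>x. iter_deriv vs \<phi> differentiable (at x)) \<and>
     (\<forall>k::nat. bounded (range (\<lambda>x. (norm x ^ k) *\<^sub>R iter_deriv vs \<phi> x)))}"

definition schwartz_seminorm :: "nat \<Rightarrow> ('a::euclidean_space \<Rightarrow> complex) \<Rightarrow> real" where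
  "schwartz_seminorm N \<phi> =
     (SUP (vs, x) \<in> {vs \<in> lists Basis. length vs \<le> N} \<times> UNIV.
        (1 + norm x) ^ N * norm (iter_deriv vs \<phi> x))"

text \<open>A tempered distribution is a continuous linear functional on \<^term>\<open>schwartz\<close>; its values
  outside \<^term>\<open>schwartz\<close> are irrelevant. The pairing is bilinear (no complex conjugate).\<close>

definition tempered_distributions :: "(('a::euclidean_space \<Rightarrow> complex) \<Rightarrow> complex) set" where
  "tempered_distributions = {S.
     (\<forall>\<phi>\<in>schwartz. \<forall>\<psi>\<in>schwartz. S (\<lambda>x. \<phi> x + \<psi> x) = S \<phi> + S \<psi>) \<and>
     (\<forall>c. \<forall>\<phi>\<in>schwartz. S (\<lambda>x. c * \<phi> x) = c * S \<phi>) \<and>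
     (\<exists>N C. \<forall>\<phi>\<in>schwartz. norm (S \<phi>) \<le> C * schwartz_seminorm N \<phi>)}"

definition tdist :: "('a::euclidean_space \<Rightarrow> complex) \<Rightarrow> ('a \<Rightarrow> complex) \<Rightarrow> complex" where
  "tdist f \<phi> = (LINT x|lebesgue. f x * \<phi> x)"

definition L2_represents ::
    "('a::euclidean_space \<Rightarrow> complex) \<Rightarrow> (('a \<Rightarrow> complex) \<Rightarrow> complex) \<Rightarrow> bool" where
  "L2_represents f S \<longleftrightarrow> f \<in> Lp 2 \<and> (\<forall>\<phi>\<in>schwartz. S \<phi> = tdist f \<phi>)"

section \<open>Fourier transform, Schroedinger group and weighted Sobolev spaces\<close>

definition fourier :: "('a::euclidean_space \<Rightarrow> complex) \<Rightarrow> 'a \<Rightarrow> complex" where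
  "fourier f \<xi> = ((2 * pi) powr (- (real DIM('a) / 2))) *\<^sub>R
     (LINT x|lebesgue. exp (- \<i> * complex_of_real (x \<bullet> \<xi>)) * f x)"

definition inv_fourier :: "('a::euclidean_space \<Rightarrow> complex) \<Rightarrow> 'a \<Rightarrow> complex" where
  "inv_fourier f x = ((2 * pi) powr (- (real DIM('a) / 2))) *\<^sub>R
     (LINT \<xi>|lebesgue. exp (\<i> * complex_of_real (x \<bullet> \<xi>)) * f \<xi>)"

text \<open>For \<open>f\<close> in \<open>L\<^sup>2\<close> the integral defining \<^term>\<open>fourier f\<close> need not converge. The transform on \<open>L\<^sup>2\<close>
  is the extension by duality to tempered distributions. By Plancherel's theorem a representing
  function exists, and it is unique almost everywhere.\<close>

definition fourier_L2 :: "('a::euclidean_space \<Rightarrow> complex) \<Rightarrow> 'a \<Rightarrow> complex" where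
  "fourier_L2 f = (SOME g. L2_represents g (\<lambda>\<phi>. tdist f (fourier \<phi>)))"

definition schrodinger ::
    "real \<Rightarrow> ('a::euclidean_space \<Rightarrow> complex) \<Rightarrow> 'a \<Rightarrow> complex" where
  \<comment> \<open>\<open>e\<^bsup>it\<Delta>\<^esup>\<close> on Schwartz functions\<close>
  "schrodinger t \<phi> =
     inv_fourier (\<lambda>\<xi>. exp (- \<i> * complex_of_real (t * (norm \<xi>)\<^sup>2)) * fourier \<phi> \<xi>)"

text \<open>The symbol of \<open>e\<^bsup>it\<Delta>\<^esup>\<close> is even, so the operator is its own transpose for the bilinear pairing.\<close>

definition schrodinger_dist :: "real \<Rightarrow> (('a::euclidean_space \<Rightarrow> complex) \<Rightarrow> complex) \<Rightarrow>
    ('a \<Rightarrow> complex) \<Rightarrow> complex" where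
  "schrodinger_dist t S \<phi> = S (schrodinger t \<phi>)"

definition schrodinger_L2 ::
    "real \<Rightarrow> ('a::euclidean_space \<Rightarrow> complex) \<Rightarrow> 'a \<Rightarrow> complex" where
  "schrodinger_L2 t f = (SOME g. L2_represents g (schrodinger_dist t (tdist f)))"

definition jbracket :: "'a::real_normed_vector \<Rightarrow> real" where
  "jbracket a = sqrt (1 + (norm a)\<^sup>2)"

definition bessel :: "real \<Rightarrow> ('a::euclidean_space \<Rightarrow> complex) \<Rightarrow> 'a \<Rightarrow> complex" where
  \<comment> \<open>\<open>\<langle>i\<nabla>\<rangle>\<^sup>m\<close> on Schwartz functions\<close>
  "bessel m \<phi> = inv_fourier (\<lambda>\<xi>. (jbracket \<xi> powr m) *\<^sub>R fourier \<phi> \<xi>)"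

text \<open>Both \<open>\<langle>i\<nabla>\<rangle>\<^sup>m\<close> and multiplication by \<open>\<langle>x\<rangle>\<^sup>s\<close> are their own transposes, so
  \<open>\<langle>i\<nabla>\<rangle>\<^sup>m \<langle>x\<rangle>\<^sup>s S\<close> maps \<open>\<phi>\<close> to \<open>S (\<langle>x\<rangle>\<^sup>s \<langle>i\<nabla>\<rangle>\<^sup>m \<phi>)\<close>.\<close>

definition weighted_sobolev ::
    "real \<Rightarrow> real \<Rightarrow> (('a::euclidean_space \<Rightarrow> complex) \<Rightarrow> complex) set" where
  "weighted_sobolev m s = {S \<in> tempered_distributions.
     \<exists>g. L2_represents g (\<lambda>\<phi>. S (\<lambda>x. (jbracket x powr s) *\<^sub>R bessel m \<phi> x))}"

section \<open>The nonlinearity\<close>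

definition homogeneous_nl :: "nat \<Rightarrow> (complex \<Rightarrow> complex) \<Rightarrow> bool" where
  "homogeneous_nl d F \<longleftrightarrow>
     (\<forall>z. \<forall>\<mu>::real. \<mu> > 0 \<longrightarrow> F (\<mu> *\<^sub>R z) = (\<mu> powr (1 + 2 / real d)) *\<^sub>R F z)"

definition nl_coeff :: "(complex \<Rightarrow> complex) \<Rightarrow> int \<Rightarrow> complex" where
  "nl_coeff F n = (1 / (2 * pi)) *\<^sub>R
     (LINT \<theta>:{0..2 * pi}|lebesgue. F (cis \<theta>) * exp (- \<i> * of_int n * complex_of_real \<theta>))"

definition nl_mode :: "nat \<Rightarrow> int \<Rightarrow> complex \<Rightarrow> complex" where
  \<comment> \<open>vanishes at \<open>z = 0\<close>, because \<open>0 powr a = 0\<close>\<close>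
  "nl_mode d n z = (norm z powr (1 + 2 / real d - of_int n)) *\<^sub>R (z powi n)"

section \<open>Solutions\<close>

text \<open>\<open>h = \<integral> U(t\<^sub>2 - s) G(s) ds\<close> over \<open>s\<close> from \<open>t\<^sub>1\<close> to \<open>t\<^sub>2\<close>, as an element of \<open>L\<^sup>2\<close>. For \<open>G = F(u)\<close>
  the integrand at time \<open>s\<close> is in general not in \<open>L\<^sup>2\<close>, only the integral is; so \<open>U(t\<^sub>2 - s)\<close> acts on
  tempered distributions, and the integral is the weak one against Schwartz functions. It is
  oriented: exchanging \<open>t\<^sub>1\<close> and \<open>t\<^sub>2\<close> as bounds changes the sign. For continuous
  \<open>F\<close>, homogeneous of degree \<open>1 + 2/d\<close>, the integrability conditions are automatic if \<open>u\<close> is continuous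
  in time with values in \<open>L\<^sup>2\<close> and locally in \<open>L\<^sup>q\<close> of space-time with \<open>q = 2(d+2)/d\<close>, by Hoelder's
  inequality.\<close>

definition is_duhamel_integral ::
    "(real \<Rightarrow> 'a::euclidean_space \<Rightarrow> complex) \<Rightarrow> real \<Rightarrow> real \<Rightarrow> ('a \<Rightarrow> complex) \<Rightarrow> bool" where
  "is_duhamel_integral G t1 t2 h \<longleftrightarrow>
     (AE s in lebesgue_on (closed_segment t1 t2).
        \<forall>\<phi>\<in>schwartz. integrable lebesgue (\<lambda>x. G s x * \<phi> x)) \<and>
     (\<forall>\<phi>\<in>schwartz. interval_lebesgue_integrable lebesgue (ereal t1) (ereal t2)
        (\<lambda>s. schrodinger_dist (t2 - s) (tdist (G s)) \<phi>)) \<and>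
     L2_represents h
       (\<lambda>\<phi>. LINT s=ereal t1..ereal t2|lebesgue. schrodinger_dist (t2 - s) (tdist (G s)) \<phi>)"

definition is_solution ::
    "(complex \<Rightarrow> complex) \<Rightarrow> real set \<Rightarrow> (real \<Rightarrow> 'a::euclidean_space \<Rightarrow> complex) \<Rightarrow> bool" where
  "is_solution F I u \<longleftrightarrow>
     (\<forall>t\<in>I. u t \<in> Lp 2) \<and>
     (\<forall>t\<in>I. ((\<lambda>s. Lp_norm 2 (\<lambda>x. u s x - u t x)) \<longlongrightarrow> 0) (at t within I)) \<and>
     (\<forall>K. compact K \<and> K \<subseteq> I \<longrightarrow>
        spacetime_norm (2 * (real DIM('a) + 2) / real DIM('a)) K u < top) \<and>
     (\<forall>t1\<in>I. \<forall>t2\<in>I. \<exists>h. is_duhamel_integral (\<lambda>s x. F (u s x)) t1 t2 h \<and>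
        (AE x in lebesgue. u t2 x = schrodinger_L2 (t2 - t1) (u t1) x - \<i> * h x))"

section \<open>The asymptotic profile\<close>

definition modulation ::
    "real \<Rightarrow> ('a::euclidean_space \<Rightarrow> complex) \<Rightarrow> 'a \<Rightarrow> complex" where
  "modulation t f x = exp (\<i> * complex_of_real ((norm x)\<^sup>2 / (4 * t))) * f x"

definition dilation ::
    "real \<Rightarrow> ('a::euclidean_space \<Rightarrow> complex) \<Rightarrow> 'a \<Rightarrow> complex" where
  \<comment> \<open>complex power, so that negative \<open>t\<close> is covered, with the principal branch\<close>
  "dilation t f x =
     (complex_of_real (2 * t) powr complex_of_real (- (real DIM('a) / 2))) *
     f ((1 / (2 * t)) *\<^sub>R x)"

definition profile ::
    "real \<Rightarrow> ('a::euclidean_space \<Rightarrow> complex) \<Rightarrow> real \<Rightarrow> 'a \<Rightarrow> complex" where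
  "profile lam up t x =
     exp (- \<i> * complex_of_real (real DIM('a) * pi / 4)) *
     modulation t (dilation t (\<lambda>\<xi>. fourier_L2 up \<xi> *
       exp (- \<i> * complex_of_real (lam * norm (fourier_L2 up \<xi>) powr (2 / real DIM('a)) * ln t)))) x"

end

theory Submission
  imports Defs "HOL-Probability.Probability"
begin

text \<open>Write \<open>W\<close> for the Fourier transform of \<open>u\<^sub>+\<close>, \<open>V\<close> for the profile and \<open>p = 1 + 2/d\<close>. The
  constant mode \<open>|u|\<^sup>p\<close> of the nonlinearity carries no phase: \<open>|V(s,x)|\<^sup>p = (2s)\<^sup>-\<^sup>1\<^sup>-\<^sup>d\<^sup>/\<^sup>2 |W(x/2s)|\<^sup>p\<close> lives at
  spatial scale \<open>s\<close>, hence at frequencies of order \<open>1/s\<close>, where the free group moves nothing over times of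
  order \<open>s\<close>. Tested against an \<open>L\<^sup>2\<close>-normalised Gaussian of width \<open>R\<close> (\<open>bump\<close>), its contribution to Duhamel's
  formula over a time interval comparable with \<open>[R, 3R]\<close> therefore has order one and a sign. Every
  other term vanishes as \<open>R\<close> tends to infinity, and this forces \<open>W = 0\<close>.

  Three facts make the other terms vanish.

  \<^item> Over times of order \<open>R\<close> the free evolution of the Gaussian stays within \<open>O(1/R)\<close> of the Gaussian in
    \<open>L\<^sup>2\<close> (\<open>nsq_schrodinger_bump_diff\<close>).

  \<^item> In the Duhamel integral \<open>u\<close> may be replaced by \<open>V\<close> (\<open>profile_almost_solves\<close>). By homogeneity \<open>F(u)\<close> lies in
    \<open>L\<^sup>2\<close> when \<open>u\<close> lies in \<open>L\<^sup>q\<close> with \<open>q = 2p = 2(d+2)/d\<close>, and the assumed decay of \<open>u - V\<close> says that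
    \<open>R\<close> times the integral of the \<open>q\<close>-th power tends to zero, which is what Cauchy--Schwarz in
    time over an interval of length \<open>R\<close> asks for. The modes of \<open>F\<close> enter here only through
    the continuity of \<open>F\<close> on the unit disc (\<open>homogeneous_continuity_estimate\<close>).

  \<^item> In the variable \<open>y = x/2s\<close> the \<open>n\<close>-th mode of \<open>F(V)\<close> has the phase
    \<open>n (s|y|\<^sup>2 - \<lambda>|W(y)|\<^sup>2\<^sup>/\<^sup>d log s - d\<pi>/4)\<close>. For fixed \<open>y\<close> and \<open>s = R\<sigma>\<close> it oscillates in \<open>\<sigma>\<close> at rate \<open>R\<close>, and
    the Riemann--Lebesgue lemma in time removes all modes with \<open>n \<noteq> 0\<close>
    (\<open>oscillating_pairing_tendsto\<close>). The boundary terms of Duhamel's formula are linear in \<open>V\<close>, so they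
    behave like a mode with \<open>n = 1\<close> and disappear after averaging over the starting time
    \<open>R\<sigma>\<close>, \<open>\<sigma> \<in> [1, 2]\<close> (\<open>profile_vanishes\<close>).

  The transform and the free group act on \<open>L\<^sup>2\<close> because the Fourier integral does not increase the
  \<open>L\<^sup>2\<close> norm (\<open>nsq_fourier_le\<close>), and \<open>W = 0\<close> gives \<open>u\<^sub>+ = 0\<close> by \<open>fourier_injective\<close>.\<close>

section \<open>Square integrable functions\<close>

definition nsq :: "('a::euclidean_space \<Rightarrow> complex) \<Rightarrow> ennreal" where
  "nsq f = (\<integral>\<^sup>+ x. ennreal ((norm (f x))\<^sup>2) \<partial>lborel)"

lemma epowr_ennreal: "0 \<le> r \<Longrightarrow> epowr (ennreal r) p = ennreal (r powr p)"
  by (simp add: epowr_def)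

lemma epowr_eq_top: "epowr x p = top \<longleftrightarrow> x = top"
  by (simp add: epowr_def)

lemma epowr_epowr: "p > 0 \<Longrightarrow> epowr (epowr x (1 / p)) p = x"
  by (cases x) (auto simp: epowr_def powr_powr)

lemma Lp_norm_epowr:
  assumes "p > 0"
  shows "epowr (Lp_norm p f) p = (\<integral>\<^sup>+ x. ennreal (norm (f x) powr p) \<partial>lborel)"
  unfolding Lp_norm_def eLp_def using assms
  by (simp add: epowr_epowr epowr_ennreal nn_integral_completion)

lemma Lp_norm_less_top:
  assumes "p > 0"
  shows "Lp_norm p f < top \<longleftrightarrow> (\<integral>\<^sup>+ x. ennreal (norm (f x) powr p) \<partial>lborel) < top"
  using Lp_norm_epowr[OF assms, of f] epowr_eq_top[of "Lp_norm p f" p]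
  by (auto simp: less_top[symmetric])

lemma nsq_eq_epowr: "nsq f = epowr (Lp_norm 2 f) 2"
  by (simp add: Lp_norm_epowr nsq_def)

lemma Lp2_iff: "f \<in> Lp 2 \<longleftrightarrow> f \<in> borel_measurable lebesgue \<and> nsq f < top"
  by (simp add: Lp_def Lp_norm_less_top nsq_def)

lemma nsq_cong_AE: "AE x in lborel. f x = g x \<Longrightarrow> nsq f = nsq g"
  unfolding nsq_def by (intro nn_integral_cong_AE) auto

text \<open>Fubini and substitution are applied on products of Borel measures, so a function that is
  measurable for the completed measure is first replaced by a Borel representative.\<close>

lemma lebesgue_borel_representative:
  fixes f :: "'a::euclidean_space \<Rightarrow> complex"
  assumes "f \<in> borel_measurable lebesgue"
  obtains g where "g \<in> borel_measurable borel" "AE x in lborel. f x = g x"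
proof -
  have "(\<lambda>x. Re (f x)) \<in> borel_measurable lebesgue" "(\<lambda>x. Im (f x)) \<in> borel_measurable lebesgue"
    using assms by measurable
  then obtain a b where ab: "a \<in> borel_measurable lborel" "AE x in lborel. Re (f x) = a x"
      "b \<in> borel_measurable lborel" "AE x in lborel. Im (f x) = b x"
    using completion_ex_borel_measurable_real by metis
  show thesis
  proof
    show "(\<lambda>x. Complex (a x) (b x)) \<in> borel_measurable borel"
      using ab(1,3) by (simp add: Complex_eq)
    show "AE x in lborel. f x = Complex (a x) (b x)"
      using ab(2,4) by eventually_elim (simp add: complex_eq_iff)
  qed
qed

lemma lebesgue_integral_eq_lborel:
  fixes f :: "'a::euclidean_space \<Rightarrow> 'b::{banach, second_countable_topology}"
  assumes "f \<in> borel_measurable lebesgue" "g \<in> borel_measurable borel" "AE x in lborel. f x = g x"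
  shows "integral\<^sup>L lebesgue f = integral\<^sup>L lborel g"
proof -
  have g: "g \<in> borel_measurable lebesgue" using assms(2) by (simp add: measurable_completion)
  have ae: "AE x in lebesgue. f x = g x" using assms(3) by (rule AE_completion)
  show "integral\<^sup>L lebesgue f = integral\<^sup>L lborel g"
    using integral_cong_AE[OF assms(1) g ae] assms(2) by (simp add: integral_completion)
qed

lemma nsq_add_le: "f \<in> borel_measurable borel \<Longrightarrow> g \<in> borel_measurable borel \<Longrightarrow>
   nsq (\<lambda>x. f x + g x) \<le> 2 * nsq f + 2 * nsq g"
proof -
  assume [measurable]: "f \<in> borel_measurable borel" "g \<in> borel_measurable borel"
  have *: "(norm (a + b))\<^sup>2 \<le> 2 * (norm a)\<^sup>2 + 2 * (norm b)\<^sup>2" for a b :: complex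
  proof -
    have "(norm (a + b))\<^sup>2 \<le> (norm a + norm b)\<^sup>2"
      by (intro power_mono norm_triangle_ineq) auto
    also have "\<dots> \<le> 2 * (norm a)\<^sup>2 + 2 * (norm b)\<^sup>2"
      using sum_squares_ge_zero[of "norm a - norm b" 0] by (simp add: power2_eq_square algebra_simps)
    finally show ?thesis .
  qed
  then have "nsq (\<lambda>x. f x + g x) \<le> (\<integral>\<^sup>+ x. 2 * ennreal ((norm (f x))\<^sup>2) + 2 * ennreal ((norm (g x))\<^sup>2) \<partial>lborel)"
    unfolding nsq_def
  proof (intro nn_integral_mono)
    fix x
    have "ennreal ((norm (f x + g x))\<^sup>2) \<le> ennreal (2 * (norm (f x))\<^sup>2 + 2 * (norm (g x))\<^sup>2)"
      by (intro ennreal_leI *)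
    then show "ennreal ((norm (f x + g x))\<^sup>2) \<le> 2 * ennreal ((norm (f x))\<^sup>2) + 2 * ennreal ((norm (g x))\<^sup>2)"
      by (simp add: ennreal_mult)
  qed
  also have "\<dots> = 2 * nsq f + 2 * nsq g"
    unfolding nsq_def by (subst nn_integral_add) (auto simp: nn_integral_cmult)
  finally show ?thesis .
qed

lemma nsq_cmult: "f \<in> borel_measurable borel \<Longrightarrow> nsq (\<lambda>x. c * f x) = ennreal ((norm c)\<^sup>2) * nsq f"
  unfolding nsq_def by (simp add: norm_mult power_mult_distrib ennreal_mult nn_integral_cmult)

lemma integrable_mult_nsq:
  assumes "f \<in> borel_measurable borel" "g \<in> borel_measurable borel" "nsq f < top" "nsq g < top"
  shows "integrable lborel (\<lambda>x. f x * g x)"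
    and "ennreal ((norm (LINT x|lborel. f x * g x))\<^sup>2) \<le> nsq f * nsq g"
proof -
  note [measurable] = assms(1,2)
  let ?J = "\<integral>\<^sup>+ x. ennreal (norm (f x * g x)) \<partial>lborel"
  have cs: "?J\<^sup>2 \<le> nsq f * nsq g"
    using Cauchy_Schwarz_nn_integral[of "\<lambda>x. ennreal (norm (f x))" lborel "\<lambda>x. ennreal (norm (g x))"]
    by (simp add: nsq_def norm_mult ennreal_mult ennreal_power)
  also have "\<dots> < top" using assms(3,4) by (simp add: ennreal_mult_less_top)
  finally have "?J < top" by (simp add: power_less_top_ennreal)
  then show i: "integrable lborel (\<lambda>x. f x * g x)" by (simp add: integrable_iff_bounded)
  have "ennreal (norm (LINT x|lborel. f x * g x)) \<le> ?J"
    by (intro integral_norm_bound_ennreal i)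
  then have "(ennreal (norm (LINT x|lborel. f x * g x)))\<^sup>2 \<le> ?J\<^sup>2"
    by (rule power_mono) simp
  also note cs
  finally show "ennreal ((norm (LINT x|lborel. f x * g x))\<^sup>2) \<le> nsq f * nsq g"
    by (simp add: ennreal_power)
qed

text \<open>The \<open>q\<close>-th power of the \<open>L\<^sup>q\<close> norm; its values are extended because finiteness is part of what is proved.\<close>

definition pmass :: "real \<Rightarrow> ('a::euclidean_space \<Rightarrow> complex) \<Rightarrow> ennreal" where
  "pmass q f = (\<integral>\<^sup>+ x. ennreal (norm (f x) powr q) \<partial>lborel)"

lemma nsq_eq_pmass: "nsq f = pmass 2 f"
  by (simp add: nsq_def pmass_def)

lemma pmass_Fatou:
  fixes f :: "nat \<Rightarrow> 'a::euclidean_space \<Rightarrow> complex"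
  assumes "\<And>n. f n \<in> borel_measurable borel" "AE x in lborel. (\<lambda>n. f n x) \<longlonglongrightarrow> g x"
    and "\<forall>\<^sub>F n in sequentially. pmass q (f n) \<le> B" and q: "q > 0"
  shows "pmass q g \<le> B"
proof -
  note [measurable] = assms(1)
  have "pmass q g = (\<integral>\<^sup>+ x. liminf (\<lambda>n. ennreal (norm (f n x) powr q)) \<partial>lborel)"
    unfolding pmass_def
  proof (rule nn_integral_cong_AE)
    show "AE x in lborel. ennreal (norm (g x) powr q) = liminf (\<lambda>n. ennreal (norm (f n x) powr q))"
      using assms(2)
    proof eventually_elim
      case (elim x)
      have "(\<lambda>n. norm (f n x) powr q) \<longlonglongrightarrow> norm (g x) powr q"
        using q by (intro tendsto_powr' tendsto_norm elim tendsto_const) auto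
      then have "(\<lambda>n. ennreal (norm (f n x) powr q)) \<longlonglongrightarrow> ennreal (norm (g x) powr q)"
        by (rule tendsto_ennrealI)
      then show ?case using lim_imp_Liminf[OF sequentially_bot] by metis
    qed
  qed
  also have "\<dots> \<le> liminf (\<lambda>n. pmass q (f n))"
    unfolding pmass_def by (intro nn_integral_liminf) measurable
  also have "\<dots> \<le> liminf (\<lambda>n::nat. B)"
    by (intro Liminf_mono assms(3))
  also have "\<dots> = B" by (simp add: Liminf_const)
  finally show ?thesis .
qed

section \<open>Gaussian integrals\<close>

text \<open>A rescaling of the characteristic function of the standard normal distribution.\<close>

lemma gaussian_fourier_real:
  fixes a z :: real
  assumes "a > 0"
  shows "has_bochner_integral lborel (\<lambda>x. exp (\<i> * of_real (z * x)) * of_real (exp (- a * x\<^sup>2)))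
     (complex_of_real (sqrt (pi / a) * exp (- z\<^sup>2 / (4 * a))))"
proof -
  define s where "s = sqrt (2 * a)"
  have s: "s > 0" "s\<^sup>2 = 2 * a" using assms by (auto simp: s_def)
  define t where "t = z / s"
  let ?f = "\<lambda>x. exp (\<i> * of_real (t * x)) * of_real (exp (- x\<^sup>2 / 2)) :: complex"
  have eq: "?f x = sqrt (2 * pi) *\<^sub>R (std_normal_density x *\<^sub>R iexp (t * x))" for x
    by (simp add: normal_density_def scaleR_conv_of_real)
  have int: "integrable lborel (\<lambda>x. std_normal_density x *\<^sub>R iexp (t * x))"
  proof (rule Bochner_Integration.integrable_bound)
    show "integrable lborel std_normal_density" by simp
  qed (auto simp: normal_density_nonneg)
  have "char std_normal_distribution t = (LINT x|lborel. std_normal_density x *\<^sub>R iexp (t * x))"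
    unfolding char_def by (subst integral_density) (auto simp: normal_density_nonneg)
  then have "has_bochner_integral lborel (\<lambda>x. std_normal_density x *\<^sub>R iexp (t * x)) (of_real (exp (- t\<^sup>2 / 2)))"
    using int by (simp add: has_bochner_integral_iff char_std_normal_distribution)
  then have "has_bochner_integral lborel ?f (sqrt (2 * pi) *\<^sub>R of_real (exp (- t\<^sup>2 / 2)))"
    unfolding eq by (intro has_bochner_integral_scaleR_right) auto
  then have "has_bochner_integral lborel (\<lambda>x. ?f (0 + s * x)) ((sqrt (2 * pi) *\<^sub>R complex_of_real (exp (- t\<^sup>2 / 2))) /\<^sub>R \<bar>s\<bar>)"
    using s by (subst lborel_has_bochner_integral_real_affine_iff[symmetric]) auto
  moreover have "?f (0 + s * x) = exp (\<i> * of_real (z * x)) * of_real (exp (- a * x\<^sup>2))" for x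
    using s by (simp add: t_def power_mult_distrib)
  moreover have "(sqrt (2 * pi) *\<^sub>R complex_of_real (exp (- t\<^sup>2 / 2))) /\<^sub>R \<bar>s\<bar> =
      complex_of_real (sqrt (pi / a) * exp (- z\<^sup>2 / (4 * a)))"
  proof -
    have 1: "- t\<^sup>2 / 2 = - z\<^sup>2 / (4 * a)" using s by (simp add: t_def power_divide)
    have 2: "sqrt (2 * pi) / s = sqrt (pi / a)"
      unfolding s_def by (simp add: real_sqrt_divide[symmetric])
    have "(sqrt (2 * pi) *\<^sub>R complex_of_real (exp (- t\<^sup>2 / 2))) /\<^sub>R \<bar>s\<bar> =
      complex_of_real ((sqrt (2 * pi) / s) * exp (- t\<^sup>2 / 2))"
      using s(1) by (simp add: scaleR_conv_of_real field_simps)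
    then show ?thesis unfolding 1 2 .
  qed
  ultimately show ?thesis by simp
qed

lemma has_bochner_integral_lborel_prod:
  fixes f :: "'a::euclidean_space \<Rightarrow> real \<Rightarrow> complex"
  assumes "\<And>b. b \<in> Basis \<Longrightarrow> has_bochner_integral lborel (f b) (v b)"
  shows "has_bochner_integral lborel (\<lambda>x::'a. \<Prod>b\<in>Basis. f b (x \<bullet> b)) (\<Prod>b\<in>Basis. v b)"
proof -
  interpret product_sigma_finite "\<lambda>_. lborel :: real measure" by standard
  have int: "integrable lborel (f b)" "integral\<^sup>L lborel (f b) = v b" if "b \<in> Basis" for b
    using assms[OF that] by (auto simp: has_bochner_integral_iff)
  have m[measurable]: "f b \<in> borel_measurable borel" if "b \<in> Basis" for b
    using int(1)[OF that] by (simp add: integrable_iff_bounded)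
  have T: "(\<lambda>g. \<Sum>b\<in>Basis. g b *\<^sub>R b) \<in> (\<Pi>\<^sub>M b\<in>(Basis::'a set). lborel) \<rightarrow>\<^sub>M (borel :: 'a measure)"
    by measurable
  have F: "(\<lambda>x::'a. \<Prod>b\<in>Basis. f b (x \<bullet> b)) \<in> borel_measurable borel" by measurable
  have inner: "(\<Sum>b\<in>Basis. g b *\<^sub>R b) \<bullet> c = g c" if "c \<in> Basis" for g :: "'a \<Rightarrow> real" and c
    using that by simp
  have e: "(\<Prod>b\<in>Basis. f b ((\<Sum>b\<in>Basis. g b *\<^sub>R b) \<bullet> b)) = (\<Prod>b\<in>Basis. f b (g b))" for g
    by (intro prod.cong) auto
  have "integrable lborel (\<lambda>x::'a. \<Prod>b\<in>Basis. f b (x \<bullet> b))"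
    apply (subst lborel_eq, subst integrable_distr_eq[OF T F])
    unfolding e by (intro product_integrable_prod int) auto
  moreover have "integral\<^sup>L lborel (\<lambda>x::'a. \<Prod>b\<in>Basis. f b (x \<bullet> b)) = (\<Prod>b\<in>Basis. v b)"
    apply (subst lborel_eq, subst integral_distr[OF T F])
    unfolding e by (subst product_integral_prod) (auto simp: int)
  ultimately show ?thesis by (simp add: has_bochner_integral_iff)
qed

lemma gaussian_fourier:
  fixes z :: "'a::euclidean_space" and a :: real
  assumes "a > 0"
  shows "has_bochner_integral lborel (\<lambda>x. exp (\<i> * of_real (z \<bullet> x)) * of_real (exp (- a * (norm x)\<^sup>2)))
     (complex_of_real ((pi / a) powr (DIM('a) / 2) * exp (- (norm z)\<^sup>2 / (4 * a))))"
proof -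
  have n: "(norm x)\<^sup>2 = (\<Sum>b\<in>Basis. (x \<bullet> b)\<^sup>2)" for x :: 'a
    unfolding power2_norm_eq_inner by (subst euclidean_inner) (simp add: power2_eq_square)
  have 1: "(\<Prod>b\<in>Basis. exp (\<i> * of_real ((z \<bullet> b) * (x \<bullet> b))) * of_real (exp (- a * (x \<bullet> b)\<^sup>2))) =
     exp (\<i> * of_real (z \<bullet> x)) * complex_of_real (exp (- a * (norm x)\<^sup>2))" for x :: 'a
    unfolding n euclidean_inner[of z x]
    by (simp add: prod.distrib exp_sum[symmetric] sum_distrib_left sum_negf exp_of_real[symmetric] of_real_prod[symmetric] del: of_real_exp)
  have 2: "(\<Prod>b\<in>Basis. complex_of_real (sqrt (pi / a) * exp (- (z \<bullet> b)\<^sup>2 / (4 * a)))) =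
    complex_of_real ((pi / a) powr (DIM('a) / 2) * exp (- (norm z)\<^sup>2 / (4 * a)))"
  proof -
    have "sqrt (pi / a) ^ DIM('a) = (pi / a) powr (DIM('a) / 2)"
      using assms by (simp add: powr_half_sqrt[symmetric] powr_powr powr_realpow[symmetric])
    then show ?thesis
      unfolding n of_real_prod[symmetric]
      by (simp add: prod.distrib exp_sum[symmetric] sum_negf sum_divide_distrib)
  qed
  show ?thesis
    using has_bochner_integral_lborel_prod[of "\<lambda>b x. exp (\<i> * of_real ((z \<bullet> b) * x)) * of_real (exp (- a * x\<^sup>2))"
        "\<lambda>b. complex_of_real (sqrt (pi / a) * exp (- (z \<bullet> b)\<^sup>2 / (4 * a)))"] gaussian_fourier_real[OF assms]
    unfolding 1 2 by blast
qed

section \<open>The Fourier integral on integrable functions\<close>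

lemma inv_fourier_eq: "inv_fourier f x = fourier f (- x)"
  by (simp add: inv_fourier_def fourier_def inner_commute)

lemma fourier_borel:
  fixes h :: "'a::euclidean_space \<Rightarrow> complex"
  assumes [measurable]: "h \<in> borel_measurable borel"
  shows "fourier h \<xi> = ((2 * pi) powr (- (real DIM('a) / 2))) *\<^sub>R
     (LINT x|lborel. exp (- \<i> * complex_of_real (x \<bullet> \<xi>)) * h x)"
  unfolding fourier_def by (subst integral_completion) simp_all

lemma borel_measurable_fourier [measurable]:
  fixes h :: "'a::euclidean_space \<Rightarrow> complex"
  assumes [measurable]: "h \<in> borel_measurable borel"
  shows "fourier h \<in> borel_measurable borel"
  unfolding fourier_borel[OF assms, abs_def] by measurable

lemma integrable_character_mult:
  fixes h :: "'a::euclidean_space \<Rightarrow> complex"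
  assumes "integrable lborel h"
  shows "integrable lborel (\<lambda>x. exp (- \<i> * complex_of_real (x \<bullet> \<xi>)) * h x)"
proof (rule Bochner_Integration.integrable_bound[OF assms])
  have [measurable]: "h \<in> borel_measurable borel" using assms by (simp add: integrable_iff_bounded)
  show "(\<lambda>x. exp (- \<i> * complex_of_real (x \<bullet> \<xi>)) * h x) \<in> borel_measurable lborel" by simp
qed (simp add: norm_mult)

lemma norm_fourier_le:
  fixes h :: "'a::euclidean_space \<Rightarrow> complex"
  assumes "integrable lborel h"
  shows "norm (fourier h \<xi>) \<le> (2 * pi) powr (- (real DIM('a) / 2)) * (LINT x|lborel. norm (h x))"
proof -
  have [measurable]: "h \<in> borel_measurable borel" using assms by (simp add: integrable_iff_bounded)
  have "norm (LINT x|lborel. exp (- \<i> * complex_of_real (x \<bullet> \<xi>)) * h x) \<le>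
     (LINT x|lborel. norm (exp (- \<i> * complex_of_real (x \<bullet> \<xi>)) * h x))"
    by (rule integral_norm_bound)
  also have "\<dots> = (LINT x|lborel. norm (h x))" by (simp add: norm_mult)
  finally show ?thesis by (simp add: fourier_borel mult_left_mono)
qed

lemma fourier_multiplication:
  fixes h k :: "'a::euclidean_space \<Rightarrow> complex"
  assumes "integrable lborel h" "integrable lborel k"
  shows "(LINT x|lborel. fourier h x * k x) = (LINT x|lborel. h x * fourier k x)"
proof -
  have [measurable]: "h \<in> borel_measurable borel" "k \<in> borel_measurable borel"
    using assms by (auto simp: integrable_iff_bounded)
  let ?c = "(2 * pi) powr (- (real DIM('a) / 2))"
  let ?e = "\<lambda>x y::'a. exp (- \<i> * complex_of_real (x \<bullet> y))"
  have "integrable (lborel \<Otimes>\<^sub>M lborel) (\<lambda>(x, y). h x * k y)"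
    using assms by (intro lborel_pair.Fubini_integrable) (auto simp: norm_mult)
  then have int: "integrable (lborel \<Otimes>\<^sub>M lborel) (\<lambda>(x, y). ?e x y * (h x * k y))"
    by (rule Bochner_Integration.integrable_bound) (auto simp: norm_mult)
  have "(LINT y|lborel. fourier h y * k y) = (LINT y|lborel. ?c *\<^sub>R (LINT x|lborel. ?e x y * (h x * k y)))"
    by (simp add: fourier_borel mult.assoc[symmetric])
  also have "\<dots> = ?c *\<^sub>R (LINT y|lborel. LINT x|lborel. ?e x y * (h x * k y))"
    by simp
  also have "(LINT y|lborel. LINT x|lborel. ?e x y * (h x * k y)) =
     (LINT x|lborel. LINT y|lborel. ?e x y * (h x * k y))"
    using lborel_pair.Fubini_integral[OF int] by simp
  also have "?c *\<^sub>R \<dots> = (LINT x|lborel. ?c *\<^sub>R (LINT y|lborel. ?e x y * (h x * k y)))"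
    by simp
  also have "\<dots> = (LINT x|lborel. h x * fourier k x)"
  proof (intro Bochner_Integration.integral_cong refl)
    fix x
    have "(LINT y|lborel. ?e x y * (h x * k y)) = h x * (LINT y|lborel. ?e y x * k y)"
      unfolding integral_mult_right_zero[symmetric]
      by (intro Bochner_Integration.integral_cong refl) (simp add: inner_commute mult_ac)
    then show "?c *\<^sub>R (LINT y|lborel. ?e x y * (h x * k y)) = h x * fourier k x"
      by (simp add: fourier_borel)
  qed
  finally show ?thesis .
qed

lemma fourier_gaussian:
  fixes z \<xi> :: "'a::euclidean_space"
  assumes "a > 0"
  shows "integrable lborel (\<lambda>x. exp (\<i> * of_real (z \<bullet> x)) * of_real (exp (- a * (norm x)\<^sup>2)) :: complex)"
    and "fourier (\<lambda>x. exp (\<i> * of_real (z \<bullet> x)) * of_real (exp (- a * (norm x)\<^sup>2))) \<xi> =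
     of_real ((2 * a) powr (- (DIM('a) / 2)) * exp (- (norm (\<xi> - z))\<^sup>2 / (4 * a)))"
proof -
  show "integrable lborel (\<lambda>x. exp (\<i> * of_real (z \<bullet> x)) * of_real (exp (- a * (norm x)\<^sup>2)) :: complex)"
    using gaussian_fourier[OF assms, of z] by (simp add: has_bochner_integral_iff)
  have "exp (- \<i> * complex_of_real (x \<bullet> \<xi>)) * (exp (\<i> * of_real (z \<bullet> x)) * of_real (exp (- a * (norm x)\<^sup>2))) =
     exp (\<i> * of_real ((z - \<xi>) \<bullet> x)) * of_real (exp (- a * (norm x)\<^sup>2))" for x
    by (simp add: inner_diff_left inner_commute algebra_simps exp_diff exp_minus field_simps)
  moreover have "(2 * pi) powr (- (real DIM('a) / 2)) * ((pi / a) powr (DIM('a) / 2)) = (2 * a) powr (- (DIM('a) / 2))"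
    using assms by (simp add: powr_minus powr_divide powr_mult field_simps)
  ultimately show "fourier (\<lambda>x. exp (\<i> * of_real (z \<bullet> x)) * of_real (exp (- a * (norm x)\<^sup>2))) \<xi> =
     of_real ((2 * a) powr (- (DIM('a) / 2)) * exp (- (norm (\<xi> - z))\<^sup>2 / (4 * a)))"
    using gaussian_fourier[OF assms, of "z - \<xi>"]
    by (simp add: fourier_borel has_bochner_integral_iff scaleR_conv_of_real norm_minus_commute
        mult.assoc[symmetric] flip: of_real_mult)
qed

lemma gaussian_total_mass:
  fixes y :: "'a::euclidean_space"
  assumes "a > 0"
  shows "(\<integral>\<^sup>+ x. ennreal ((pi / a) powr (- (DIM('a) / 2)) * exp (- a * (norm (x - y))\<^sup>2)) \<partial>lborel) = 1"
proof -
  have 0: "(\<lambda>x::'a. of_real (exp (- a * (norm x)\<^sup>2)) :: complex) = (\<lambda>x. exp (\<i> * of_real (0 \<bullet> x)) * of_real (exp (- a * (norm x)\<^sup>2)))"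
    by simp
  have "has_bochner_integral lborel (\<lambda>x::'a. of_real (exp (- a * (norm x)\<^sup>2)) :: complex) (of_real ((pi / a) powr (DIM('a) / 2)))"
    using gaussian_fourier[OF assms, of "0::'a"] unfolding 0 by simp
  then have "has_bochner_integral lborel (\<lambda>x::'a. exp (- a * (norm x)\<^sup>2)) ((pi / a) powr (DIM('a) / 2))"
    using has_bochner_integral_Re by fastforce
  then have *: "has_bochner_integral lborel (\<lambda>x::'a. (pi / a) powr (- (DIM('a) / 2)) * exp (- a * (norm x)\<^sup>2)) 1"
    using has_bochner_integral_mult_right[of "(pi / a) powr (- (DIM('a) / 2))" lborel _ "(pi / a) powr (DIM('a) / 2)"] assms
    by (fastforce simp: powr_minus)
  let ?g = "\<lambda>x::'a. ennreal ((pi / a) powr (- (DIM('a) / 2)) * exp (- a * (norm x)\<^sup>2))"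
  have "(\<integral>\<^sup>+ x. ?g (x - y) \<partial>lborel) = (\<integral>\<^sup>+ x. ?g x \<partial>lborel)"
    by (subst (2) lborel_affine[of 1 "-y"]) (simp_all add: nn_integral_density nn_integral_distr)
  also have "\<dots> = 1"
    using * by (simp add: nn_integral_eq_integral has_bochner_integral_iff)
  finally show ?thesis .
qed

text \<open>After damping with \<open>exp (-\<epsilon>|\<xi>|\<^sup>2)\<close> the left-hand side becomes a quadratic form in \<open>h\<close> whose kernel is
  a Gaussian of total mass one, so Schur's test bounds it by the norm of \<open>h\<close>.\<close>

lemma nsq_fourier_le:
  fixes h :: "'a::euclidean_space \<Rightarrow> complex"
  assumes h: "integrable lborel h"
  shows "nsq (fourier h) \<le> nsq h"
proof -
  have hm[measurable]: "h \<in> borel_measurable borel" using assms by (auto simp: integrable_iff_bounded)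
  have key: "(\<integral>\<^sup>+ \<xi>. ennreal ((norm (fourier h \<xi>))\<^sup>2 * exp (- e * (norm \<xi>)\<^sup>2)) \<partial>lborel) \<le> nsq h" if e: "e > 0" for e
  proof -
    let ?E = "\<lambda>\<xi>::'a. complex_of_real (exp (- e * (norm \<xi>)\<^sup>2))"
    \<comment> \<open>pairing the transform of \<open>h\<close> with \<open>k\<close> gives the damped norm, and the transform of \<open>k\<close> is a Gaussian average of the conjugate of \<open>h\<close>\<close>
    let ?k = "\<lambda>\<xi>. cnj (fourier h \<xi>) * ?E \<xi>"
    let ?c = "(2 * pi) powr (- (real DIM('a) / 2))"
    define G where "G w = (4 * pi * e) powr (- (DIM('a) / 2)) * exp (- (norm w)\<^sup>2 / (4 * e))" for w :: 'a
    have G0: "G w \<ge> 0" for w by (simp add: G_def)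
    have [measurable]: "G \<in> borel_measurable borel" unfolding G_def by simp
    have Gmass: "(\<integral>\<^sup>+ x. ennreal (G (x - y)) \<partial>lborel) = 1" for y
      using gaussian_total_mass[of "1 / (4 * e)" y] e unfolding G_def by (simp add: mult_ac)
    have Gsym: "G (x - y) = G (y - x)" for x y by (simp add: G_def norm_minus_commute)
    have intE: "integrable lborel ?E"
      using fourier_gaussian(1)[OF e, of "0::'a"] by simp
    have [measurable]: "cnj \<in> borel_measurable borel"
      by (intro borel_measurable_continuous_onI continuous_intros)
    have [measurable]: "(\<lambda>\<xi>. cnj (fourier h \<xi>)) \<in> borel_measurable borel" by measurable
    have [measurable]: "?E \<in> borel_measurable borel" by simp
    have intk: "integrable lborel ?k"
    proof (rule Bochner_Integration.integrable_bound)
      show "integrable lborel (\<lambda>\<xi>. (?c * (LINT x|lborel. norm (h x))) *\<^sub>R ?E \<xi>)" using intE by simp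
      show "AE \<xi> in lborel. norm (?k \<xi>) \<le> norm ((?c * (LINT x|lborel. norm (h x))) *\<^sub>R ?E \<xi>)"
        using norm_fourier_le[OF h]
        by (intro AE_I2) (auto simp: norm_mult intro!: mult_right_mono order_trans[OF norm_fourier_le[OF h]])
    qed measurable
    have fk: "fourier ?k x = (LINT y|lborel. cnj (h y) * of_real (G (y - x)))" for x
    proof -
      let ?Ex = "\<lambda>\<xi>. exp (\<i> * of_real ((-x) \<bullet> \<xi>)) * ?E \<xi>"
      have h': "integrable lborel (\<lambda>y. cnj (h (- y)))" 
      proof -
        have "integrable (distr lborel borel uminus) h"
          using h lborel_affine[of "-1" "0::'a"] by (simp add: density_1)
        then have "integrable lborel (\<lambda>y. h (- y))" by (subst (asm) integrable_distr_eq) auto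
        then show ?thesis by simp
      qed
      have "fourier (\<lambda>y. cnj (h (- y))) \<xi> = cnj (fourier h \<xi>)" for \<xi>
      proof -
        have "(LINT y|lborel. exp (- \<i> * complex_of_real (y \<bullet> \<xi>)) * cnj (h (- y))) =
          (LINT y|distr lborel borel uminus. exp (\<i> * complex_of_real (y \<bullet> \<xi>)) * cnj (h y))"
          by (subst integral_distr) auto
        also have "\<dots> = (LINT y|lborel. exp (\<i> * complex_of_real (y \<bullet> \<xi>)) * cnj (h y))"
          using lborel_affine[of "-1" "0::'a"] by (simp add: density_1)
        also have "\<dots> = (LINT y|lborel. cnj (exp (- \<i> * complex_of_real (y \<bullet> \<xi>)) * h y))"
          by (simp add: exp_cnj)
        also have "\<dots> = cnj (LINT y|lborel. exp (- \<i> * complex_of_real (y \<bullet> \<xi>)) * h y)"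
          by (rule Bochner_Integration.integral_cnj)
        finally show ?thesis by (simp add: fourier_borel)
      qed
      moreover have "fourier ?k x = ?c *\<^sub>R (LINT \<xi>|lborel. cnj (fourier h \<xi>) * ?Ex \<xi>)"
        by (simp add: fourier_borel inner_commute mult_ac)
      ultimately have "fourier ?k x = ?c *\<^sub>R (LINT \<xi>|lborel. fourier (\<lambda>y. cnj (h (- y))) \<xi> * ?Ex \<xi>)"
        by simp
      also have "\<dots> = ?c *\<^sub>R (LINT y|lborel. cnj (h (- y)) * fourier ?Ex y)"
        using fourier_multiplication[OF h' fourier_gaussian(1)[OF e, of "-x"]] by simp
      also have "\<dots> = (LINT y|lborel. cnj (h (- y)) * of_real (G (- y - x)))"
      proof -
        have c: "?c * (2 * e) powr (- (DIM('a) / 2)) = (4 * pi * e) powr (- (DIM('a) / 2))"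
          using e by (simp add: powr_mult[symmetric] mult_ac)
        have "norm (y + x) = norm (- y - x)" for y using norm_minus_cancel[of "y + x"] by simp
        then have "?c *\<^sub>R (cnj (h (- y)) * fourier ?Ex y) = cnj (h (- y)) * of_real (G (- y - x))" for y
          unfolding fourier_gaussian(2)[OF e] G_def c[symmetric] by (simp add: scaleR_conv_of_real mult_ac)
        then show ?thesis by (simp flip: integral_scaleR_right)
      qed
      also have "\<dots> = (LINT y|distr lborel borel uminus. cnj (h y) * of_real (G (y - x)))"
        by (subst integral_distr) auto
      also have "\<dots> = (LINT y|lborel. cnj (h y) * of_real (G (y - x)))"
        using lborel_affine[of "-1" "0::'a"] by (simp add: density_1)
      finally show ?thesis .
    qed
    have "(LINT \<xi>|lborel. fourier h \<xi> * ?k \<xi>) = (LINT x|lborel. h x * fourier ?k x)"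
      by (rule fourier_multiplication[OF h intk])
    moreover have "fourier h \<xi> * ?k \<xi> = of_real ((norm (fourier h \<xi>))\<^sup>2 * exp (- e * (norm \<xi>)\<^sup>2))" for \<xi>
      using complex_norm_square[of "fourier h \<xi>"] by (simp add: mult.assoc[symmetric])
    ultimately have eq: "(LINT \<xi>|lborel. of_real ((norm (fourier h \<xi>))\<^sup>2 * exp (- e * (norm \<xi>)\<^sup>2))) = (LINT x|lborel. h x * fourier ?k x)"
      by (simp only:)
    have intL: "integrable lborel (\<lambda>\<xi>. (norm (fourier h \<xi>))\<^sup>2 * exp (- e * (norm \<xi>)\<^sup>2))"
    proof (rule Bochner_Integration.integrable_bound)
      show "integrable lborel (\<lambda>\<xi>. (?c * (LINT x|lborel. norm (h x))) *\<^sub>R ?k \<xi>)" using intk by simp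
      show "AE \<xi> in lborel. norm ((norm (fourier h \<xi>))\<^sup>2 * exp (- e * (norm \<xi>)\<^sup>2)) \<le> norm ((?c * (LINT x|lborel. norm (h x))) *\<^sub>R ?k \<xi>)"
        using norm_fourier_le[OF h]
        by (intro AE_I2) (auto simp: norm_mult power2_eq_square mult.assoc[symmetric] intro!: mult_right_mono order_trans[OF norm_fourier_le[OF h]])
    qed measurable
    have "(\<integral>\<^sup>+ \<xi>. ennreal ((norm (fourier h \<xi>))\<^sup>2 * exp (- e * (norm \<xi>)\<^sup>2)) \<partial>lborel) =
        ennreal (LINT \<xi>|lborel. (norm (fourier h \<xi>))\<^sup>2 * exp (- e * (norm \<xi>)\<^sup>2))"
      by (rule nn_integral_eq_integral[OF intL]) simp
    also have "\<dots> = ennreal (norm (LINT x|lborel. h x * fourier ?k x))"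
      unfolding eq[symmetric] integral_complex_of_real norm_of_real by (simp add: integral_nonneg)
    also have "\<dots> \<le> (\<integral>\<^sup>+ x. ennreal (norm (h x * fourier ?k x)) \<partial>lborel)"
      by (cases "integrable lborel (\<lambda>x. h x * fourier ?k x)") (auto intro: integral_norm_bound_ennreal simp: not_integrable_integral_eq)
    also have "\<dots> \<le> (\<integral>\<^sup>+ x. ennreal (norm (h x)) * (\<integral>\<^sup>+ y. ennreal (norm (h y) * G (y - x)) \<partial>lborel) \<partial>lborel)"
    proof (intro nn_integral_mono)
      fix x
      have "ennreal (norm (fourier ?k x)) \<le> (\<integral>\<^sup>+ y. ennreal (norm (cnj (h y) * of_real (G (y - x)))) \<partial>lborel)"
        unfolding fk
        by (cases "integrable lborel (\<lambda>y. cnj (h y) * of_real (G (y - x)))") (auto intro: integral_norm_bound_ennreal simp: not_integrable_integral_eq)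
      then show "ennreal (norm (h x * fourier ?k x)) \<le> ennreal (norm (h x)) * (\<integral>\<^sup>+ y. ennreal (norm (h y) * G (y - x)) \<partial>lborel)"
        using G0 by (simp add: norm_mult ennreal_mult mult_left_mono)
    qed
    also have "\<dots> = (\<integral>\<^sup>+ x. (\<integral>\<^sup>+ y. ennreal (norm (h x) * (norm (h y) * G (y - x))) \<partial>lborel) \<partial>lborel)"
      using G0 by (simp add: nn_integral_cmult[symmetric] ennreal_mult)
    also have "\<dots> \<le> (\<integral>\<^sup>+ x. (\<integral>\<^sup>+ y. ennreal ((norm (h x))\<^sup>2 / 2 * G (y - x)) + ennreal ((norm (h y))\<^sup>2 / 2 * G (y - x)) \<partial>lborel) \<partial>lborel)"
    proof (intro nn_integral_mono)
      fix x y
      have "norm (h x) * norm (h y) \<le> (norm (h x))\<^sup>2 / 2 + (norm (h y))\<^sup>2 / 2"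
        using sum_squares_ge_zero[of "norm (h x) - norm (h y)" 0] by (simp add: power2_eq_square algebra_simps)
      then have "norm (h x) * (norm (h y) * G (y - x)) \<le> (norm (h x))\<^sup>2 / 2 * G (y - x) + (norm (h y))\<^sup>2 / 2 * G (y - x)"
        using mult_right_mono[OF _ G0] by (simp only: mult.assoc[symmetric] distrib_right[symmetric])
      then show "ennreal (norm (h x) * (norm (h y) * G (y - x))) \<le> ennreal ((norm (h x))\<^sup>2 / 2 * G (y - x)) + ennreal ((norm (h y))\<^sup>2 / 2 * G (y - x))"
        using G0 by (simp flip: ennreal_plus)
    qed
    also have "\<dots> = (\<integral>\<^sup>+ x. (\<integral>\<^sup>+ y. ennreal ((norm (h x))\<^sup>2 / 2 * G (y - x)) \<partial>lborel) \<partial>lborel) +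
        (\<integral>\<^sup>+ x. (\<integral>\<^sup>+ y. ennreal ((norm (h y))\<^sup>2 / 2 * G (y - x)) \<partial>lborel) \<partial>lborel)"
      by (simp add: nn_integral_add)
    also have "(\<integral>\<^sup>+ x. (\<integral>\<^sup>+ y. ennreal ((norm (h y))\<^sup>2 / 2 * G (y - x)) \<partial>lborel) \<partial>lborel) =
        (\<integral>\<^sup>+ x. (\<integral>\<^sup>+ y. ennreal ((norm (h x))\<^sup>2 / 2 * G (y - x)) \<partial>lborel) \<partial>lborel)"
      by (subst lborel_pair.Fubini') (simp_all add: Gsym)
    also have "(\<integral>\<^sup>+ x. (\<integral>\<^sup>+ y. ennreal ((norm (h x))\<^sup>2 / 2 * G (y - x)) \<partial>lborel) \<partial>lborel) = (\<integral>\<^sup>+ x. ennreal ((norm (h x))\<^sup>2 / 2) \<partial>lborel)"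
    proof (intro nn_integral_cong)
      fix x
      have "(\<integral>\<^sup>+ y. ennreal ((norm (h x))\<^sup>2 / 2 * G (y - x)) \<partial>lborel) = (\<integral>\<^sup>+ y. ennreal ((norm (h x))\<^sup>2 / 2) * ennreal (G (y - x)) \<partial>lborel)"
        using G0 by (intro nn_integral_cong ennreal_mult) auto
      also have "\<dots> = ennreal ((norm (h x))\<^sup>2 / 2)"
        by (subst nn_integral_cmult) (simp_all add: Gmass)
      finally show "(\<integral>\<^sup>+ y. ennreal ((norm (h x))\<^sup>2 / 2 * G (y - x)) \<partial>lborel) = ennreal ((norm (h x))\<^sup>2 / 2)" .
    qed
    also have "\<dots> + \<dots> = nsq h"
      unfolding nsq_def by (subst nn_integral_add[symmetric]) (simp_all flip: ennreal_plus)
    finally show ?thesis .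
  qed
  let ?F = "\<lambda>n \<xi>. ennreal ((norm (fourier h \<xi>))\<^sup>2 * exp (- (1 / real (Suc n)) * (norm \<xi>)\<^sup>2))"
  have lim: "(\<lambda>n. ?F n \<xi>) \<longlonglongrightarrow> ennreal ((norm (fourier h \<xi>))\<^sup>2)" for \<xi>
  proof (intro tendsto_ennrealI)
    have "(\<lambda>n. (norm (fourier h \<xi>))\<^sup>2 * exp (- (1 / real (Suc n)) * (norm \<xi>)\<^sup>2)) \<longlonglongrightarrow> (norm (fourier h \<xi>))\<^sup>2 * exp (- 0 * (norm \<xi>)\<^sup>2)"
      by (intro tendsto_intros LIMSEQ_Suc[OF lim_1_over_n])
    then show "(\<lambda>n. (norm (fourier h \<xi>))\<^sup>2 * exp (- (1 / real (Suc n)) * (norm \<xi>)\<^sup>2)) \<longlonglongrightarrow> (norm (fourier h \<xi>))\<^sup>2" by simp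
  qed
  have "nsq (fourier h) = (\<integral>\<^sup>+ \<xi>. liminf (\<lambda>n. ?F n \<xi>) \<partial>lborel)"
    unfolding nsq_def using lim_imp_Liminf[OF _ lim] by simp
  also have "\<dots> \<le> liminf (\<lambda>n. \<integral>\<^sup>+ \<xi>. ?F n \<xi> \<partial>lborel)"
    by (intro nn_integral_liminf) measurable
  also have "\<dots> \<le> liminf (\<lambda>n::nat. nsq h)"
    by (intro Liminf_mono always_eventually allI key) simp
  also have "\<dots> = nsq h" by (simp add: Liminf_const)
  finally show ?thesis .
qed

section \<open>Schwartz functions\<close>

text \<open>The \<open>d\<close>-th power of \<open>1 + |x|\<^sup>2\<close> dominates the product of the factors \<open>1 + x\<^sub>b\<^sup>2\<close> over the coordinates.\<close>

lemma integrable_inverse_1_plus_norm_power: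
  "integrable lborel (\<lambda>x::'a::euclidean_space. inverse ((1 + (norm x)\<^sup>2) ^ DIM('a)))"
proof -
  have "integrable lborel (\<lambda>x::real. inverse (1 + x\<^sup>2))"
    using integrable_inverse_1_plus_square by (simp add: set_integrable_def einterval_eq)
  then have 1: "integrable lborel (\<lambda>x::real. complex_of_real (inverse (1 + x\<^sup>2)))"
    by (rule integrable_of_real)
  have 2: "integrable lborel (\<lambda>x::'a. \<Prod>b\<in>Basis. complex_of_real (inverse (1 + (x \<bullet> b)\<^sup>2)))"
    using has_bochner_integral_lborel_prod[of "\<lambda>(b::'a) x. complex_of_real (inverse (1 + x\<^sup>2))"
        "\<lambda>b. integral\<^sup>L lborel (\<lambda>x. complex_of_real (inverse (1 + x\<^sup>2)))"] 1
    unfolding has_bochner_integral_iff by blast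
  show ?thesis
  proof (rule Bochner_Integration.integrable_bound[OF 2], simp, intro AE_I2)
    fix x :: 'a
    have "(\<Prod>b\<in>(Basis::'a set). 1 + (x \<bullet> b)\<^sup>2) \<le> (\<Prod>b\<in>(Basis::'a set). 1 + (norm x)\<^sup>2)"
    proof (rule prod_mono)
      fix b :: 'a assume "b \<in> Basis"
      then have "\<bar>x \<bullet> b\<bar>\<^sup>2 \<le> (norm x)\<^sup>2" by (intro power_mono Basis_le_norm) auto
      then show "0 \<le> 1 + (x \<bullet> b)\<^sup>2 \<and> 1 + (x \<bullet> b)\<^sup>2 \<le> 1 + (norm x)\<^sup>2" by simp
    qed
    then have "(\<Prod>b\<in>(Basis::'a set). 1 + (x \<bullet> b)\<^sup>2) \<le> (1 + (norm x)\<^sup>2) ^ DIM('a)" by simp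
    moreover have "0 < (\<Prod>b\<in>(Basis::'a set). 1 + (x \<bullet> b)\<^sup>2)"
      by (intro prod_pos) (auto intro: add_pos_nonneg)
    moreover have "norm (\<Prod>b\<in>(Basis::'a set). complex_of_real (inverse (1 + (x \<bullet> b)\<^sup>2))) = inverse (\<Prod>b\<in>(Basis::'a set). 1 + (x \<bullet> b)\<^sup>2)"
      unfolding of_real_prod[symmetric] norm_of_real prod_inversef[symmetric]
      by (subst abs_of_nonneg) (auto intro!: prod_nonneg)
    moreover have "0 \<le> inverse ((1 + (norm x)\<^sup>2) ^ DIM('a))" by (simp add: add_nonneg_nonneg)
    ultimately show "norm (inverse ((1 + (norm x)\<^sup>2) ^ DIM('a))) \<le> norm (\<Prod>b\<in>(Basis::'a set). complex_of_real (inverse (1 + (x \<bullet> b)\<^sup>2)))"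
      by (simp add: le_imp_inverse_le)
  qed
qed

lemma integrable_rapid_decay:
  fixes f :: "'a::euclidean_space \<Rightarrow> complex"
  assumes "f \<in> borel_measurable borel" "\<And>x. (1 + (norm x)\<^sup>2) ^ DIM('a) * norm (f x) \<le> C"
  shows "integrable lborel f"
proof (rule Bochner_Integration.integrable_bound)
  show "integrable lborel (\<lambda>x::'a. C * inverse ((1 + (norm x)\<^sup>2) ^ DIM('a)))"
    by (intro integrable_mult_right integrable_inverse_1_plus_norm_power)
  show "AE x in lborel. norm (f x) \<le> norm (C * inverse ((1 + (norm x)\<^sup>2) ^ DIM('a)))"
  proof (intro AE_I2)
    fix x :: 'a
    have p: "(1 + (norm x)\<^sup>2) ^ DIM('a) > 0" by (intro zero_less_power add_pos_nonneg) auto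
    then have "norm (f x) \<le> C * inverse ((1 + (norm x)\<^sup>2) ^ DIM('a))"
      using assms(2)[of x] by (simp add: field_simps)
    then show "norm (f x) \<le> norm (C * inverse ((1 + (norm x)\<^sup>2) ^ DIM('a)))" by simp
  qed
qed (use assms in simp)

lemma one_plus_square_power_le:
  fixes r :: real
  assumes "r \<ge> 0"
  shows "(1 + r\<^sup>2) ^ n \<le> 2 ^ n * (1 + r ^ (2 * n))"
proof -
  have "(1 + r\<^sup>2) ^ n \<le> (2 * max 1 (r\<^sup>2)) ^ n"
    by (intro power_mono) auto
  also have "\<dots> = 2 ^ n * max 1 (r\<^sup>2) ^ n" by (simp add: power_mult_distrib)
  also have "max 1 (r\<^sup>2) ^ n \<le> 1 + r ^ (2 * n)"
    using assms by (auto simp: max_def power_mult)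
  finally show ?thesis by simp
qed

lemma schwartz_differentiable: "\<phi> \<in> schwartz \<Longrightarrow> \<phi> differentiable (at x)"
  unfolding schwartz_def by (auto dest!: bspec[of _ _ "[]"])

lemma schwartz_bounded: "\<phi> \<in> schwartz \<Longrightarrow> \<exists>C. \<forall>x. norm x ^ k * norm (\<phi> x) \<le> C"
proof -
  assume "\<phi> \<in> schwartz"
  then have "bounded (range (\<lambda>x. (norm x ^ k) *\<^sub>R iter_deriv [] \<phi> x))"
    unfolding schwartz_def by (auto dest!: bspec[of _ _ "[]"])
  then show ?thesis by (auto simp: bounded_iff)
qed

lemma schwartz_rapid_decay:
  fixes \<phi> :: "'a::euclidean_space \<Rightarrow> complex"
  assumes "\<phi> \<in> schwartz"
  obtains C where "\<And>x. (1 + (norm x)\<^sup>2) ^ n * norm (\<phi> x) \<le> C"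
proof -
  obtain C0 where C0: "norm x ^ 0 * norm (\<phi> x) \<le> C0" for x using schwartz_bounded[OF assms] by blast
  obtain C1 where C1: "norm x ^ (2 * n) * norm (\<phi> x) \<le> C1" for x using schwartz_bounded[OF assms] by blast
  show thesis
  proof
    fix x :: 'a
    have "(1 + (norm x)\<^sup>2) ^ n * norm (\<phi> x) \<le> 2 ^ n * (1 + norm x ^ (2 * n)) * norm (\<phi> x)"
      by (intro mult_right_mono one_plus_square_power_le) auto
    also have "\<dots> = 2 ^ n * (norm (\<phi> x) + norm x ^ (2 * n) * norm (\<phi> x))" by (simp add: algebra_simps)
    also have "\<dots> \<le> 2 ^ n * (C0 + C1)" using C0[of x] C1[of x] by (intro mult_left_mono) auto
    finally show "(1 + (norm x)\<^sup>2) ^ n * norm (\<phi> x) \<le> 2 ^ n * (C0 + C1)" .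
  qed
qed

lemma schwartz_continuous: "\<phi> \<in> schwartz \<Longrightarrow> continuous_on UNIV \<phi>"
  using schwartz_differentiable differentiable_imp_continuous_within
  by (metis continuous_on_eq_continuous_within)

lemma schwartz_measurable: "\<phi> \<in> schwartz \<Longrightarrow> \<phi> \<in> borel_measurable borel"
  using schwartz_continuous borel_measurable_continuous_onI by blast

lemma schwartz_integrable: "\<phi> \<in> schwartz \<Longrightarrow> integrable lborel \<phi>"
  by (meson integrable_rapid_decay schwartz_measurable schwartz_rapid_decay)

lemma nsq_finite_of_bounded_integrable:
  assumes "integrable lborel f" "\<And>x. norm (f x) \<le> C"
  shows "nsq f < top"
proof -
  have [measurable]: "f \<in> borel_measurable borel" using assms by (auto simp: integrable_iff_bounded)
  have C: "C \<ge> 0" using assms(2)[of 0] norm_ge_zero order_trans by blast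
  have "nsq f \<le> (\<integral>\<^sup>+ x. ennreal C * ennreal (norm (f x)) \<partial>lborel)"
    unfolding nsq_def using assms(2) C
    by (intro nn_integral_mono) (auto simp: power2_eq_square mult_right_mono intro!: ennreal_leI simp flip: ennreal_mult)
  also have "\<dots> = ennreal C * (\<integral>\<^sup>+ x. ennreal (norm (f x)) \<partial>lborel)" by (simp add: nn_integral_cmult)
  also have "\<dots> < top" using assms(1) by (simp add: integrable_iff_bounded ennreal_mult_less_top)
  finally show ?thesis .
qed

lemma schwartz_nsq: "\<phi> \<in> schwartz \<Longrightarrow> nsq \<phi> < top"
  using schwartz_rapid_decay[of \<phi> 0] nsq_finite_of_bounded_integrable schwartz_integrable
  by (metis mult_1 power_0)

lemma iter_deriv_append: "iter_deriv (vs @ ws) f = iter_deriv vs (iter_deriv ws f)"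
  by (induction vs) auto

lemma schwartz_deriv:
  assumes "\<phi> \<in> schwartz" "b \<in> Basis"
  shows "(\<lambda>x. frechet_derivative \<phi> (at x) b) \<in> schwartz"
proof -
  have "iter_deriv vs (\<lambda>x. frechet_derivative \<phi> (at x) b) = iter_deriv (vs @ [b]) \<phi>" for vs
    by (simp add: iter_deriv_append)
  then show ?thesis using assms unfolding schwartz_def by auto
qed

lemma difference_quotient_tendsto:
  fixes f :: "real \<Rightarrow> 'b::real_normed_vector"
  assumes "(f has_vector_derivative D) (at 0)" "filterlim h (at 0) sequentially"
  shows "(\<lambda>n. (f (h n) - f 0) /\<^sub>R h n) \<longlonglongrightarrow> D"
proof -
  have "(\<lambda>t. norm (f (0 + t) - f 0 - t *\<^sub>R D) / norm t) \<midarrow>0\<rightarrow> 0"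
    using assms(1) unfolding has_vector_derivative_def has_derivative_at by blast
  then have "(\<lambda>n. norm (f (h n) - f 0 - h n *\<^sub>R D) / norm (h n)) \<longlonglongrightarrow> 0"
    using filterlim_compose[OF _ assms(2)] by fastforce
  moreover have "\<forall>\<^sub>F n in sequentially. norm (f (h n) - f 0 - h n *\<^sub>R D) / norm (h n) = norm ((f (h n) - f 0) /\<^sub>R h n - D)"
  proof -
    have "\<forall>\<^sub>F n in sequentially. h n \<noteq> 0" using assms(2) by (simp add: filterlim_at)
    then show ?thesis
    proof eventually_elim
      case (elim n)
      have "f (h n) - f 0 - h n *\<^sub>R D = h n *\<^sub>R ((f (h n) - f 0) /\<^sub>R h n - D)"
        using elim by (simp add: scaleR_diff_right)
      then show ?case using elim by simp
    qed
  qed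
  ultimately have "(\<lambda>n. norm ((f (h n) - f 0) /\<^sub>R h n - D)) \<longlonglongrightarrow> 0"
    by (rule Lim_transform_eventually)
  then show ?thesis using Lim_null tendsto_norm_zero_iff by blast
qed

text \<open>By translation invariance of the measure the transform of a difference quotient of \<open>\<phi>\<close> is a
  multiple of the transform of \<open>\<phi>\<close>. The quotients are dominated through the mean value theorem and the rapid
  decay of the derivative.\<close>

lemma fourier_deriv:
  fixes \<phi> :: "'a::euclidean_space \<Rightarrow> complex"
  assumes \<phi>: "\<phi> \<in> schwartz" and b: "b \<in> Basis"
  shows "fourier (\<lambda>x. frechet_derivative \<phi> (at x) b) \<xi> = \<i> * of_real (b \<bullet> \<xi>) * fourier \<phi> \<xi>"
proof -
  define D where "D x = frechet_derivative \<phi> (at x) b" for x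
  have DS: "D \<in> schwartz" unfolding D_def[abs_def] by (rule schwartz_deriv[OF assms])
  note [measurable] = schwartz_measurable[OF \<phi>] schwartz_measurable[OF DS]
  obtain C where C: "\<And>x. (1 + (norm x)\<^sup>2) ^ DIM('a) * norm (D x) \<le> C"
    using schwartz_rapid_decay[OF DS] by blast
  let ?P = "\<lambda>x::'a. (1 + (norm x)\<^sup>2) ^ DIM('a)"
  have P0: "?P x > 0" for x by (intro zero_less_power add_pos_nonneg) auto
  have der: "((\<lambda>t. \<phi> (x + t *\<^sub>R b)) has_derivative (\<lambda>s. s *\<^sub>R D (x + t *\<^sub>R b))) (at t within A)" for x t A
  proof -
    have "(\<phi> has_derivative frechet_derivative \<phi> (at (x + t *\<^sub>R b))) (at (x + t *\<^sub>R b))"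
      using schwartz_differentiable[OF \<phi>] frechet_derivative_works by blast
    then have "((\<lambda>t. \<phi> (x + t *\<^sub>R b)) has_derivative (\<lambda>s. frechet_derivative \<phi> (at (x + t *\<^sub>R b)) (s *\<^sub>R b))) (at t within A)"
      by (rule has_derivative_compose[rotated]) (auto intro!: derivative_eq_intros)
    moreover have "frechet_derivative \<phi> (at (x + t *\<^sub>R b)) (s *\<^sub>R b) = s *\<^sub>R D (x + t *\<^sub>R b)" for s
      unfolding D_def using linear_frechet_derivative[OF schwartz_differentiable[OF \<phi>]] linear_scale by blast
    ultimately show ?thesis by simp
  qed
  have P3: "?P x \<le> 3 ^ DIM('a) * ?P (x + t *\<^sub>R b)" if "0 \<le> t" "t \<le> 1" for x t
  proof -
    have "norm x \<le> norm (x + t *\<^sub>R b) + 1"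
      using norm_triangle_ineq4[of "x + t *\<^sub>R b" "t *\<^sub>R b"] b that by simp
    then have "(norm x)\<^sup>2 \<le> (norm (x + t *\<^sub>R b) + 1)\<^sup>2" by (intro power_mono) auto
    also have "\<dots> \<le> 2 * (norm (x + t *\<^sub>R b))\<^sup>2 + 2"
      using sum_squares_ge_zero[of "norm (x + t *\<^sub>R b) - 1" 0] by (simp add: power2_eq_square algebra_simps)
    finally have "1 + (norm x)\<^sup>2 \<le> 3 * (1 + (norm (x + t *\<^sub>R b))\<^sup>2)" by (smt (verit) zero_le_power2)
    then have "?P x \<le> (3 * (1 + (norm (x + t *\<^sub>R b))\<^sup>2)) ^ DIM('a)" by (intro power_mono) auto
    then show ?thesis by (simp only: power_mult_distrib)
  qed
  define h where "h n = 1 / real (Suc n)" for n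
  have h: "0 < h n" "h n \<le> 1" for n by (auto simp: h_def)
  have h0: "h \<longlonglongrightarrow> 0" unfolding h_def by (rule LIMSEQ_Suc[OF lim_1_over_n])
  then have h0': "filterlim h (at 0) sequentially"
    using h(1) by (auto simp: filterlim_at less_imp_neq[THEN not_sym])
  define g where "g n x = (\<phi> (x + h n *\<^sub>R b) - \<phi> x) /\<^sub>R h n" for n x
  have gm[measurable]: "g n \<in> borel_measurable borel" for n unfolding g_def by measurable
  have glim: "(\<lambda>n. g n x) \<longlonglongrightarrow> D x" for x
  proof -
    have "((\<lambda>t. \<phi> (x + t *\<^sub>R b)) has_vector_derivative D (x + 0 *\<^sub>R b)) (at 0)"
      unfolding has_vector_derivative_def using der[where t=0 and A=UNIV] by simp
    from difference_quotient_tendsto[OF this h0'] show ?thesis by (simp add: g_def)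
  qed
  have gbd: "norm (g n x) \<le> 3 ^ DIM('a) * C * inverse (?P x)" for n x
  proof -
    have "norm (\<phi> (x + h n *\<^sub>R b) - \<phi> (x + 0 *\<^sub>R b)) \<le> (3 ^ DIM('a) * C * inverse (?P x)) * norm (h n - 0)"
    proof (rule differentiable_bound[where S="{0..h n}" and f' = "\<lambda>t s. s *\<^sub>R D (x + t *\<^sub>R b)"])
      fix t assume t: "t \<in> {0..h n}"
      then have t: "0 \<le> t" "t \<le> 1" using h(2)[of n] by auto
      have "norm (D (x + t *\<^sub>R b)) \<le> 3 ^ DIM('a) * C * inverse (?P x)"
      proof -
        have "?P x * norm (D (x + t *\<^sub>R b)) \<le> 3 ^ DIM('a) * (?P (x + t *\<^sub>R b) * norm (D (x + t *\<^sub>R b)))"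
          using mult_right_mono[OF P3[OF t, of x], of "norm (D (x + t *\<^sub>R b))"] by (simp add: mult.assoc)
        also have "\<dots> \<le> 3 ^ DIM('a) * C" using C by (intro mult_left_mono) auto
        finally show ?thesis using P0[of x] by (simp add: field_simps)
      qed
      then show "onorm (\<lambda>s. s *\<^sub>R D (x + t *\<^sub>R b)) \<le> 3 ^ DIM('a) * C * inverse (?P x)"
        by (intro onorm_le) (simp add: mult.commute mult_left_mono)
    qed (use h(1)[of n] der in \<open>auto simp: less_imp_le\<close>)
    then have "norm (\<phi> (x + h n *\<^sub>R b) - \<phi> x) / h n \<le> 3 ^ DIM('a) * C * inverse (?P x)"
      using h(1)[of n] unfolding pos_divide_le_eq[OF h(1)] by simp
    then show ?thesis using h(1)[of n] by (simp add: g_def divide_inverse mult.commute)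
  qed
  let ?e = "\<lambda>x::'a. exp (- \<i> * complex_of_real (x \<bullet> \<xi>))"
  have lim1: "(\<lambda>n. LINT x|lborel. ?e x * g n x) \<longlonglongrightarrow> (LINT x|lborel. ?e x * D x)"
  proof (rule integral_dominated_convergence[where w="\<lambda>x. 3 ^ DIM('a) * C * inverse (?P x)"])
    show "integrable lborel (\<lambda>x. 3 ^ DIM('a) * C * inverse (?P x))"
      by (intro integrable_mult_right integrable_inverse_1_plus_norm_power)
    show "AE x in lborel. (\<lambda>n. ?e x * g n x) \<longlonglongrightarrow> ?e x * D x"
      using glim by (intro AE_I2 tendsto_intros)
    show "AE x in lborel. norm (?e x * g n x) \<le> 3 ^ DIM('a) * C * inverse (?P x)" for n
      using gbd by (simp add: norm_mult)
  qed measurable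
  have i\<phi>: "integrable lborel (\<lambda>x. ?e x * \<phi> x)"
    by (rule integrable_character_mult[OF schwartz_integrable[OF \<phi>]])
  have eq: "(LINT x|lborel. ?e x * g n x) = ((exp (\<i> * of_real (h n * (b \<bullet> \<xi>))) - 1) /\<^sub>R h n) * (LINT x|lborel. ?e x * \<phi> x)" for n
  proof -
    have sh: "lborel = distr lborel borel (\<lambda>x::'a. h n *\<^sub>R b + x)"
      using lborel_affine[of 1 "h n *\<^sub>R b"] by (simp add: density_1)
    have e: "?e x * \<phi> (x + h n *\<^sub>R b) = exp (\<i> * of_real (h n * (b \<bullet> \<xi>))) * (?e (h n *\<^sub>R b + x) * \<phi> (h n *\<^sub>R b + x))" for x
    proof -
      have "?e x = exp (\<i> * of_real (h n * (b \<bullet> \<xi>))) * ?e (h n *\<^sub>R b + x)"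
        by (simp add: inner_add_left ring_distribs flip: exp_add)
      then show ?thesis by (simp add: add.commute)
    qed
    have i2: "integrable lborel (\<lambda>x. ?e (h n *\<^sub>R b + x) * \<phi> (h n *\<^sub>R b + x))"
      using i\<phi> by (subst (asm) sh) (simp add: integrable_distr_eq)
    have e2: "(LINT x|lborel. ?e (h n *\<^sub>R b + x) * \<phi> (h n *\<^sub>R b + x)) = (LINT x|lborel. ?e x * \<phi> x)"
      by (subst (2) sh) (simp add: integral_distr)
    have "(LINT x|lborel. ?e x * g n x) = (LINT x|lborel. (?e x * \<phi> (x + h n *\<^sub>R b) - ?e x * \<phi> x) /\<^sub>R h n)"
      unfolding g_def by (simp add: algebra_simps)
    also have "\<dots> = ((LINT x|lborel. ?e x * \<phi> (x + h n *\<^sub>R b)) - (LINT x|lborel. ?e x * \<phi> x)) /\<^sub>R h n"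
      using i2 i\<phi> unfolding e by simp
    also have "(LINT x|lborel. ?e x * \<phi> (x + h n *\<^sub>R b)) = exp (\<i> * of_real (h n * (b \<bullet> \<xi>))) * (LINT x|lborel. ?e x * \<phi> x)"
      unfolding e integral_mult_right_zero e2 ..
    finally show ?thesis by (simp add: algebra_simps)
  qed
  have "((\<lambda>t. \<i> * of_real (t * (b \<bullet> \<xi>))) has_derivative (\<lambda>s. \<i> * of_real (s * (b \<bullet> \<xi>)))) (at 0)"
    by (auto intro!: derivative_eq_intros)
  from has_derivative_compose[OF this DERIV_exp[unfolded has_field_derivative_def]]
  have "((\<lambda>t. exp (\<i> * of_real (t * (b \<bullet> \<xi>)))) has_vector_derivative \<i> * of_real (b \<bullet> \<xi>)) (at 0)"
    unfolding has_vector_derivative_def by (rule has_derivative_eq_rhs) (auto simp: scaleR_conv_of_real)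
  from difference_quotient_tendsto[OF this h0']
  have "(\<lambda>n. (exp (\<i> * of_real (h n * (b \<bullet> \<xi>))) - 1) /\<^sub>R h n) \<longlonglongrightarrow> \<i> * of_real (b \<bullet> \<xi>)"
    by simp
  then have "(\<lambda>n. LINT x|lborel. ?e x * g n x) \<longlonglongrightarrow> \<i> * of_real (b \<bullet> \<xi>) * (LINT x|lborel. ?e x * \<phi> x)"
    unfolding eq by (intro tendsto_intros)
  with lim1 have "(LINT x|lborel. ?e x * D x) = \<i> * of_real (b \<bullet> \<xi>) * (LINT x|lborel. ?e x * \<phi> x)"
    by (rule LIMSEQ_unique)
  then show ?thesis
    unfolding D_def[symmetric] by (simp add: fourier_borel)
qed

lemma fourier_coordinate_power_bounded:
  fixes \<phi> :: "'a::euclidean_space \<Rightarrow> complex"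
  assumes "\<phi> \<in> schwartz" "b \<in> Basis"
  shows "\<exists>C. \<forall>\<xi>. \<bar>b \<bullet> \<xi>\<bar> ^ n * norm (fourier \<phi> \<xi>) \<le> C"
  using assms(1)
proof (induction n arbitrary: \<phi>)
  case 0
  show ?case using norm_fourier_le[OF schwartz_integrable[OF 0]] by auto
next
  case (Suc n)
  let ?D = "\<lambda>x. frechet_derivative \<phi> (at x) b"
  obtain C where "\<forall>\<xi>. \<bar>b \<bullet> \<xi>\<bar> ^ n * norm (fourier ?D \<xi>) \<le> C"
    using Suc.IH[OF schwartz_deriv[OF Suc.prems assms(2)]] by blast
  then show ?case
    by (intro exI[of _ C]) (simp add: fourier_deriv[OF Suc.prems assms(2)] norm_mult mult_ac)
qed

text \<open>Each derivative of \<open>\<phi>\<close> yields one power of a coordinate of \<open>\<xi>\<close>, and \<open>2d\<close> powers are enough for integrability.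
  This is what makes the inverse transform in \<^const>\<open>schrodinger\<close> a convergent integral.\<close>

lemma fourier_schwartz_integrable:
  fixes \<phi> :: "'a::euclidean_space \<Rightarrow> complex"
  assumes \<phi>: "\<phi> \<in> schwartz"
  shows "integrable lborel (fourier \<phi>)"
proof -
  let ?N = "2 * DIM('a)"
  have "\<forall>b\<in>Basis. \<exists>C. \<forall>\<xi>. \<bar>b \<bullet> \<xi>\<bar> ^ ?N * norm (fourier \<phi> \<xi>) \<le> C"
    using fourier_coordinate_power_bounded[OF \<phi>] by blast
  then obtain C where C: "\<And>b \<xi>. b \<in> Basis \<Longrightarrow> \<bar>b \<bullet> \<xi>\<bar> ^ ?N * norm (fourier \<phi> \<xi>) \<le> C b"
    by (auto dest!: bchoice)
  obtain C0 where C0: "norm (fourier \<phi> \<xi>) \<le> C0" for \<xi> using norm_fourier_le[OF schwartz_integrable[OF \<phi>]] by blast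
  have nx: "norm \<xi> ^ ?N \<le> real DIM('a) ^ ?N * (\<Sum>b\<in>Basis. \<bar>b \<bullet> \<xi>\<bar> ^ ?N)" for \<xi> :: 'a
  proof -
    let ?M = "Max ((\<lambda>b. \<bar>b \<bullet> \<xi>\<bar>) ` Basis)"
    have "?M \<in> (\<lambda>b. \<bar>b \<bullet> \<xi>\<bar>) ` Basis" by (intro Max_in) auto
    then obtain b where b: "b \<in> Basis" "?M = \<bar>b \<bullet> \<xi>\<bar>" by blast
    have "norm \<xi> \<le> (\<Sum>b\<in>Basis. \<bar>\<xi> \<bullet> b\<bar>)" by (rule norm_le_l1)
    also have "\<dots> \<le> (\<Sum>b\<in>(Basis::'a set). ?M)" by (intro sum_mono Max_ge) (auto simp: inner_commute)
    finally have "norm \<xi> \<le> real DIM('a) * \<bar>b \<bullet> \<xi>\<bar>" by (simp add: b)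
    then have "norm \<xi> ^ ?N \<le> (real DIM('a) * \<bar>b \<bullet> \<xi>\<bar>) ^ ?N" by (intro power_mono) auto
    also have "\<dots> = real DIM('a) ^ ?N * \<bar>b \<bullet> \<xi>\<bar> ^ ?N" by (rule power_mult_distrib)
    also have "\<dots> \<le> real DIM('a) ^ ?N * (\<Sum>b\<in>Basis. \<bar>b \<bullet> \<xi>\<bar> ^ ?N)"
      using b by (intro mult_left_mono member_le_sum) auto
    finally show ?thesis .
  qed
  show ?thesis
  proof (rule integrable_rapid_decay)
    show "fourier \<phi> \<in> borel_measurable borel" using schwartz_measurable[OF \<phi>] by (rule borel_measurable_fourier)
    fix \<xi> :: 'a
    have "(1 + (norm \<xi>)\<^sup>2) ^ DIM('a) * norm (fourier \<phi> \<xi>) \<le> 2 ^ DIM('a) * (1 + norm \<xi> ^ ?N) * norm (fourier \<phi> \<xi>)"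
      by (intro mult_right_mono one_plus_square_power_le) auto
    also have "\<dots> \<le> 2 ^ DIM('a) * (1 + real DIM('a) ^ ?N * (\<Sum>b\<in>Basis. \<bar>b \<bullet> \<xi>\<bar> ^ ?N)) * norm (fourier \<phi> \<xi>)"
      using nx[of \<xi>] by (intro mult_right_mono mult_left_mono add_left_mono) auto
    also have "\<dots> = 2 ^ DIM('a) * (norm (fourier \<phi> \<xi>) + real DIM('a) ^ ?N * (\<Sum>b\<in>Basis. \<bar>b \<bullet> \<xi>\<bar> ^ ?N * norm (fourier \<phi> \<xi>)))"
      by (simp add: distrib_left distrib_right sum_distrib_right mult.assoc)
    also have "\<dots> \<le> 2 ^ DIM('a) * (C0 + real DIM('a) ^ ?N * (\<Sum>b\<in>Basis. C b))"
      by (intro mult_left_mono add_mono C0 sum_mono C) auto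
    finally show "(1 + (norm \<xi>)\<^sup>2) ^ DIM('a) * norm (fourier \<phi> \<xi>) \<le> 2 ^ DIM('a) * (C0 + real DIM('a) ^ ?N * (\<Sum>b\<in>Basis. C b))" .
  qed
qed

subsection \<open>Gaussians are Schwartz functions\<close>

text \<open>Polynomials in the coordinates. Products of these with a fixed Gaussian are closed under
  directional derivatives, which gives the Schwartz property for all iterated derivatives at once.\<close>

inductive_set polyfun :: "('a::euclidean_space \<Rightarrow> complex) set" where
  const: "(\<lambda>x. c) \<in> polyfun"
| coord: "(\<lambda>x. of_real (x \<bullet> v)) \<in> polyfun"
| add: "p \<in> polyfun \<Longrightarrow> q \<in> polyfun \<Longrightarrow> (\<lambda>x. p x + q x) \<in> polyfun"
| mult: "p \<in> polyfun \<Longrightarrow> q \<in> polyfun \<Longrightarrow> (\<lambda>x. p x * q x) \<in> polyfun"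

lemma polyfun_has_derivative:
  "p \<in> polyfun \<Longrightarrow> \<exists>p'. (\<forall>x. (p has_derivative p' x) (at x)) \<and> (\<forall>v. (\<lambda>x. p' x v) \<in> polyfun)"
proof (induction rule: polyfun.induct)
  case (const c)
  show ?case by (intro exI[of _ "\<lambda>x v. 0"]) (auto intro: polyfun.const)
next
  case (coord v)
  show ?case
    by (intro exI[of _ "\<lambda>x h. of_real (h \<bullet> v)"]) (auto intro: polyfun.const intro!: derivative_eq_intros)
next
  case (add p q)
  then obtain p' q' where "\<forall>x. (p has_derivative p' x) (at x)" "\<forall>v. (\<lambda>x. p' x v) \<in> polyfun"
    "\<forall>x. (q has_derivative q' x) (at x)" "\<forall>v. (\<lambda>x. q' x v) \<in> polyfun" by blast
  then show ?case
    by (intro exI[of _ "\<lambda>x h. p' x h + q' x h"]) (auto intro: polyfun.add intro!: derivative_eq_intros)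
next
  case (mult p q)
  then obtain p' q' where *: "\<forall>x. (p has_derivative p' x) (at x)" "\<forall>v. (\<lambda>x. p' x v) \<in> polyfun"
    "\<forall>x. (q has_derivative q' x) (at x)" "\<forall>v. (\<lambda>x. q' x v) \<in> polyfun" by blast
  show ?case
  proof (intro exI[of _ "\<lambda>x h. p x * q' x h + p' x h * q x"] conjI allI)
    show "((\<lambda>x. p x * q x) has_derivative (\<lambda>h. p x * q' x h + p' x h * q x)) (at x)" for x
      using * by (intro has_derivative_mult) auto
    show "(\<lambda>x. p x * q' x v + p' x v * q x) \<in> polyfun" for v
      using * mult.hyps by (intro polyfun.add polyfun.mult) auto
  qed
qed

lemma polyfun_growth: "p \<in> polyfun \<Longrightarrow> \<exists>C n. C \<ge> 0 \<and> (\<forall>x. norm (p x) \<le> C * (1 + norm x) ^ n)"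
proof (induction rule: polyfun.induct)
  case (const c)
  show ?case by (intro exI[of _ "norm c"] exI[of _ 0]) auto
next
  case (coord v)
  have "\<bar>x \<bullet> v\<bar> \<le> norm v * (1 + norm x) ^ 1" for x
    using Cauchy_Schwarz_ineq2[of x v] by (simp add: algebra_simps) (smt (verit) norm_ge_zero)
  then show ?case by (intro exI[of _ "norm v"] exI[of _ 1]) auto
next
  case (add p q)
  then obtain C n D m where *: "C \<ge> 0" "\<And>x. norm (p x) \<le> C * (1 + norm x) ^ n"
    "D \<ge> 0" "\<And>x. norm (q x) \<le> D * (1 + norm x) ^ m" by blast
  have "norm (p x + q x) \<le> (C + D) * (1 + norm x) ^ (n + m)" for x
  proof -
    have "C * (1 + norm x) ^ n \<le> C * (1 + norm x) ^ (n + m)" "D * (1 + norm x) ^ m \<le> D * (1 + norm x) ^ (n + m)"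
      using * by (auto intro!: mult_left_mono power_increasing)
    then show ?thesis using *(2,4)[of x] norm_triangle_ineq[of "p x" "q x"] by (simp add: distrib_right)
  qed
  then show ?case using * by (intro exI[of _ "C + D"] exI[of _ "n + m"]) auto
next
  case (mult p q)
  then obtain C n D m where *: "C \<ge> 0" "\<And>x. norm (p x) \<le> C * (1 + norm x) ^ n"
    "D \<ge> 0" "\<And>x. norm (q x) \<le> D * (1 + norm x) ^ m" by blast
  have "norm (p x * q x) \<le> (C * D) * (1 + norm x) ^ (n + m)" for x
  proof -
    have "norm (p x) * norm (q x) \<le> (C * (1 + norm x) ^ n) * (D * (1 + norm x) ^ m)"
      using * by (intro mult_mono) auto
    then show ?thesis by (simp add: norm_mult power_add mult_ac)
  qed
  then show ?case using * by (intro exI[of _ "C * D"] exI[of _ "n + m"]) auto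
qed

definition wave_packet :: "real \<Rightarrow> 'a::euclidean_space \<Rightarrow> 'a \<Rightarrow> complex" where
  "wave_packet a z x = exp (\<i> * of_real (z \<bullet> x)) * of_real (exp (- a * (norm x)\<^sup>2))"

lemma norm_wave_packet: "norm (wave_packet a z x) = exp (- a * (norm x)\<^sup>2)"
  by (simp add: wave_packet_def norm_mult)

lemma wave_packet_has_derivative:
  "(wave_packet a z has_derivative (\<lambda>h. (\<i> * of_real (h \<bullet> z) + of_real (- 2 * a) * of_real (x \<bullet> h)) * wave_packet a z x)) (at x)"
proof -
  have eq: "wave_packet a z = (\<lambda>x. exp (\<i> * of_real (z \<bullet> x) + of_real (- a * (x \<bullet> x))))"
    by (rule ext) (simp only: wave_packet_def exp_add exp_of_real power2_norm_eq_inner)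
  have "((\<lambda>x. \<i> * of_real (z \<bullet> x) + complex_of_real (- a * (x \<bullet> x))) has_derivative
      (\<lambda>h. \<i> * of_real (z \<bullet> h) + of_real (- a * (x \<bullet> h + h \<bullet> x)))) (at x)"
    by (auto intro!: derivative_eq_intros)
  from has_derivative_compose[OF this DERIV_exp[unfolded has_field_derivative_def]] show ?thesis
    unfolding eq by (rule has_derivative_eq_rhs) (auto simp: inner_commute algebra_simps)
qed

text \<open>From \<open>1 + r \<le> K (1 + c r\<^sup>2) \<le> K exp (c r\<^sup>2)\<close> with \<open>c = a / n\<close>, by taking the \<open>n\<close>-th power.\<close>

lemma one_plus_power_le_exp:
  fixes a :: real
  assumes "a > 0"
  shows "\<exists>K. \<forall>r\<ge>0. (1 + r) ^ n * exp (- a * r\<^sup>2) \<le> K"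
proof (cases "n = 0")
  case True
  have "exp (- a * r\<^sup>2) \<le> 1" for r :: real using assms by simp
  then show ?thesis using True by (intro exI[of _ 1]) simp
next
  case False
  define c where "c = a / n"
  have c: "c > 0" using assms False by (simp add: c_def)
  let ?K = "2 + 1 / c"
  have "(1 + r) ^ n * exp (- a * r\<^sup>2) \<le> ?K ^ n" if "r \<ge> 0" for r
  proof -
    have "1 + r \<le> 2 + r\<^sup>2" using sum_squares_ge_zero[of "r - 1" 0] that
      by (simp add: power2_eq_square algebra_simps)
    also have "\<dots> \<le> ?K * (1 + c * r\<^sup>2)" using c by (simp add: field_simps)
    also have "\<dots> \<le> ?K * exp (c * r\<^sup>2)" using c by (intro mult_left_mono) auto
    finally have "(1 + r) ^ n \<le> (?K * exp (c * r\<^sup>2)) ^ n" using that by (intro power_mono) auto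
    also have "\<dots> = ?K ^ n * exp (a * r\<^sup>2)"
      using False by (simp add: power_mult_distrib c_def exp_of_nat_mult[symmetric])
    finally show ?thesis by (simp add: exp_minus field_simps)
  qed
  then show ?thesis by blast
qed

lemma iter_deriv_polyfun_wave_packet:
  "p \<in> polyfun \<Longrightarrow> \<exists>q\<in>polyfun. iter_deriv vs (\<lambda>x. p x * wave_packet a z x) = (\<lambda>x. q x * wave_packet a z x)"
proof (induction vs)
  case Nil
  then show ?case by auto
next
  case (Cons v vs)
  then obtain q where q: "q \<in> polyfun" "iter_deriv vs (\<lambda>x. p x * wave_packet a z x) = (\<lambda>x. q x * wave_packet a z x)" by blast
  obtain q' where q': "\<And>x. (q has_derivative q' x) (at x)" "\<And>v. (\<lambda>x. q' x v) \<in> polyfun"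
    using polyfun_has_derivative[OF q(1)] by blast
  let ?r = "\<lambda>x. q x * (\<i> * of_real (v \<bullet> z) + of_real (- 2 * a) * of_real (x \<bullet> v)) + q' x v"
  have "frechet_derivative (\<lambda>x. q x * wave_packet a z x) (at x) v = ?r x * wave_packet a z x" for x
    unfolding frechet_derivative_at[OF has_derivative_mult[OF q'(1) wave_packet_has_derivative[of a z]], symmetric]
    by (simp add: algebra_simps)
  then have "iter_deriv (v # vs) (\<lambda>x. p x * wave_packet a z x) = (\<lambda>x. ?r x * wave_packet a z x)"
    by (simp add: q(2))
  moreover have "?r \<in> polyfun"
    by (intro polyfun.add polyfun.mult polyfun.coord polyfun.const q q')
  ultimately show ?case by (intro bexI[of _ ?r])
qed

lemma polyfun_wave_packet_schwartz:
  assumes "a > 0" and p: "p \<in> polyfun"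
  shows "(\<lambda>x. p x * wave_packet a z x) \<in> schwartz"
proof -
  have "(\<forall>x. iter_deriv vs (\<lambda>x. p x * wave_packet a z x) differentiable (at x)) \<and>
     (\<forall>k::nat. bounded (range (\<lambda>x. (norm x ^ k) *\<^sub>R iter_deriv vs (\<lambda>x. p x * wave_packet a z x) x)))" for vs
  proof -
    obtain q where q: "q \<in> polyfun" "iter_deriv vs (\<lambda>x. p x * wave_packet a z x) = (\<lambda>x. q x * wave_packet a z x)"
      using iter_deriv_polyfun_wave_packet[OF p, of vs a z] by auto
    obtain q' where q': "\<And>x. (q has_derivative q' x) (at x)"
      using polyfun_has_derivative[OF q(1)] by blast
    have d: "(\<lambda>x. q x * wave_packet a z x) differentiable (at x)" for x
      using has_derivative_mult[OF q'(1) wave_packet_has_derivative[of a z]] differentiableI by blast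
    obtain C n where C: "C \<ge> 0" "\<And>x. norm (q x) \<le> C * (1 + norm x) ^ n"
      using polyfun_growth[OF q(1)] by blast
    have "bounded (range (\<lambda>x. (norm x ^ k) *\<^sub>R (q x * wave_packet a z x)))" for k
    proof -
      obtain K where K: "\<And>r. r \<ge> 0 \<Longrightarrow> (1 + r) ^ (k + n) * exp (- a * r\<^sup>2) \<le> K"
        using one_plus_power_le_exp[OF assms(1)] by blast
      have "norm ((norm x ^ k) *\<^sub>R (q x * wave_packet a z x)) \<le> C * K" for x
      proof -
        have "norm ((norm x ^ k) *\<^sub>R (q x * wave_packet a z x)) = norm x ^ k * norm (q x) * exp (- a * (norm x)\<^sup>2)"
          by (simp add: norm_mult norm_wave_packet)
        also have "\<dots> \<le> (1 + norm x) ^ k * (C * (1 + norm x) ^ n) * exp (- a * (norm x)\<^sup>2)"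
          using C by (intro mult_right_mono mult_mono power_mono) auto
        also have "\<dots> = C * ((1 + norm x) ^ (k + n) * exp (- a * (norm x)\<^sup>2))" by (simp add: power_add mult_ac)
        also have "\<dots> \<le> C * K" using C(1) K[of "norm x"] by (intro mult_left_mono) auto
        finally show ?thesis .
      qed
      then show ?thesis by (auto simp: bounded_iff)
    qed
    then show ?thesis using d by (simp add: q(2))
  qed
  then show ?thesis by (simp add: schwartz_def)
qed

lemma wave_packet_schwartz: "a > 0 \<Longrightarrow> wave_packet a z \<in> schwartz"
  using polyfun_wave_packet_schwartz[OF _ polyfun.const[of 1], of a z] by simp

lemma fourier_wave_packet:
  fixes z \<xi> :: "'a::euclidean_space"
  assumes "a > 0"
  shows "fourier (wave_packet a z) \<xi> = of_real ((2 * a) powr (- (DIM('a) / 2)) * exp (- (norm (\<xi> - z))\<^sup>2 / (4 * a)))"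
  using fourier_gaussian(2)[OF assms] by (simp add: wave_packet_def[abs_def])

section \<open>Fourier transform and free evolution on \<open>L\<^sup>2\<close>\<close>

lemma ennreal_le_suminf:
  fixes f :: "nat \<Rightarrow> ennreal"
  shows "f k \<le> suminf f"
  using sum_le_suminf[of f "{k}"] by (simp add: summableI)

text \<open>The weighted series of \<open>2\<^sup>k |g\<^sub>k(x)|\<^sup>2\<close> has finite integral, so almost everywhere \<open>|g\<^sub>k(x)|\<close> decays
  geometrically. This turns fast convergence in \<open>L\<^sup>2\<close> into convergence almost everywhere.\<close>

lemma AE_summable_of_nsq_le:
  fixes g :: "nat \<Rightarrow> 'a::euclidean_space \<Rightarrow> complex"
  assumes [measurable]: "\<And>k. g k \<in> borel_measurable borel"
    and le: "\<And>k. nsq (g k) \<le> ennreal ((1 / 4) ^ k)"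
  shows "AE x in lborel. summable (\<lambda>k. norm (g k x))"
proof -
  let ?f = "\<lambda>k x. ennreal (2 ^ k * (norm (g k x))\<^sup>2)"
  have "(\<integral>\<^sup>+ x. (\<Sum>k. ?f k x) \<partial>lborel) = (\<Sum>k. \<integral>\<^sup>+ x. ?f k x \<partial>lborel)"
    by (rule nn_integral_suminf) simp
  also have "\<dots> \<le> (\<Sum>k. ennreal ((1 / 2) ^ k))"
  proof (intro suminf_le summableI)
    fix k
    have "(\<integral>\<^sup>+ x. ?f k x \<partial>lborel) = ennreal (2 ^ k) * nsq (g k)"
      unfolding nsq_def by (simp add: ennreal_mult nn_integral_cmult)
    also have "\<dots> \<le> ennreal (2 ^ k) * ennreal ((1 / 4) ^ k)" by (intro mult_left_mono le) simp
    also have "\<dots> = ennreal ((1 / 2) ^ k)"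
      by (simp flip: ennreal_mult power_mult_distrib)
    finally show "(\<integral>\<^sup>+ x. ?f k x \<partial>lborel) \<le> ennreal ((1 / 2) ^ k)" .
  qed
  also have "\<dots> < top"
  proof -
    have "(\<lambda>k. (1 / 2) ^ k :: real) sums 2" using geometric_sums[of "1/2 :: real"] by simp
    then show ?thesis by (subst suminf_ennreal2) (auto simp: sums_iff)
  qed
  finally have "AE x in lborel. (\<Sum>k. ?f k x) \<noteq> \<infinity>"
    by (intro nn_integral_noteq_infinite) auto
  then show ?thesis
  proof eventually_elim
    case (elim x)
    define M where "M = enn2real (\<Sum>k. ?f k x)"
    have M0: "M \<ge> 0" unfolding M_def by (rule enn2real_nonneg)
    have M: "2 ^ k * (norm (g k x))\<^sup>2 \<le> M" for k
    proof -
      have "?f k x \<le> (\<Sum>k. ?f k x)" by (rule ennreal_le_suminf)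
      also have "\<dots> = ennreal M" using elim by (simp add: M_def)
      finally show ?thesis using ennreal_le_iff[OF M0] by blast
    qed
    show ?case
    proof (rule summable_comparison_test')
      show "summable (\<lambda>k. sqrt M * (1 / sqrt 2) ^ k)"
        by (intro summable_mult summable_geometric) simp
      fix k :: nat
      have "(norm (g k x))\<^sup>2 \<le> M * (1 / 2) ^ k" using M[of k] by (simp add: field_simps power_one_over)
      then have "sqrt ((norm (g k x))\<^sup>2) \<le> sqrt (M * (1 / 2) ^ k)" by (rule real_sqrt_le_mono)
      then show "norm (norm (g k x)) \<le> sqrt M * (1 / sqrt 2) ^ k"
        by (simp add: real_sqrt_mult real_sqrt_power real_sqrt_divide)
    qed
  qed
qed

lemma nsq_minus_commute: "nsq (\<lambda>x. f x - g x) = nsq (\<lambda>x. g x - f x)"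
  unfolding nsq_def by (simp add: norm_minus_commute)

lemma nsq_diff_le:
  assumes "f \<in> borel_measurable borel" "g \<in> borel_measurable borel" "h \<in> borel_measurable borel"
  shows "nsq (\<lambda>x. f x - h x) \<le> 2 * nsq (\<lambda>x. f x - g x) + 2 * nsq (\<lambda>x. g x - h x)"
  using nsq_add_le[of "\<lambda>x. f x - g x" "\<lambda>x. g x - h x"] assms by simp

lemma pairing_tendsto:
  fixes f :: "'a::euclidean_space \<Rightarrow> complex"
  assumes [measurable]: "\<And>k. g k \<in> borel_measurable borel" "f \<in> borel_measurable borel" "\<psi> \<in> borel_measurable borel"
    and fin: "\<And>k. nsq (g k) < top" "nsq f < top" "nsq \<psi> < top"
    and lim: "(\<lambda>k::nat. nsq (\<lambda>x. f x - g k x)) \<longlonglongrightarrow> 0"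
  shows "(\<lambda>k. LINT x|lborel. g k x * \<psi> x) \<longlonglongrightarrow> (LINT x|lborel. f x * \<psi> x)"
proof -
  have fin': "nsq (\<lambda>x. f x - g k x) < top" for k
    using nsq_add_le[of f "\<lambda>x. - g k x"] nsq_cmult[of "g k" "-1"] fin(1)[of k] fin(2)
    by (simp add: ennreal_mult_less_top order_le_less_trans)
  have "(\<lambda>k. nsq (\<lambda>x. f x - g k x) * nsq \<psi>) \<longlonglongrightarrow> 0"
    using ennreal_tendsto_cmult[OF fin(3) lim] by (simp add: mult.commute)
  then have "(\<lambda>k. ennreal ((norm (LINT x|lborel. (f x - g k x) * \<psi> x))\<^sup>2)) \<longlonglongrightarrow> 0"
  proof (rule tendsto_sandwich[OF _ _ tendsto_const, rotated 2])
    show "\<forall>\<^sub>F k in sequentially. ennreal ((norm (LINT x|lborel. (f x - g k x) * \<psi> x))\<^sup>2) \<le> nsq (\<lambda>x. f x - g k x) * nsq \<psi>"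
      by (intro always_eventually allI integrable_mult_nsq(2) fin fin') measurable
  qed simp
  then have "(\<lambda>k. (norm (LINT x|lborel. (f x - g k x) * \<psi> x))\<^sup>2) \<longlonglongrightarrow> 0"
    by (subst (asm) tendsto_ennreal_iff[of _ _ 0, unfolded ennreal_0]) auto
  then have "(\<lambda>k. sqrt ((norm (LINT x|lborel. (f x - g k x) * \<psi> x))\<^sup>2)) \<longlonglongrightarrow> sqrt 0"
    by (rule tendsto_real_sqrt)
  then have "(\<lambda>k. LINT x|lborel. (f x - g k x) * \<psi> x) \<longlonglongrightarrow> 0"
    by (simp add: tendsto_norm_zero_iff)
  then have "(\<lambda>k. (LINT x|lborel. f x * \<psi> x) - (LINT x|lborel. (f x - g k x) * \<psi> x)) \<longlonglongrightarrow> (LINT x|lborel. f x * \<psi> x) - 0"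
    by (intro tendsto_diff tendsto_const)
  moreover have "(LINT x|lborel. f x * \<psi> x) - (LINT x|lborel. (f x - g k x) * \<psi> x) = (LINT x|lborel. g k x * \<psi> x)" for k
  proof -
    have "integrable lborel (\<lambda>x. f x * \<psi> x)" "integrable lborel (\<lambda>x. g k x * \<psi> x)"
      using integrable_mult_nsq(1) assms(1-3) fin by blast+
    then show ?thesis by (simp add: left_diff_distrib)
  qed
  ultimately show ?thesis by simp
qed

lemma truncation_tendsto:
  fixes f :: "'a::euclidean_space \<Rightarrow> complex"
  assumes [measurable]: "f \<in> borel_measurable borel" and fin: "nsq f < top"
  shows "(\<lambda>n. nsq (\<lambda>x. f x - indicator (cball 0 (real n)) x * f x)) \<longlonglongrightarrow> 0"
proof -
  have [measurable]: "cball 0 (real n) \<in> sets borel" for n by simp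
  have "(\<lambda>n. \<integral>\<^sup>+ x. ennreal ((norm (f x - indicator (cball 0 (real n)) x * f x))\<^sup>2) \<partial>lborel) \<longlonglongrightarrow> (\<integral>\<^sup>+ x. 0 \<partial>(lborel :: 'a measure))"
  proof (rule nn_integral_dominated_convergence[where w="\<lambda>x. ennreal ((norm (f x))\<^sup>2)"])
    show "AE x in lborel. (\<lambda>n. ennreal ((norm (f x - indicator (cball 0 (real n)) x * f x))\<^sup>2)) \<longlonglongrightarrow> 0"
    proof (intro AE_I2 tendsto_eventually)
      fix x :: 'a
      obtain N :: nat where "norm x \<le> N" using real_arch_simple by blast
      then show "\<forall>\<^sub>F n in sequentially. ennreal ((norm (f x - indicator (cball 0 (real n)) x * f x))\<^sup>2) = 0"
        by (intro eventually_sequentiallyI[of N]) (auto simp: indicator_def)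
    qed
  qed (use fin in \<open>auto simp: nsq_def indicator_def less_top\<close>)
  then show ?thesis by (simp add: nsq_def)
qed

lemma integrable_truncation:
  fixes f :: "'a::euclidean_space \<Rightarrow> complex"
  assumes [measurable]: "f \<in> borel_measurable borel" and fin: "nsq f < top"
  shows "integrable lborel (\<lambda>x. indicator (cball 0 (real n)) x * f x)"
    and "nsq (\<lambda>x. indicator (cball 0 (real n)) x * f x) \<le> nsq f"
proof -
  have "nsq (indicator (cball 0 (real n)) :: 'a \<Rightarrow> complex) = emeasure lborel (cball (0::'a) (real n))"
  proof -
    have "nsq (indicator (cball 0 (real n)) :: 'a \<Rightarrow> complex) = (\<integral>\<^sup>+ x. indicator (cball (0::'a) (real n)) x \<partial>lborel)"
      unfolding nsq_def by (intro nn_integral_cong) (auto simp: indicator_def)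
    then show ?thesis by simp
  qed
  also have "\<dots> < top" using emeasure_lborel_cball_finite by (simp add: less_top)
  finally show "integrable lborel (\<lambda>x. indicator (cball 0 (real n)) x * f x)"
    by (intro integrable_mult_nsq(1) fin borel_measurable_indicator) simp_all
  show "nsq (\<lambda>x. indicator (cball 0 (real n)) x * f x) \<le> nsq f"
    unfolding nsq_def by (intro nn_integral_mono) (auto simp: indicator_def)
qed

text \<open>The transform of \<open>f\<close> is the limit of the transforms of its truncations: truncating along a
  sufficiently fast sequence makes the transforms converge almost everywhere.\<close>

lemma fourier_L2_exists:
  fixes f :: "'a::euclidean_space \<Rightarrow> complex"
  assumes f[measurable]: "f \<in> borel_measurable borel" and fin: "nsq f < top"
  obtains g where "g \<in> borel_measurable borel" "nsq g < top"
    "\<And>\<psi>. integrable lborel \<psi> \<Longrightarrow> nsq \<psi> < top \<Longrightarrow> (LINT x|lborel. g x * \<psi> x) = (LINT x|lborel. f x * fourier \<psi> x)"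
proof -
  let ?T = "\<lambda>n x. indicator (cball 0 (real n)) x * f x"
  have "\<exists>n. nsq (\<lambda>x. f x - ?T n x) < ennreal ((1 / 4) ^ (k + 1))" for k
    using order_tendstoD(2)[OF truncation_tendsto[OF f fin], of "ennreal ((1 / 4) ^ (k + 1))"]
    by (auto simp: eventually_sequentially)
  then obtain r where r: "nsq (\<lambda>x. f x - ?T (r k) x) < ennreal ((1 / 4) ^ (k + 1))" for k by metis
  define h where "h k = ?T (r k)" for k
  have hm[measurable]: "h k \<in> borel_measurable borel" for k
  proof -
    have [measurable]: "cball (0::'a) (real (r k)) \<in> sets borel" by simp
    show ?thesis unfolding h_def by measurable
  qed
  have hi: "integrable lborel (h k)" for k unfolding h_def by (rule integrable_truncation(1)[OF f fin])
  have hf: "nsq (h k) < top" for k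
    unfolding h_def using integrable_truncation(2)[OF f fin] fin order_le_less_trans by blast
  have hd: "nsq (\<lambda>x. f x - h k x) \<le> ennreal ((1 / 4) ^ (k + 1))" for k
    unfolding h_def using r[of k] by (rule less_imp_le)
  have hdiff: "nsq (\<lambda>x. h m x - h k x) \<le> ennreal ((1 / 4) ^ k)" if "k \<le> m" for k m
  proof -
    have "nsq (\<lambda>x. h m x - h k x) \<le> 2 * nsq (\<lambda>x. h m x - f x) + 2 * nsq (\<lambda>x. f x - h k x)"
      by (intro nsq_diff_le) measurable
    also have "\<dots> \<le> 2 * ennreal ((1 / 4) ^ (k + 1)) + 2 * ennreal ((1 / 4) ^ (k + 1))"
    proof (intro add_mono mult_left_mono hd)
      have "(1 / 4) ^ (m + 1) \<le> (1 / 4 :: real) ^ (k + 1)" using that by (intro power_decreasing) auto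
      then show "nsq (\<lambda>x. h m x - f x) \<le> ennreal ((1 / 4) ^ (k + 1))"
        unfolding nsq_minus_commute[of "h m" f] by (intro order_trans[OF hd] ennreal_leI)
    qed auto
    also have "\<dots> = ennreal ((1 / 4) ^ k)"
    proof -
      have 2: "2 * ennreal p = ennreal (2 * p)" if "p \<ge> 0" for p
        using that by (simp add: ennreal_mult)
      show ?thesis by (subst (1 2) 2, simp, simp, subst ennreal_plus[symmetric]) simp_all
    qed
    finally show ?thesis .
  qed
  define F where "F k = fourier (h k)" for k
  have Fm[measurable]: "F k \<in> borel_measurable borel" for k unfolding F_def by measurable
  have Fsub: "F m x - F k x = fourier (\<lambda>x. h m x - h k x) x" for m k x
  proof -
    have "(LINT y|lborel. exp (- \<i> * complex_of_real (y \<bullet> x)) * (h m y - h k y)) =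
      (LINT y|lborel. exp (- \<i> * complex_of_real (y \<bullet> x)) * h m y) - (LINT y|lborel. exp (- \<i> * complex_of_real (y \<bullet> x)) * h k y)"
      using integrable_character_mult[OF hi] by (simp add: right_diff_distrib)
    then show ?thesis unfolding F_def by (simp add: fourier_borel scaleR_diff_right)
  qed
  have Fdiff: "nsq (\<lambda>x. F m x - F k x) \<le> ennreal ((1 / 4) ^ k)" if "k \<le> m" for k m
    unfolding Fsub using hdiff[OF that] nsq_fourier_le[of "\<lambda>x. h m x - h k x"] hi order_trans by fastforce
  have "AE x in lborel. summable (\<lambda>k. norm (F (Suc k) x - F k x))"
    by (rule AE_summable_of_nsq_le) (auto intro!: Fdiff)
  then have conv: "AE x in lborel. convergent (\<lambda>k. F k x)"
  proof eventually_elim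
    case (elim x)
    then have "summable (\<lambda>k. F (Suc k) x - F k x)" by (rule summable_norm_cancel)
    then obtain L where "(\<lambda>n. \<Sum>i<n. F (Suc i) x - F i x) \<longlonglongrightarrow> L"
      by (auto simp: summable_def sums_def)
    then have "(\<lambda>n. (F n x - F 0 x) + F 0 x) \<longlonglongrightarrow> L + F 0 x"
      unfolding sum_lessThan_telescope[of "\<lambda>k. F k x"] by (intro tendsto_intros)
    then show ?case by (auto simp: convergent_def)
  qed
  define g where "g x = lim (\<lambda>k. F k x)" for x
  have gm[measurable]: "g \<in> borel_measurable borel" unfolding g_def by measurable
  have glim: "AE x in lborel. (\<lambda>k. F k x) \<longlonglongrightarrow> g x"
    using conv by eventually_elim (simp add: g_def convergent_LIMSEQ_iff)
  have gd: "nsq (\<lambda>x. g x - F k x) \<le> ennreal ((1 / 4) ^ k)" for k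
  unfolding nsq_eq_pmass
  proof (rule pmass_Fatou[where f="\<lambda>m x. F m x - F k x"])
    show "AE x in lborel. (\<lambda>m. F m x - F k x) \<longlonglongrightarrow> g x - F k x"
      using glim by eventually_elim (intro tendsto_intros)
    show "\<forall>\<^sub>F m in sequentially. pmass 2 (\<lambda>x. F m x - F k x) \<le> ennreal ((1 / 4) ^ k)"
      using Fdiff unfolding nsq_eq_pmass by (intro eventually_sequentiallyI[of k])
  qed auto
  have Ff: "nsq (F k) < top" for k
    unfolding F_def using nsq_fourier_le[OF hi] hf order_le_less_trans by blast
  have "nsq g \<le> 2 * nsq (\<lambda>x. g x - F 0 x) + 2 * nsq (F 0)"
    using nsq_add_le[of "\<lambda>x. g x - F 0 x" "F 0"] by simp
  also have "\<dots> < top" using gd[of 0] Ff[of 0] by (auto simp: ennreal_mult_less_top intro: order_le_less_trans)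
  finally have gf: "nsq g < top" .
  have p0: "(\<lambda>k. ennreal ((1 / 4) ^ k)) \<longlonglongrightarrow> 0"
    using tendsto_ennrealI[OF LIMSEQ_power_zero[of "1/4 :: real"]] by simp
  have l1: "(\<lambda>k. nsq (\<lambda>x. g x - F k x)) \<longlonglongrightarrow> 0"
    by (rule tendsto_sandwich[OF _ _ tendsto_const p0]) (auto intro: always_eventually gd)
  have l2: "(\<lambda>k. nsq (\<lambda>x. f x - h k x)) \<longlonglongrightarrow> 0"
    by (rule tendsto_sandwich[OF _ _ tendsto_const LIMSEQ_ignore_initial_segment[OF p0, of 1]]) (simp, intro always_eventually allI hd)
  show thesis
  proof (rule that[OF gm gf])
    fix \<psi> :: "'a \<Rightarrow> complex" assume \<psi>: "integrable lborel \<psi>" "nsq \<psi> < top"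
    have \<psi>m: "\<psi> \<in> borel_measurable borel" using \<psi> by (simp add: integrable_iff_bounded)
    have a: "(\<lambda>k. LINT x|lborel. F k x * \<psi> x) \<longlonglongrightarrow> (LINT x|lborel. g x * \<psi> x)"
      by (rule pairing_tendsto[OF Fm gm \<psi>m Ff gf \<psi>(2) l1])
    have b: "(\<lambda>k. LINT x|lborel. h k x * fourier \<psi> x) \<longlonglongrightarrow> (LINT x|lborel. f x * fourier \<psi> x)"
      by (rule pairing_tendsto[OF hm f borel_measurable_fourier[OF \<psi>m] hf fin order_le_less_trans[OF nsq_fourier_le[OF \<psi>(1)] \<psi>(2)] l2])
    have "(LINT x|lborel. F k x * \<psi> x) = (LINT x|lborel. h k x * fourier \<psi> x)" for k
      unfolding F_def by (rule fourier_multiplication[OF hi \<psi>(1)])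
    with a b show "(LINT x|lborel. g x * \<psi> x) = (LINT x|lborel. f x * fourier \<psi> x)"
      using LIMSEQ_unique by fastforce
  qed
qed

lemma nn_integral_lborel_affine:
  fixes f :: "'a::euclidean_space \<Rightarrow> ennreal"
  assumes [measurable]: "f \<in> borel_measurable borel" and "c \<noteq> 0"
  shows "(\<integral>\<^sup>+ x. f x \<partial>lborel) = ennreal (\<bar>c\<bar> ^ DIM('a)) * (\<integral>\<^sup>+ x. f (t + c *\<^sub>R x) \<partial>lborel)"
  by (subst lborel_affine[OF assms(2), of t]) (simp add: nn_integral_density nn_integral_distr nn_integral_cmult)

lemma integral_lborel_affine:
  fixes f :: "'a::euclidean_space \<Rightarrow> 'b::{banach, second_countable_topology}"
  assumes [measurable]: "f \<in> borel_measurable borel" and "c \<noteq> 0"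
  shows "(LINT x|lborel. f x) = (\<bar>c\<bar> ^ DIM('a)) *\<^sub>R (LINT x|lborel. f (t + c *\<^sub>R x))"
  by (subst lborel_affine[OF assms(2), of t]) (simp add: integral_density integral_distr)

lemma integral_lborel_reflect:
  fixes f :: "'a::euclidean_space \<Rightarrow> 'b::{banach, second_countable_topology}"
  assumes "f \<in> borel_measurable borel"
  shows "(LINT x|lborel. f (- x)) = (LINT x|lborel. f x)"
    and "integrable lborel (\<lambda>x. f (- x)) \<longleftrightarrow> integrable lborel f"
proof -
  have d: "distr lborel borel uminus = (lborel :: 'a measure)"
    using lborel_affine[of "-1" "0::'a"] by (simp add: density_1)
  have "(LINT x|lborel. f (- x)) = (LINT x|distr lborel borel uminus. f x)"
    using assms by (subst integral_distr) auto
  then show "(LINT x|lborel. f (- x)) = (LINT x|lborel. f x)" by (simp add: d)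
  have "integrable lborel (\<lambda>x. f (- x)) \<longleftrightarrow> integrable (distr lborel borel uminus) f"
    using assms by (subst integrable_distr_eq) auto
  then show "integrable lborel (\<lambda>x. f (- x)) \<longleftrightarrow> integrable lborel f" by (simp add: d)
qed

lemma nsq_reflect:
  fixes f :: "'a::euclidean_space \<Rightarrow> complex"
  assumes [measurable]: "f \<in> borel_measurable borel"
  shows "nsq (\<lambda>x. f (- x)) = nsq f"
proof -
  have d: "distr lborel borel uminus = (lborel :: 'a measure)"
    using lborel_affine[of "-1" "0::'a"] by (simp add: density_1)
  have "nsq (\<lambda>x. f (- x)) = (\<integral>\<^sup>+ x. ennreal ((norm (f x))\<^sup>2) \<partial>distr lborel borel uminus)"
    unfolding nsq_def by (subst nn_integral_distr) auto
  then show ?thesis by (simp add: d nsq_def)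
qed

lemma fourier_reflect:
  fixes f :: "'a::euclidean_space \<Rightarrow> complex"
  assumes [measurable]: "f \<in> borel_measurable borel"
  shows "fourier (\<lambda>x. f (- x)) \<xi> = fourier f (- \<xi>)"
proof -
  have "(LINT x|lborel. exp (- \<i> * complex_of_real (x \<bullet> \<xi>)) * f (- x)) = (LINT x|lborel. exp (- \<i> * complex_of_real (x \<bullet> (- \<xi>))) * f x)"
    using integral_lborel_reflect(1)[of "\<lambda>x. exp (- \<i> * complex_of_real (x \<bullet> (- \<xi>))) * f x"] by simp
  then show ?thesis by (simp add: fourier_borel)
qed

text \<open>The evolution is the multiplier \<open>m\<close> between a transform and an inverse transform. Both are taken from
  \<open>fourier_L2_exists\<close>: inverse and direct transform differ by the reflection \<open>x \<mapsto> -x\<close>, which commutes with \<open>m\<close>.\<close>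

lemma schrodinger_L2_exists:
  fixes f :: "'a::euclidean_space \<Rightarrow> complex"
  assumes f[measurable]: "f \<in> borel_measurable borel" and fin: "nsq f < top"
  obtains g where "g \<in> borel_measurable borel" "nsq g < top"
    "\<And>\<phi>. \<phi> \<in> schwartz \<Longrightarrow> (LINT x|lborel. g x * \<phi> x) = (LINT x|lborel. f x * schrodinger t \<phi> x)"
proof -
  define m :: "'a \<Rightarrow> complex" where "m \<xi> = exp (- \<i> * complex_of_real (t * (norm \<xi>)\<^sup>2))" for \<xi>
  have mm[measurable]: "m \<in> borel_measurable borel" unfolding m_def by simp
  have m1: "norm (m \<xi>) = 1" "m (- \<xi>) = m \<xi>" for \<xi> by (simp_all add: m_def)
  have mn: "nsq (\<lambda>\<xi>. m \<xi> * h \<xi>) = nsq h" for h by (simp add: nsq_def norm_mult m1)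
  obtain g1 where g1: "g1 \<in> borel_measurable borel" "nsq g1 < top"
    "\<And>\<psi>. integrable lborel \<psi> \<Longrightarrow> nsq \<psi> < top \<Longrightarrow> (LINT x|lborel. g1 x * \<psi> x) = (LINT x|lborel. f x * fourier \<psi> x)"
    using fourier_L2_exists[OF f fin] by blast
  note [measurable] = g1(1)
  have k: "(\<lambda>\<xi>. m \<xi> * g1 \<xi>) \<in> borel_measurable borel" "nsq (\<lambda>\<xi>. m \<xi> * g1 \<xi>) < top"
    using g1(2) by (auto simp: mn)
  obtain g2 where g2: "g2 \<in> borel_measurable borel" "nsq g2 < top"
    "\<And>\<psi>. integrable lborel \<psi> \<Longrightarrow> nsq \<psi> < top \<Longrightarrow> (LINT x|lborel. g2 x * \<psi> x) = (LINT x|lborel. m x * g1 x * fourier \<psi> x)"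
    using fourier_L2_exists[OF k] by blast
  note [measurable] = g2(1)
  show thesis
  proof (rule that[of "\<lambda>x. g2 (- x)"])
    show "nsq (\<lambda>x. g2 (- x)) < top" using g2 by (simp add: nsq_reflect)
    fix \<phi> :: "'a \<Rightarrow> complex" assume \<phi>: "\<phi> \<in> schwartz"
    note [measurable] = schwartz_measurable[OF \<phi>]
    have F\<phi>: "integrable lborel (fourier \<phi>)" "nsq (fourier \<phi>) < top"
      using fourier_schwartz_integrable[OF \<phi>] nsq_fourier_le[OF schwartz_integrable[OF \<phi>]] schwartz_nsq[OF \<phi>]
      by (auto intro: order_le_less_trans)
    let ?\<psi> = "\<lambda>\<xi>. m \<xi> * fourier \<phi> (- \<xi>)"
    have r: "integrable lborel (\<lambda>\<xi>. fourier \<phi> (- \<xi>))" "nsq (\<lambda>\<xi>. fourier \<phi> (- \<xi>)) < top"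
      using F\<phi> by (simp_all add: integral_lborel_reflect nsq_reflect)
    have \<psi>: "integrable lborel ?\<psi>" "nsq ?\<psi> < top"
      using r(2) by (auto simp: mn intro!: Bochner_Integration.integrable_bound[OF r(1)] simp: norm_mult m1)
    have "(LINT x|lborel. g2 (- x) * \<phi> x) = (LINT x|lborel. g2 x * \<phi> (- x))"
      using integral_lborel_reflect(1)[of "\<lambda>x. g2 x * \<phi> (- x)"] by simp
    also have "\<dots> = (LINT x|lborel. m x * g1 x * fourier (\<lambda>x. \<phi> (- x)) x)"
      using schwartz_integrable[OF \<phi>] schwartz_nsq[OF \<phi>]
      by (intro g2(3)) (simp_all add: integral_lborel_reflect nsq_reflect)
    also have "\<dots> = (LINT x|lborel. g1 x * ?\<psi> x)"
      by (simp add: fourier_reflect mult_ac)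
    also have "\<dots> = (LINT x|lborel. f x * fourier ?\<psi> x)"
      by (rule g1(3)[OF \<psi>])
    also have "fourier ?\<psi> = schrodinger t \<phi>"
    proof
      fix x :: 'a
      have "fourier ?\<psi> x = fourier (\<lambda>\<xi>. m \<xi> * fourier \<phi> \<xi>) (- x)"
        using fourier_reflect[of "\<lambda>\<xi>. m \<xi> * fourier \<phi> \<xi>" x] by (simp add: m1)
      then show "fourier ?\<psi> x = schrodinger t \<phi> x"
        by (simp add: schrodinger_def inv_fourier_eq m_def)
    qed
    finally show "(LINT x|lborel. g2 (- x) * \<phi> x) = (LINT x|lborel. f x * schrodinger t \<phi> x)" .
  qed measurable
qed

lemma borel_measurable_schrodinger [measurable]:
  "\<phi> \<in> borel_measurable borel \<Longrightarrow> schrodinger t \<phi> \<in> borel_measurable borel"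
proof -
  assume [measurable]: "\<phi> \<in> borel_measurable borel"
  have "schrodinger t \<phi> = (\<lambda>x. fourier (\<lambda>\<xi>. exp (- \<i> * complex_of_real (t * (norm \<xi>)\<^sup>2)) * fourier \<phi> \<xi>) (- x))"
    by (simp add: fun_eq_iff schrodinger_def inv_fourier_eq)
  also have "\<dots> \<in> borel_measurable borel" by measurable
  finally show ?thesis .
qed

lemma tdist_borel:
  assumes "f \<in> borel_measurable lebesgue" "g \<in> borel_measurable borel" "AE x in lborel. f x = g x"
    "\<psi> \<in> borel_measurable borel"
  shows "tdist f \<psi> = (LINT x|lborel. g x * \<psi> x)"
  unfolding tdist_def
proof (rule lebesgue_integral_eq_lborel)
  show "(\<lambda>x. f x * \<psi> x) \<in> borel_measurable lebesgue"
    using assms by (intro borel_measurable_times) (auto intro: measurable_completion)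
qed (use assms in auto)

lemma fourier_L2_represents:
  fixes f :: "'a::euclidean_space \<Rightarrow> complex"
  assumes "f \<in> Lp 2"
  shows "L2_represents (fourier_L2 f) (\<lambda>\<phi>. tdist f (fourier \<phi>))"
proof -
  have f: "f \<in> borel_measurable lebesgue" "nsq f < top" using assms by (auto simp: Lp2_iff)
  obtain f' where f': "f' \<in> borel_measurable borel" "AE x in lborel. f x = f' x"
    using lebesgue_borel_representative[OF f(1)] by blast
  then have "nsq f' < top" using f(2) nsq_cong_AE[of f f'] by simp
  then obtain g where g: "g \<in> borel_measurable borel" "nsq g < top"
    "\<And>\<psi>. integrable lborel \<psi> \<Longrightarrow> nsq \<psi> < top \<Longrightarrow> (LINT x|lborel. g x * \<psi> x) = (LINT x|lborel. f' x * fourier \<psi> x)"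
    using fourier_L2_exists[OF f'(1)] by blast
  have "L2_represents g (\<lambda>\<phi>. tdist f (fourier \<phi>))"
    unfolding L2_represents_def
  proof (intro conjI ballI)
    show "g \<in> Lp 2" using g by (simp add: Lp2_iff measurable_completion)
    fix \<phi> :: "'a \<Rightarrow> complex" assume \<phi>: "\<phi> \<in> schwartz"
    have "tdist f (fourier \<phi>) = (LINT x|lborel. f' x * fourier \<phi> x)"
      by (rule tdist_borel[OF f(1) f']) (use schwartz_measurable[OF \<phi>] in simp)
    moreover have "tdist g \<phi> = (LINT x|lborel. g x * \<phi> x)"
      by (rule tdist_borel[OF _ g(1)]) (use schwartz_measurable[OF \<phi>] g in \<open>auto simp: measurable_completion\<close>)
    ultimately show "tdist f (fourier \<phi>) = tdist g \<phi>"
      using g(3)[OF schwartz_integrable[OF \<phi>] schwartz_nsq[OF \<phi>]] by simp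
  qed
  then show ?thesis unfolding fourier_L2_def by (rule someI[where P="\<lambda>g. L2_represents g (\<lambda>\<phi>. tdist f (fourier \<phi>))"])
qed

lemma schrodinger_L2_represents:
  fixes f :: "'a::euclidean_space \<Rightarrow> complex"
  assumes "f \<in> Lp 2"
  shows "L2_represents (schrodinger_L2 t f) (schrodinger_dist t (tdist f))"
proof -
  have f: "f \<in> borel_measurable lebesgue" "nsq f < top" using assms by (auto simp: Lp2_iff)
  obtain f' where f': "f' \<in> borel_measurable borel" "AE x in lborel. f x = f' x"
    using lebesgue_borel_representative[OF f(1)] by blast
  then have "nsq f' < top" using f(2) nsq_cong_AE[of f f'] by simp
  then obtain g where g: "g \<in> borel_measurable borel" "nsq g < top"
    "\<And>\<phi>. \<phi> \<in> schwartz \<Longrightarrow> (LINT x|lborel. g x * \<phi> x) = (LINT x|lborel. f' x * schrodinger t \<phi> x)"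
    using schrodinger_L2_exists[OF f'(1)] by blast
  have "L2_represents g (schrodinger_dist t (tdist f))"
    unfolding L2_represents_def schrodinger_dist_def
  proof (intro conjI ballI)
    show "g \<in> Lp 2" using g by (simp add: Lp2_iff measurable_completion)
    fix \<phi> :: "'a \<Rightarrow> complex" assume \<phi>: "\<phi> \<in> schwartz"
    have "tdist f (schrodinger t \<phi>) = (LINT x|lborel. f' x * schrodinger t \<phi> x)"
      by (rule tdist_borel[OF f(1) f']) (use schwartz_measurable[OF \<phi>] in simp)
    moreover have "tdist g \<phi> = (LINT x|lborel. g x * \<phi> x)"
      by (rule tdist_borel[OF _ g(1)]) (use schwartz_measurable[OF \<phi>] g in \<open>auto simp: measurable_completion\<close>)
    ultimately show "tdist f (schrodinger t \<phi>) = tdist g \<phi>"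
      using g(3)[OF \<phi>] by simp
  qed
  then show ?thesis unfolding schrodinger_L2_def by (rule someI[where P="\<lambda>g. L2_represents g (schrodinger_dist t (tdist f))"])
qed

subsection \<open>Injectivity of the Fourier transform\<close>

text \<open>The positive and the negative part of \<open>f\<close> are densities of finite measures that agree on boxes, and
  boxes generate the Borel sets.\<close>

lemma AE_zero_of_box_integrals_real:
  fixes f :: "'a::euclidean_space \<Rightarrow> real"
  assumes f: "integrable lborel f"
    and box: "\<And>a b. (LINT x|lborel. indicator (box a b) x * f x) = 0"
  shows "AE x in lborel. f x = 0"
proof -
  have [measurable]: "f \<in> borel_measurable borel" using f by (simp add: integrable_iff_bounded)
  let ?P = "density lborel (\<lambda>x. ennreal (f x))" and ?N = "density lborel (\<lambda>x. ennreal (- f x))"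
  have fin: "(\<integral>\<^sup>+ x. ennreal (f x) \<partial>lborel) < top" "(\<integral>\<^sup>+ x. ennreal (- f x) \<partial>lborel) < top"
    using f by (auto simp: real_integrable_def less_top)
  have eq: "emeasure ?P (box a b) = emeasure ?N (box a b)" for a b
  proof -
    have P: "emeasure ?P (box a b) = (\<integral>\<^sup>+ x. ennreal (indicator (box a b) x * f x) \<partial>lborel)"
      by (subst emeasure_density) (auto intro!: nn_integral_cong simp: indicator_def)
    have N: "emeasure ?N (box a b) = (\<integral>\<^sup>+ x. ennreal (- (indicator (box a b) x * f x)) \<partial>lborel)"
      by (subst emeasure_density) (auto intro!: nn_integral_cong simp: indicator_def)
    have fP: "emeasure ?P (box a b) < top"
      using fin(1) unfolding P by (rule order_le_less_trans[rotated]) (auto intro!: nn_integral_mono simp: indicator_def)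
    have fN: "emeasure ?N (box a b) < top"
      using fin(2) unfolding N by (rule order_le_less_trans[rotated]) (auto intro!: nn_integral_mono simp: indicator_def)
    have i: "integrable lborel (\<lambda>x. indicator (box a b) x * f x)"
      by (rule Bochner_Integration.integrable_bound[OF f]) (auto simp: indicator_def)
    have "enn2real (emeasure ?P (box a b)) - enn2real (emeasure ?N (box a b)) = 0"
      using real_lebesgue_integral_def[OF i] box[of a b] by (simp only: P N)
    then show ?thesis using fP fN
      by (metis eq_iff_diff_eq_0 ennreal_enn2real)
  qed
  have "?P = ?N"
  proof (rule measure_eqI_generator_eq)
    let ?E = "range (\<lambda>(a, b). box a b::'a set)"
    show "Int_stable ?E" by (auto simp: Int_stable_def box_Int_box)
    show "?E \<subseteq> Pow UNIV" "sets ?P = sigma_sets UNIV ?E" "sets ?N = sigma_sets UNIV ?E"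
      by (simp_all add: borel_eq_box)
    let ?A = "\<lambda>n::nat. box (- (real n *\<^sub>R One)) (real n *\<^sub>R One) :: 'a set"
    show "range ?A \<subseteq> ?E" "(\<Union>i. ?A i) = UNIV" unfolding UN_box_eq_UNIV by auto
    show "emeasure ?P X = emeasure ?N X" if "X \<in> ?E" for X using that eq by auto
    show "emeasure ?P (?A i) \<noteq> \<infinity>" for i
    proof -
      have "emeasure ?P (?A i) \<le> emeasure ?P (space ?P)" by (intro emeasure_mono) auto
      also have "\<dots> = (\<integral>\<^sup>+ x. ennreal (f x) \<partial>lborel)" by (subst emeasure_density) auto
      finally show ?thesis using fin by (simp add: less_top top.extremum_unique)
    qed
  qed
  then have "AE x in lborel. ennreal (f x) = ennreal (- f x)"
    by (intro sigma_finite_measure.density_unique[OF sigma_finite_lborel]) auto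
  then show ?thesis
  proof eventually_elim
    case (elim x)
    then show ?case by (cases "f x" "0 :: real" rule: linorder_cases) (auto simp: ennreal_neg ennreal_eq_0_iff dest: sym)
  qed
qed

lemma AE_zero_of_box_integrals:
  fixes f :: "'a::euclidean_space \<Rightarrow> complex"
  assumes f: "integrable lborel f"
    and box: "\<And>a b. (LINT x|lborel. indicator (box a b) x * f x) = 0"
  shows "AE x in lborel. f x = 0"
proof -
  have [measurable]: "f \<in> borel_measurable borel" using f by (simp add: integrable_iff_bounded)
  have i: "integrable lborel (\<lambda>x. indicator (box a b) x * f x)" for a b
    by (rule Bochner_Integration.integrable_bound[OF f]) (auto simp: indicator_def)
  have re: "Re (indicator A x * z) = indicator A x * Re z" and im: "Im (indicator A x * z) = indicator A x * Im z"
    for A and x :: 'a and z :: complex by (auto simp: indicator_def)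
  have "AE x in lborel. Re (f x) = 0"
  proof (rule AE_zero_of_box_integrals_real)
    show "integrable lborel (\<lambda>x. Re (f x))" using f by simp
    show "(LINT x|lborel. indicator (box a b) x * Re (f x)) = 0" for a b
      using integral_Re[OF i, of a b] unfolding re box by simp
  qed
  moreover have "AE x in lborel. Im (f x) = 0"
  proof (rule AE_zero_of_box_integrals_real)
    show "integrable lborel (\<lambda>x. Im (f x))" using f by simp
    show "(LINT x|lborel. indicator (box a b) x * Im (f x)) = 0" for a b
      using integral_Im[OF i, of a b] unfolding im box by simp
  qed
  ultimately show ?thesis by eventually_elim (simp add: complex_eq_iff)
qed

text \<open>Gaussians of width of order \<open>1/n\<close> centred at the points of a box average to functions that converge to the
  indicator of the box off its boundary; this reduces the claim to integrals over boxes.\<close>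

lemma AE_zero_of_gaussian_integrals:
  fixes f :: "'a::euclidean_space \<Rightarrow> complex"
  assumes f: "integrable lborel f"
    and G: "\<And>b y. b > 0 \<Longrightarrow> (LINT x|lborel. f x * of_real (exp (- b * (norm (x - y))\<^sup>2))) = 0"
  shows "AE x in lborel. f x = 0"
proof (rule AE_zero_of_box_integrals[OF f])
  have fm[measurable]: "f \<in> borel_measurable borel" using f by (simp add: integrable_iff_bounded)
  fix a b :: 'a
  have [measurable]: "box a b \<in> sets borel" by simp
  define g where "g w = exp (- 1 * (norm w)\<^sup>2)" for w :: 'a
  have [measurable]: "g \<in> borel_measurable borel" unfolding g_def by simp
  define Z where "Z = (LINT w|lborel. g w)"
  have gi: "integrable lborel g" and Z: "Z > 0"
  proof -
    have 1: "has_bochner_integral lborel (\<lambda>x::'a. complex_of_real (exp (- 1 * (norm x)\<^sup>2))) (of_real (pi powr (DIM('a) / 2)))"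
      using gaussian_fourier[of 1 "0::'a"] by simp
    have "has_bochner_integral lborel g (pi powr (DIM('a) / 2))"
      using has_bochner_integral_Re[OF 1] unfolding g_def by simp
    then show "integrable lborel g" "Z > 0" by (auto simp: has_bochner_integral_iff Z_def)
  qed
  define J where "J n x = (LINT w|lborel. indicator (box a b) (x + (1 / real (Suc n)) *\<^sub>R w) * g w)" for n x
  have Jm[measurable]: "J n \<in> borel_measurable borel" for n unfolding J_def by measurable
  have ib: "integrable lborel (\<lambda>w. indicator (box a b) (x + c *\<^sub>R w) * g w)" for x c
    by (rule Bochner_Integration.integrable_bound[OF gi]) (auto simp: indicator_def g_def)
  have J01: "0 \<le> J n x" "J n x \<le> Z" for n x
  proof -
    show "0 \<le> J n x" unfolding J_def by (intro Bochner_Integration.integral_nonneg) (auto simp: indicator_def g_def)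
    show "J n x \<le> Z" unfolding J_def Z_def by (intro integral_mono ib gi) (auto simp: indicator_def g_def)
  qed
  have Jlim: "(\<lambda>n. J n x) \<longlonglongrightarrow> indicator (box a b) x * Z" if x: "x \<notin> cbox a b - box a b" for x
  proof -
    have "(\<lambda>n. J n x) \<longlonglongrightarrow> (LINT w|lborel. indicator (box a b) x * g w)"
      unfolding J_def
    proof (rule integral_dominated_convergence[where w=g])
      show "AE w in lborel. (\<lambda>n. indicator (box a b) (x + (1 / real (Suc n)) *\<^sub>R w) * g w) \<longlonglongrightarrow> indicator (box a b) x * g w"
      proof (intro AE_I2 tendsto_mult tendsto_const)
        fix w
        have l: "(\<lambda>n. x + (1 / real (Suc n)) *\<^sub>R w) \<longlonglongrightarrow> x + 0 *\<^sub>R w"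
          by (intro tendsto_intros LIMSEQ_Suc[OF lim_1_over_n])
        show "(\<lambda>n. indicator (box a b) (x + (1 / real (Suc n)) *\<^sub>R w)) \<longlonglongrightarrow> (indicator (box a b) x :: real)"
        proof (cases "x \<in> box a b")
          case True
          then have "\<forall>\<^sub>F n in sequentially. x + (1 / real (Suc n)) *\<^sub>R w \<in> box a b"
            using topological_tendstoD[OF l, of "box a b"] by (simp add: open_box)
          then show ?thesis using True by (intro tendsto_eventually) (auto elim!: eventually_mono)
        next
          case False
          then have "x \<in> - cbox a b" using x by auto
          then have "\<forall>\<^sub>F n in sequentially. x + (1 / real (Suc n)) *\<^sub>R w \<in> - cbox a b"
            using topological_tendstoD[OF l open_Compl[OF closed_cbox[of a b]]] by simp
          then have "\<forall>\<^sub>F n in sequentially. indicator (box a b) (x + (1 / real (Suc n)) *\<^sub>R w) = (indicator (box a b) x :: real)"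
          proof eventually_elim
            case (elim n)
            then have "x + (1 / real (Suc n)) *\<^sub>R w \<notin> box a b" using box_subset_cbox by blast
            then show ?case using False by simp
          qed
          then show ?thesis by (rule tendsto_eventually)
        qed
      qed
    qed (use gi in \<open>auto simp: indicator_def g_def\<close>)
    then show ?thesis by (simp add: Z_def)
  qed
  have zero: "(LINT x|lborel. f x * of_real (J n x)) = 0" for n
  proof -
    define c where "c = 1 / real (Suc n)"
    have c: "c > 0" by (simp add: c_def)
    have cd: "c ^ DIM('a) > 0" using c by simp
    define k where "k x y = g ((1 / c) *\<^sub>R (y - x))" for x y
    have k: "k x y = exp (- (1 / c\<^sup>2) * (norm (x - y))\<^sup>2)" for x y
      using c by (simp add: k_def g_def norm_minus_commute power_mult_distrib power_divide)
    have km[measurable]: "(\<lambda>(x, y). k x y) \<in> borel_measurable (borel \<Otimes>\<^sub>M borel)" unfolding k_def by measurable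
    have J: "c ^ DIM('a) * J n x = (LINT y|lborel. indicator (box a b) y * k x y)" for x
    proof -
      have "(LINT y|lborel. indicator (box a b) y * k x y) = \<bar>c\<bar> ^ DIM('a) *\<^sub>R (LINT w|lborel. indicator (box a b) (x + c *\<^sub>R w) * k x (x + c *\<^sub>R w))"
        using c by (intro integral_lborel_affine) (auto simp: k_def)
      also have "(LINT w|lborel. indicator (box a b) (x + c *\<^sub>R w) * k x (x + c *\<^sub>R w)) = J n x"
        using c by (simp add: k_def J_def c_def)
      finally show ?thesis using c by simp
    qed
    have i2: "integrable (lborel \<Otimes>\<^sub>M lborel) (\<lambda>(x, y). f x * complex_of_real (indicator (box a b) y * k x y))"
    proof (rule Bochner_Integration.integrable_bound)
      have "integrable lborel (indicator (box a b) :: 'a \<Rightarrow> real)"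
        using emeasure_lborel_box_finite[of a b] by (simp add: integrable_indicator_iff)
      then show "integrable (lborel \<Otimes>\<^sub>M lborel) (\<lambda>(x, y). f x * complex_of_real (indicator (box a b) y))"
        using f by (intro lborel_pair.Fubini_integrable) (auto simp: norm_mult)
      show "AE z in lborel \<Otimes>\<^sub>M lborel. norm (case z of (x, y) \<Rightarrow> f x * complex_of_real (indicator (box a b) y * k x y)) \<le>
          norm (case z of (x, y) \<Rightarrow> f x * complex_of_real (indicator (box a b) y))"
        by (intro AE_I2) (auto simp: indicator_def norm_mult k mult_left_le)
    qed measurable
    have "c ^ DIM('a) * (LINT x|lborel. f x * of_real (J n x)) = (LINT x|lborel. f x * of_real (c ^ DIM('a) * J n x))"
      by (subst integral_mult_right_zero[symmetric]) (simp add: mult_ac)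
    also have "\<dots> = (LINT x|lborel. LINT y|lborel. f x * complex_of_real (indicator (box a b) y * k x y))"
      unfolding J by (simp del: of_real_mult)
    also have "\<dots> = (LINT y|lborel. LINT x|lborel. f x * complex_of_real (indicator (box a b) y * k x y))"
      using lborel_pair.Fubini_integral[OF i2] by simp
    also have "\<dots> = (LINT y|(lborel :: 'a measure). 0)"
    proof (intro Bochner_Integration.integral_cong refl)
      fix y
      have "(LINT x|lborel. f x * complex_of_real (indicator (box a b) y * k x y)) =
        complex_of_real (indicator (box a b) y) * (LINT x|lborel. f x * of_real (exp (- (1 / c\<^sup>2) * (norm (x - y))\<^sup>2)))"
        by (subst integral_mult_right_zero[symmetric]) (simp add: mult_ac k)
      also have "\<dots> = 0" using G[of "1 / c\<^sup>2" y] c by simp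
      finally show "(LINT x|lborel. f x * complex_of_real (indicator (box a b) y * k x y)) = 0" .
    qed
    finally show ?thesis using c by simp
  qed
  have "(\<lambda>n. LINT x|lborel. f x * of_real (J n x)) \<longlonglongrightarrow> (LINT x|lborel. f x * of_real (indicator (box a b) x * Z))"
  proof (rule integral_dominated_convergence[where w="\<lambda>x. Z * norm (f x)"])
    have "AE x in lborel. x \<notin> cbox a b - box a b"
    proof -
      have "cbox a b - box a b \<in> null_sets lebesgue"
        using negligible_frontier_interval[of a b] by (simp add: negligible_iff_null_sets)
      then show ?thesis by (metis AE_completion_iff AE_not_in)
    qed
    then show "AE x in lborel. (\<lambda>n. f x * complex_of_real (J n x)) \<longlonglongrightarrow> f x * complex_of_real (indicator (box a b) x * Z)"
      by eventually_elim (intro tendsto_intros Jlim)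
    show "AE x in lborel. norm (f x * complex_of_real (J n x)) \<le> Z * norm (f x)" for n
      using J01 by (intro AE_I2) (auto simp: norm_mult mult.commute[of Z] intro!: mult_left_mono)
    show "integrable lborel (\<lambda>x. Z * norm (f x))" using f by simp
  qed simp_all
  then have "(LINT x|lborel. f x * of_real (indicator (box a b) x * Z)) = 0"
    unfolding zero using LIMSEQ_unique tendsto_const by blast
  moreover have "f x * of_real (indicator (box a b) x * Z) = of_real Z * (indicator (box a b) x * f x)" for x
    by (cases "x \<in> box a b") simp_all
  ultimately have "of_real Z * (LINT x|lborel. indicator (box a b) x * f x) = 0"
    by (simp only: integral_mult_right_zero)
  then show "(LINT x|lborel. indicator (box a b) x * f x) = 0" using Z by simp
qed

text \<open>The Fourier transforms of the wave packets are all translated Gaussians. Multiplying \<open>f\<close> by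
  a fixed Gaussian makes it integrable and keeps this orthogonality, because a product of Gaussians is again
  a translated Gaussian.\<close>

lemma fourier_injective:
  fixes f :: "'a::euclidean_space \<Rightarrow> complex"
  assumes "f \<in> Lp 2" and orth: "\<And>\<phi>. \<phi> \<in> schwartz \<Longrightarrow> tdist f (fourier \<phi>) = 0"
  shows "AE x in lborel. f x = 0"
proof -
  have f: "f \<in> borel_measurable lebesgue" "nsq f < top" using assms by (auto simp: Lp2_iff)
  obtain f' where f': "f' \<in> borel_measurable borel" "AE x in lborel. f x = f' x"
    using lebesgue_borel_representative[OF f(1)] by blast
  have nf': "nsq f' < top" using f(2) nsq_cong_AE[OF f'(2)] by simp
  note [measurable] = f'(1)
  have gauss: "(LINT x|lborel. f' x * of_real (exp (- c * (norm (x - z))\<^sup>2))) = 0" if c: "c > 0" for c z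
  proof -
    define a where "a = 1 / (4 * c)"
    have a: "a > 0" "1 / (4 * a) = c" using c by (auto simp: a_def)
    have a': "- r / (4 * a) = - c * r" for r using c by (simp add: a_def)
    have "0 = tdist f (fourier (wave_packet a z))" using orth[OF wave_packet_schwartz[OF a(1)]] by simp
    also have "\<dots> = (LINT x|lborel. f' x * fourier (wave_packet a z) x)"
      by (rule tdist_borel[OF f(1) f' borel_measurable_fourier[OF schwartz_measurable[OF wave_packet_schwartz[OF a(1)]]]])
    also have "\<dots> = (LINT x|lborel. of_real ((2 * a) powr (- (DIM('a) / 2))) * (f' x * of_real (exp (- c * (norm (x - z))\<^sup>2))))"
      unfolding fourier_wave_packet[OF a(1)] a' by (simp add: mult_ac)
    finally show ?thesis using a(1) by simp
  qed
  let ?g = "\<lambda>x. f' x * of_real (exp (- 1 * (norm x)\<^sup>2))"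
  have "AE x in lborel. ?g x = 0"
  proof (rule AE_zero_of_gaussian_integrals)
    have "wave_packet 1 (0::'a) = (\<lambda>x. of_real (exp (- 1 * (norm x)\<^sup>2)))"
      by (simp add: wave_packet_def fun_eq_iff)
    then have "nsq (\<lambda>x::'a. complex_of_real (exp (- 1 * (norm x)\<^sup>2))) < top"
      using schwartz_nsq[OF wave_packet_schwartz[of 1 "0::'a"]] by simp
    then show "integrable lborel ?g"
      by (intro integrable_mult_nsq(1) nf') simp_all
    fix b :: real and y :: 'a assume b: "b > 0"
    \<comment> \<open>completing the square in \<open>|x|\<^sup>2 + b|x - y|\<^sup>2\<close>\<close>
    define c where "c = 1 + b"
    define z where "z = (b / c) *\<^sub>R y"
    have c: "c > 0" using b by (simp add: c_def)
    have sq: "(norm x)\<^sup>2 + b * (norm (x - y))\<^sup>2 = c * (norm (x - z))\<^sup>2 + (b - b\<^sup>2 / c) * (norm y)\<^sup>2" for x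
    proof -
      have "c * (norm (x - z))\<^sup>2 = c * (x \<bullet> x) - 2 * b * (x \<bullet> y) + b\<^sup>2 / c * (y \<bullet> y)"
        unfolding z_def power2_norm_eq_inner
        using c by (simp add: inner_diff_left inner_diff_right inner_commute field_simps power2_eq_square)
      then show ?thesis
        by (simp add: power2_norm_eq_inner inner_diff_left inner_diff_right inner_commute c_def algebra_simps)
    qed
    have "?g x * of_real (exp (- b * (norm (x - y))\<^sup>2)) =
      of_real (exp (- (b - b\<^sup>2 / c) * (norm y)\<^sup>2)) * (f' x * of_real (exp (- c * (norm (x - z))\<^sup>2)))" for x
    proof -
      have "exp (- 1 * (norm x)\<^sup>2) * exp (- b * (norm (x - y))\<^sup>2) = exp (- (b - b\<^sup>2 / c) * (norm y)\<^sup>2) * exp (- c * (norm (x - z))\<^sup>2)"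
        unfolding exp_add[symmetric] using sq[of x] by (simp add: algebra_simps)
      then show ?thesis by (metis (no_types, opaque_lifting) mult.assoc mult.commute of_real_mult)
    qed
    then have "(LINT x|lborel. ?g x * of_real (exp (- b * (norm (x - y))\<^sup>2))) =
      (LINT x|lborel. of_real (exp (- (b - b\<^sup>2 / c) * (norm y)\<^sup>2)) * (f' x * of_real (exp (- c * (norm (x - z))\<^sup>2))))"
      by (simp only:)
    then show "(LINT x|lborel. ?g x * of_real (exp (- b * (norm (x - y))\<^sup>2))) = 0"
      unfolding integral_mult_right_zero gauss[OF c, of z] by (simp only: mult_zero_right)
  qed
  with f'(2) show ?thesis by eventually_elim simp
qed

section \<open>Oscillation in time\<close>

lemma integrable_indicator_Icc [simp]: "integrable lborel (indicator {a..b} :: real \<Rightarrow> real)"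
  using emeasure_compact_finite[of "{a..b}"] by (intro integrable_real_indicator) auto

text \<open>A shift by half a period \<open>\<pi>/\<omega>\<close> changes the sign of the oscillating factor, so twice the integral is at
  most the \<open>L\<^sup>1\<close> distance between the truncated \<open>k\<close> and its shift.\<close>

lemma Riemann_Lebesgue:
  fixes k :: "real \<Rightarrow> complex" and \<omega> :: "nat \<Rightarrow> real"
  assumes k: "continuous_on {\<alpha>..\<beta>} k" and \<omega>: "filterlim \<omega> at_infinity sequentially"
  shows "(\<lambda>n. LINT \<sigma>|lborel. indicator {\<alpha>..\<beta>} \<sigma> * (k \<sigma> * cis (\<omega> n * \<sigma>))) \<longlonglongrightarrow> 0"
proof -
  define K where "K \<sigma> = indicator {\<alpha>..\<beta>} \<sigma> * k \<sigma>" for \<sigma>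
  have K_eq: "K = (\<lambda>\<sigma>. indicator {\<alpha>..\<beta>} \<sigma> *\<^sub>R k \<sigma>)"
    by (auto simp: K_def indicator_def)
  have Km[measurable]: "K \<in> borel_measurable borel"
    unfolding K_eq by (rule borel_measurable_continuous_on_indicator[OF _ k]) simp
  have "compact (k ` {\<alpha>..\<beta>})" by (rule compact_continuous_image[OF k]) simp
  then obtain M where M: "\<And>\<sigma>. \<sigma> \<in> {\<alpha>..\<beta>} \<Longrightarrow> norm (k \<sigma>) \<le> M" "M > 0"
    using compact_imp_bounded bounded_pos by (metis imageI)
  have Kb: "norm (K \<sigma>) \<le> M * indicator {\<alpha>..\<beta>} \<sigma>" for \<sigma>
    using M by (auto simp: K_def indicator_def)
  have Ki: "integrable lborel K"
  proof (rule Bochner_Integration.integrable_bound)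
    show "integrable lborel (\<lambda>\<sigma>. M * indicator {\<alpha>..\<beta>} \<sigma> :: real)" by simp
    show "AE \<sigma> in lborel. norm (K \<sigma>) \<le> norm (M * indicator {\<alpha>..\<beta>} \<sigma> :: real)"
      using Kb M(2) by (intro AE_I2) (auto simp: abs_mult)
  qed simp
  define h where "h n = pi / \<omega> n" for n
  have h0: "h \<longlonglongrightarrow> 0"
    unfolding h_def by (rule tendsto_divide_0[OF tendsto_const \<omega>])
  define I where "I n = (LINT \<sigma>|lborel. K \<sigma> * cis (\<omega> n * \<sigma>))" for n
  have ic: "integrable lborel (\<lambda>\<sigma>. g \<sigma> * cis (c * \<sigma>))" if "integrable lborel g" for g :: "real \<Rightarrow> complex" and c
  proof (rule Bochner_Integration.integrable_bound[OF that])
    have [measurable]: "g \<in> borel_measurable borel" using that by (simp add: integrable_iff_bounded)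
    have [measurable]: "(\<lambda>\<sigma>. cis (c * \<sigma>)) \<in> borel_measurable borel"
      by (intro borel_measurable_continuous_onI continuous_intros)
    show "(\<lambda>\<sigma>. g \<sigma> * cis (c * \<sigma>)) \<in> borel_measurable lborel" by simp
  qed (simp add: norm_mult)
  have Ksi: "integrable lborel (\<lambda>\<sigma>. K (\<sigma> + c))" for c
    using lborel_integrable_real_affine[OF Ki, of 1 c] by (simp add: add.commute)
  have bound: "norm (I n) \<le> (LINT \<sigma>|lborel. norm (K \<sigma> - K (\<sigma> + h n)))" if "\<omega> n \<noteq> 0" for n
  proof -
    have "I n = (LINT \<sigma>|lborel. K (h n + 1 * \<sigma>) * cis (\<omega> n * (h n + 1 * \<sigma>)))"
      unfolding I_def by (subst lborel_integral_real_affine[of 1 _ "h n"]) auto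
    also have "\<dots> = (LINT \<sigma>|lborel. - (K (\<sigma> + h n) * cis (\<omega> n * \<sigma>)))"
    proof (intro Bochner_Integration.integral_cong refl)
      fix \<sigma>
      have "\<omega> n * (h n + 1 * \<sigma>) = pi + \<omega> n * \<sigma>" using that by (simp add: h_def distrib_left)
      then have "cis (\<omega> n * (h n + 1 * \<sigma>)) = - cis (\<omega> n * \<sigma>)" by (simp add: cis_mult[symmetric] cis_pi)
      then show "K (h n + 1 * \<sigma>) * cis (\<omega> n * (h n + 1 * \<sigma>)) = - (K (\<sigma> + h n) * cis (\<omega> n * \<sigma>))"
        by (simp add: add.commute)
    qed
    finally have "2 * I n = I n + (LINT \<sigma>|lborel. - (K (\<sigma> + h n) * cis (\<omega> n * \<sigma>)))" by simp
    also have "\<dots> = (LINT \<sigma>|lborel. (K \<sigma> - K (\<sigma> + h n)) * cis (\<omega> n * \<sigma>))"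
      unfolding I_def using ic[OF Ki] ic[OF Ksi] by (simp add: left_diff_distrib)
    finally have "norm (2 * I n) \<le> (LINT \<sigma>|lborel. norm ((K \<sigma> - K (\<sigma> + h n)) * cis (\<omega> n * \<sigma>)))"
      by (simp only: integral_norm_bound)
    then have "2 * norm (I n) \<le> (LINT \<sigma>|lborel. norm (K \<sigma> - K (\<sigma> + h n)))" by (simp add: norm_mult)
    then show ?thesis using norm_ge_zero[of "I n"] by linarith
  qed
  have "(\<lambda>n. LINT \<sigma>|lborel. norm (K \<sigma> - K (\<sigma> + h n))) \<longlonglongrightarrow> (LINT \<sigma>|(lborel::real measure). (0::real))"
  proof (rule tendsto_cong[THEN iffD1])
    \<comment> \<open>once \<open>|h n| \<le> 1\<close>, all integrands live on the same compact interval\<close>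
    define h' where "h' n = max (-1) (min 1 (h n))" for n
    have "h' \<longlonglongrightarrow> max (-1) (min 1 0)" unfolding h'_def by (intro tendsto_intros h0)
    then have h'0: "h' \<longlonglongrightarrow> 0" by simp
    have h'1: "\<bar>h' n\<bar> \<le> 1" for n by (auto simp: h'_def)
    have "\<forall>\<^sub>F n in sequentially. dist (h n) 0 < 1" using h0 tendstoD by fastforce
    then show "\<forall>\<^sub>F n in sequentially. (LINT \<sigma>|lborel. norm (K \<sigma> - K (\<sigma> + h' n))) = (LINT \<sigma>|lborel. norm (K \<sigma> - K (\<sigma> + h n)))"
      by eventually_elim (auto simp: h'_def dist_real_def)
    show "(\<lambda>n. LINT \<sigma>|lborel. norm (K \<sigma> - K (\<sigma> + h' n))) \<longlonglongrightarrow> (LINT \<sigma>|(lborel::real measure). (0::real))"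
    proof (rule integral_dominated_convergence[where w="\<lambda>\<sigma>. 2 * M * indicator {\<alpha>-1..\<beta>+1} \<sigma>"])
      show "AE \<sigma> in lborel. norm (norm (K \<sigma> - K (\<sigma> + h' n))) \<le> 2 * M * indicator {\<alpha>-1..\<beta>+1} \<sigma>" for n
      proof (intro AE_I2)
        fix \<sigma>
        have "norm (K \<sigma>) \<le> M * indicator {\<alpha>-1..\<beta>+1} \<sigma>" "norm (K (\<sigma> + h' n)) \<le> M * indicator {\<alpha>-1..\<beta>+1} \<sigma>"
          using M(2) h'1[of n] by (auto simp: indicator_def K_def intro: M(1))
        then show "norm (norm (K \<sigma> - K (\<sigma> + h' n))) \<le> 2 * M * indicator {\<alpha>-1..\<beta>+1} \<sigma>"
          using norm_triangle_ineq4[of "K \<sigma>" "K (\<sigma> + h' n)"] by simp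
      qed
      have "AE \<sigma> in lborel. \<sigma> \<notin> {\<alpha>, \<beta>}" by (intro AE_not_in countable_imp_null_set_lborel) auto
      then show "AE \<sigma> in lborel. (\<lambda>n. norm (K \<sigma> - K (\<sigma> + h' n))) \<longlonglongrightarrow> 0"
      proof eventually_elim
        case (elim \<sigma>)
        have "isCont K \<sigma>"
        proof (cases "\<sigma> \<in> {\<alpha><..<\<beta>}")
          case True
          have "isCont k \<sigma>" using k True continuous_on_interior[of "{\<alpha>..\<beta>}" k \<sigma>] by simp
          moreover have "\<forall>\<^sub>F s in nhds \<sigma>. K s = k s"
            using eventually_nhds_in_open[of "{\<alpha><..<\<beta>}" \<sigma>] True by (auto elim!: eventually_mono simp: K_def)
          ultimately show ?thesis using isCont_cong by blast
        next
          case False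
          then have "\<sigma> \<in> - {\<alpha>..\<beta>}" using elim by auto
          then have "\<forall>\<^sub>F s in nhds \<sigma>. K s = 0"
            using eventually_nhds_in_open[of "- {\<alpha>..\<beta>}" \<sigma>] by (auto elim!: eventually_mono simp: K_def open_Compl)
          then show ?thesis using isCont_cong[of K "\<lambda>_. 0" \<sigma>] by simp
        qed
        moreover have "(\<lambda>n. \<sigma> + h' n) \<longlonglongrightarrow> \<sigma> + 0" by (intro tendsto_intros h'0)
        ultimately have "(\<lambda>n. K (\<sigma> + h' n)) \<longlonglongrightarrow> K \<sigma>" using isCont_tendsto_compose by fastforce
        then have "(\<lambda>n. norm (K \<sigma> - K (\<sigma> + h' n))) \<longlonglongrightarrow> norm (K \<sigma> - K \<sigma>)" by (intro tendsto_intros)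
        then show ?case by simp
      qed
    qed auto
  qed
  then have lim: "(\<lambda>n. LINT \<sigma>|lborel. norm (K \<sigma> - K (\<sigma> + h n))) \<longlonglongrightarrow> 0" by simp
  have "\<forall>\<^sub>F n in sequentially. \<omega> n \<noteq> 0"
    using filterlim_at_infinity_imp_eventually_ne[OF \<omega>] by simp
  then have "\<forall>\<^sub>F n in sequentially. norm (I n) \<le> (LINT \<sigma>|lborel. norm (K \<sigma> - K (\<sigma> + h n)))"
    by eventually_elim (rule bound)
  then have "I \<longlonglongrightarrow> 0" by (rule Lim_null_comparison[OF _ lim])
  then show ?thesis by (simp add: I_def[abs_def] K_def mult.assoc)
qed

text \<open>The cut-off \<open>S\<close> depends only on the tail of the absolute sum, so it serves all bounded factors
  \<open>c\<close> at once.\<close>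

lemma has_sum_finite_tail:
  fixes a :: "int \<Rightarrow> complex"
  assumes "(\<lambda>j. norm (a j)) summable_on UNIV" "\<epsilon> > 0"
  obtains S where "finite S" "0 \<in> S"
    "\<And>c f. (\<And>j. norm (c j) \<le> 1) \<Longrightarrow> ((\<lambda>j. a j * c j) has_sum f) UNIV \<Longrightarrow> norm (f - (\<Sum>j\<in>S. a j * c j)) \<le> \<epsilon>"
proof -
  obtain A where A: "((\<lambda>j. norm (a j)) has_sum A) UNIV" using assms(1) by (auto simp: summable_on_def)
  then have "\<forall>\<^sub>F S in finite_subsets_at_top UNIV. dist (\<Sum>j\<in>S. norm (a j)) A < \<epsilon>"
    using assms(2) unfolding has_sum_def by (rule tendstoD)
  then obtain S0 where S0: "finite S0" "\<And>S. finite S \<Longrightarrow> S0 \<subseteq> S \<Longrightarrow> dist (\<Sum>j\<in>S. norm (a j)) A < \<epsilon>"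
    unfolding eventually_finite_subsets_at_top by auto
  define S where "S = insert 0 S0"
  have S: "finite S" "0 \<in> S" using S0 by (auto simp: S_def)
  have tail: "((\<lambda>j. norm (a j)) has_sum (A - (\<Sum>j\<in>S. norm (a j)))) (UNIV - S)"
    using has_sum_Diff[OF A has_sum_finite[OF S(1)]] by simp
  have le: "A - (\<Sum>j\<in>S. norm (a j)) \<le> \<epsilon>"
    using S0(2)[OF S(1)] by (simp add: S_def dist_real_def subset_insertI)
  show thesis
  proof (rule that[OF S])
    fix c f assume c: "\<And>j. norm (c j) \<le> (1::real)" and f: "((\<lambda>j. a j * c j) has_sum f) UNIV"
    have t2: "((\<lambda>j. a j * c j) has_sum (f - (\<Sum>j\<in>S. a j * c j))) (UNIV - S)"
      using has_sum_Diff[OF f has_sum_finite[OF S(1)]] by simp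
    have "norm (f - (\<Sum>j\<in>S. a j * c j)) \<le> A - (\<Sum>j\<in>S. norm (a j))"
    proof -
      have le1: "norm (a j * c j) \<le> norm (a j)" for j
        using c[of j] by (simp add: norm_mult mult_left_le)
      have "(\<lambda>j. norm (a j * c j)) summable_on (UNIV - S)"
        by (rule summable_on_comparison_test[where f="\<lambda>j. norm (a j)"])
           (use tail le1 in \<open>auto simp: summable_on_def\<close>)
      then obtain B where B: "((\<lambda>j. norm (a j * c j)) has_sum B) (UNIV - S)" by (auto simp: summable_on_def)
      have "B \<le> A - (\<Sum>j\<in>S. norm (a j))" by (rule has_sum_mono[OF B tail]) (use le1 in auto)
      with norm_has_sum_bound[OF B t2] show ?thesis by linarith
    qed
    then show "norm (f - (\<Sum>j\<in>S. a j * c j)) \<le> \<epsilon>" using le by simp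
  qed
qed

text \<open>Along the phase \<open>n P \<sigma> - Q ln (n \<sigma>) + b\<close> every Fourier mode of \<open>f\<close> except the
  constant one is killed by the Riemann--Lebesgue lemma; the logarithm splits into a unimodular constant and a
  factor that does not depend on \<open>n\<close>.\<close>

lemma oscillation_averages_out:
  fixes f :: "real \<Rightarrow> complex" and a :: "int \<Rightarrow> complex" and k :: "real \<Rightarrow> complex"
  assumes sum: "(\<lambda>j. norm (a j)) summable_on UNIV"
    and f: "\<And>\<theta>. ((\<lambda>j. a j * cis (of_int j * \<theta>)) has_sum f \<theta>) UNIV"
    and fm[measurable]: "f \<in> borel_measurable borel"
    and k: "continuous_on {\<alpha>..\<beta>} k" and \<alpha>: "0 < \<alpha>" and P: "P \<noteq> (0::real)"
  shows "(\<lambda>n. LINT \<sigma>|lborel. indicator {\<alpha>..\<beta>} \<sigma> * (k \<sigma> * f (real n * \<sigma> * P - Q * ln (real n * \<sigma>) + b)))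
     \<longlonglongrightarrow> a 0 * (LINT \<sigma>|lborel. indicator {\<alpha>..\<beta>} \<sigma> * k \<sigma>)"
proof -
  let ?\<theta> = "\<lambda>n \<sigma>. real n * \<sigma> * P - Q * ln (real n * \<sigma>) + b"
  let ?i = "\<lambda>\<sigma>. indicator {\<alpha>..\<beta>} \<sigma> :: complex"
  have [measurable]: "cis \<in> borel_measurable borel"
    by (intro borel_measurable_continuous_onI continuous_intros)
  define K where "K \<sigma> = ?i \<sigma> * k \<sigma>" for \<sigma>
  have K_eq: "K = (\<lambda>\<sigma>. indicator {\<alpha>..\<beta>} \<sigma> *\<^sub>R k \<sigma>)"
    by (auto simp: K_def indicator_def)
  have Km[measurable]: "K \<in> borel_measurable borel"
    unfolding K_eq by (rule borel_measurable_continuous_on_indicator[OF _ k]) simp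
  have Ki: "integrable lborel K"
    unfolding K_eq by (rule borel_integrable_compact[OF _ k]) simp
  have iK: "integrable lborel (\<lambda>\<sigma>. K \<sigma> * g \<sigma>)" if "g \<in> borel_measurable borel" "\<And>\<sigma>. norm (g \<sigma>) \<le> C" for g C
  proof (rule Bochner_Integration.integrable_bound)
    show "integrable lborel (\<lambda>\<sigma>. C * norm (K \<sigma>))" using Ki by simp
    show "(\<lambda>\<sigma>. K \<sigma> * g \<sigma>) \<in> borel_measurable lborel" using that by simp
    have "0 \<le> C" using that(2)[of 0] norm_ge_zero order_trans by blast
    then show "AE \<sigma> in lborel. norm (K \<sigma> * g \<sigma>) \<le> norm (C * norm (K \<sigma>))"
      using that(2) by (intro AE_I2) (simp add: norm_mult abs_mult mult.commute[of C] mult_left_mono)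
  qed
  have mode: "(\<lambda>n. LINT \<sigma>|lborel. K \<sigma> * cis (of_int j * ?\<theta> n \<sigma>)) \<longlonglongrightarrow> 0" if "j \<noteq> 0" for j
  proof -
    let ?k = "\<lambda>\<sigma>. k \<sigma> * cis (- of_int j * Q * ln \<sigma>)"
    let ?I = "\<lambda>n. LINT \<sigma>|lborel. ?i \<sigma> * (?k \<sigma> * cis ((real n * (of_int j * P)) * \<sigma>))"
    have "filterlim (\<lambda>n. real n * (of_int j * P)) at_infinity sequentially"
      unfolding mult.commute[of "real _"] using that P
      by (intro tendsto_mult_filterlim_at_infinity[OF tendsto_const]
          filterlim_compose[OF filterlim_at_top_imp_at_infinity filterlim_real_sequentially] filterlim_ident) auto
    moreover have "continuous_on {\<alpha>..\<beta>} ?k" using \<alpha> by (intro continuous_intros k) auto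
    ultimately have RL: "?I \<longlonglongrightarrow> 0" using Riemann_Lebesgue by blast
    have "\<forall>\<^sub>F n in sequentially. norm (LINT \<sigma>|lborel. K \<sigma> * cis (of_int j * ?\<theta> n \<sigma>)) \<le> norm (?I n)"
    proof (rule eventually_sequentiallyI[of 1])
      fix n :: nat assume n: "1 \<le> n"
      have "K \<sigma> * cis (of_int j * ?\<theta> n \<sigma>) = cis (of_int j * (b - Q * ln (real n))) * (?i \<sigma> * (?k \<sigma> * cis ((real n * (of_int j * P)) * \<sigma>)))" for \<sigma>
      proof (cases "\<sigma> \<in> {\<alpha>..\<beta>}")
        case True
        then have "ln (real n * \<sigma>) = ln (real n) + ln \<sigma>" using n \<alpha> by (simp add: ln_mult)
        then have "of_int j * ?\<theta> n \<sigma> = of_int j * (b - Q * ln (real n)) + (- of_int j * Q * ln \<sigma> + (real n * (of_int j * P)) * \<sigma>)"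
          by (simp add: algebra_simps)
        then have "cis (of_int j * ?\<theta> n \<sigma>) = cis (of_int j * (b - Q * ln (real n))) * (cis (- of_int j * Q * ln \<sigma>) * cis ((real n * (of_int j * P)) * \<sigma>))"
          by (simp only: cis_mult)
        then show ?thesis by (simp add: K_def mult_ac)
      qed (simp add: K_def)
      then have "(LINT \<sigma>|lborel. K \<sigma> * cis (of_int j * ?\<theta> n \<sigma>)) = cis (of_int j * (b - Q * ln (real n))) * ?I n"
        by (simp only: integral_mult_right_zero)
      then show "norm (LINT \<sigma>|lborel. K \<sigma> * cis (of_int j * ?\<theta> n \<sigma>)) \<le> norm (?I n)" by (simp add: norm_mult)
    qed
    then show ?thesis by (rule Lim_null_comparison[OF _ tendsto_norm_zero[OF RL]])
  qed
  define N where "N = (LINT \<sigma>|lborel. norm (K \<sigma>))"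
  have N: "N \<ge> 0" by (simp add: N_def)
  have main: "(\<lambda>n. LINT \<sigma>|lborel. K \<sigma> * f (?\<theta> n \<sigma>)) \<longlonglongrightarrow> a 0 * (LINT \<sigma>|lborel. K \<sigma>)"
  proof (rule LIMSEQ_I)
    fix r :: real assume r: "r > 0"
    define \<epsilon> where "\<epsilon> = r / (2 * (N + 1))"
    have \<epsilon>: "\<epsilon> > 0" "\<epsilon> * N < r / 2" using r N by (auto simp: \<epsilon>_def field_simps)
    obtain S where S: "finite S" "0 \<in> S"
      "\<And>c f. (\<And>j. norm (c j) \<le> 1) \<Longrightarrow> ((\<lambda>j. a j * c j) has_sum f) UNIV \<Longrightarrow> norm (f - (\<Sum>j\<in>S. a j * c j)) \<le> \<epsilon>"
      using has_sum_finite_tail[OF sum \<epsilon>(1)] by metis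
    define p where "p \<theta> = (\<Sum>j\<in>S. a j * cis (of_int j * \<theta>))" for \<theta>
    have [measurable]: "p \<in> borel_measurable borel" unfolding p_def by simp
    have fp: "norm (f \<theta> - p \<theta>) \<le> \<epsilon>" for \<theta> unfolding p_def by (rule S(3)[OF _ f]) simp
    have pb: "norm (p \<theta>) \<le> (\<Sum>j\<in>S. norm (a j))" for \<theta>
      unfolding p_def by (rule order_trans[OF norm_sum]) (simp add: norm_mult)
    have pint: "(LINT \<sigma>|lborel. K \<sigma> * p (?\<theta> n \<sigma>)) = a 0 * (LINT \<sigma>|lborel. K \<sigma>) +
        (\<Sum>j\<in>S-{0}. a j * (LINT \<sigma>|lborel. K \<sigma> * cis (of_int j * ?\<theta> n \<sigma>)))" for n
    proof -
      have i: "integrable lborel (\<lambda>\<sigma>. a j * (K \<sigma> * cis (of_int j * ?\<theta> n \<sigma>)))" for j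
        by (intro integrable_mult_right iK[where C=1]) auto
      have "(LINT \<sigma>|lborel. K \<sigma> * p (?\<theta> n \<sigma>)) = (LINT \<sigma>|lborel. (\<Sum>j\<in>S. a j * (K \<sigma> * cis (of_int j * ?\<theta> n \<sigma>))))"
        unfolding p_def by (simp add: sum_distrib_left mult_ac)
      also have "\<dots> = (\<Sum>j\<in>S. LINT \<sigma>|lborel. a j * (K \<sigma> * cis (of_int j * ?\<theta> n \<sigma>)))"
        by (rule Bochner_Integration.integral_sum[OF i])
      also have "\<dots> = (\<Sum>j\<in>S. a j * (LINT \<sigma>|lborel. K \<sigma> * cis (of_int j * ?\<theta> n \<sigma>)))" by simp
      also have "\<dots> = a 0 * (LINT \<sigma>|lborel. K \<sigma>) + (\<Sum>j\<in>S-{0}. a j * (LINT \<sigma>|lborel. K \<sigma> * cis (of_int j * ?\<theta> n \<sigma>)))"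
        by (subst sum.remove[OF S(1,2)]) simp
      finally show ?thesis .
    qed
    have "(\<lambda>n. \<Sum>j\<in>S-{0}. a j * (LINT \<sigma>|lborel. K \<sigma> * cis (of_int j * ?\<theta> n \<sigma>))) \<longlonglongrightarrow> (\<Sum>j\<in>S-{0}. a j * 0)"
      by (intro tendsto_sum tendsto_mult tendsto_const mode) auto
    then have "(\<lambda>n. \<Sum>j\<in>S-{0}. a j * (LINT \<sigma>|lborel. K \<sigma> * cis (of_int j * ?\<theta> n \<sigma>))) \<longlonglongrightarrow> 0" by simp
    from LIMSEQ_D[OF this, of "r / 2"] obtain n0 where n0:
      "\<And>n. n \<ge> n0 \<Longrightarrow> norm (\<Sum>j\<in>S-{0}. a j * (LINT \<sigma>|lborel. K \<sigma> * cis (of_int j * ?\<theta> n \<sigma>))) < r / 2"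
      using r by auto
    show "\<exists>no. \<forall>n\<ge>no. norm ((LINT \<sigma>|lborel. K \<sigma> * f (?\<theta> n \<sigma>)) - a 0 * (LINT \<sigma>|lborel. K \<sigma>)) < r"
    proof (intro exI allI impI)
      fix n assume n: "n \<ge> n0"
      have fb: "norm (f \<theta>) \<le> \<epsilon> + (\<Sum>j\<in>S. norm (a j))" for \<theta>
        using fp[of \<theta>] pb[of \<theta>] norm_triangle_sub[of "f \<theta>" "p \<theta>"] by linarith
      have i1: "integrable lborel (\<lambda>\<sigma>. K \<sigma> * f (?\<theta> n \<sigma>))" by (rule iK[OF _ fb]) simp
      have i2: "integrable lborel (\<lambda>\<sigma>. K \<sigma> * p (?\<theta> n \<sigma>))" by (rule iK[OF _ pb]) simp
      have "(LINT \<sigma>|lborel. K \<sigma> * f (?\<theta> n \<sigma>)) - (LINT \<sigma>|lborel. K \<sigma> * p (?\<theta> n \<sigma>)) = (LINT \<sigma>|lborel. K \<sigma> * (f (?\<theta> n \<sigma>) - p (?\<theta> n \<sigma>)))"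
        using i1 i2 by (simp add: right_diff_distrib)
      also have "norm \<dots> \<le> (LINT \<sigma>|lborel. \<epsilon> * norm (K \<sigma>))"
      proof (rule order_trans[OF integral_norm_bound], rule integral_mono)
        show "integrable lborel (\<lambda>\<sigma>. norm (K \<sigma> * (f (?\<theta> n \<sigma>) - p (?\<theta> n \<sigma>))))"
          using i1 i2 by (simp add: right_diff_distrib)
      qed (use Ki fp in \<open>auto simp: norm_mult mult.commute[of \<epsilon>] intro!: mult_left_mono\<close>)
      also have "\<dots> = \<epsilon> * N" by (simp add: N_def)
      finally have "norm ((LINT \<sigma>|lborel. K \<sigma> * f (?\<theta> n \<sigma>)) - (LINT \<sigma>|lborel. K \<sigma> * p (?\<theta> n \<sigma>))) < r / 2"
        using \<epsilon>(2) by simp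
      moreover have "norm ((LINT \<sigma>|lborel. K \<sigma> * p (?\<theta> n \<sigma>)) - a 0 * (LINT \<sigma>|lborel. K \<sigma>)) < r / 2"
        unfolding pint using n0[OF n] by simp
      ultimately show "norm ((LINT \<sigma>|lborel. K \<sigma> * f (?\<theta> n \<sigma>)) - a 0 * (LINT \<sigma>|lborel. K \<sigma>)) < r"
        by (rule norm_diff_triangle_less[where y="LINT \<sigma>|lborel. K \<sigma> * p (?\<theta> n \<sigma>)", THEN order_less_le_trans]) simp
    qed
  qed
  then show ?thesis by (simp add: K_def mult.assoc)
qed

section \<open>The asymptotic profile\<close>

text \<open>The phase of the profile in the self-similar variable \<open>y = x/2s\<close>.\<close>

definition profile_phase :: "real \<Rightarrow> ('a::euclidean_space \<Rightarrow> complex) \<Rightarrow> real \<Rightarrow> 'a \<Rightarrow> real" where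
  "profile_phase lam W s y = s * (norm y)\<^sup>2 - lam * norm (W y) powr (2 / real DIM('a)) * ln s - real DIM('a) * pi / 4"

text \<open>The profile as a function of an arbitrary \<open>W\<close>, so that a Borel representative can take the
  place of the transform of \<open>u\<^sub>+\<close>.\<close>

definition profile_of :: "real \<Rightarrow> ('a::euclidean_space \<Rightarrow> complex) \<Rightarrow> real \<Rightarrow> 'a \<Rightarrow> complex" where
  "profile_of lam W s x = of_real ((2 * s) powr (- (real DIM('a) / 2))) *
     (cis (profile_phase lam W s ((1 / (2 * s)) *\<^sub>R x)) * W ((1 / (2 * s)) *\<^sub>R x))"

lemma profile_eq_profile_of:
  fixes up :: "'a::euclidean_space \<Rightarrow> complex"
  assumes "s > 0"
  shows "profile lam up s x = profile_of lam (fourier_L2 up) s x"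
proof -
  let ?y = "(1 / (2 * s)) *\<^sub>R x"
  let ?r = "lam * norm (fourier_L2 up ?y) powr (2 / real DIM('a)) * ln s"
  have p: "complex_of_real (2 * s) powr complex_of_real (- (real DIM('a) / 2)) = of_real ((2 * s) powr (- (real DIM('a) / 2)))"
    using assms by (intro powr_of_real) auto
  have n: "(norm x)\<^sup>2 / (4 * s) = s * (norm ?y)\<^sup>2"
    using assms by (simp add: power_divide power_mult_distrib field_simps power2_eq_square)
  have e: "exp (- \<i> * complex_of_real (real DIM('a) * pi / 4)) = cis (- (real DIM('a) * pi / 4))"
    "exp (\<i> * complex_of_real ((norm x)\<^sup>2 / (4 * s))) = cis (s * (norm ?y)\<^sup>2)"
    "exp (- \<i> * complex_of_real ?r) = cis (- ?r)"
    unfolding n cis_conv_exp by (simp_all add: mult_ac)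
  have c: "cis (- (real DIM('a) * pi / 4)) * cis (s * (norm ?y)\<^sup>2) * cis (- ?r) = cis (profile_phase lam (fourier_L2 up) s ?y)"
    unfolding cis_mult profile_phase_def by (simp add: algebra_simps)
  show ?thesis
    unfolding profile_def modulation_def dilation_def p e profile_of_def c[symmetric] by (simp add: mult_ac)
qed

lemma borel_measurable_profile_phase [measurable]:
  assumes [measurable]: "W \<in> borel_measurable borel" "f \<in> borel_measurable M" "g \<in> borel_measurable M"
  shows "(\<lambda>x. profile_phase lam W (f x) (g x)) \<in> borel_measurable M"
  unfolding profile_phase_def by measurable

lemma borel_measurable_cis [measurable]: "f \<in> borel_measurable M \<Longrightarrow> (\<lambda>x. cis (f x)) \<in> borel_measurable M"
  using measurable_compose[of f M borel cis borel]
  by (simp add: borel_measurable_continuous_onI continuous_on_cis continuous_on_id)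

lemma borel_measurable_profile_of [measurable]:
  assumes [measurable]: "W \<in> borel_measurable borel" "f \<in> borel_measurable M" "g \<in> borel_measurable M"
  shows "(\<lambda>x. profile_of lam W (f x) (g x)) \<in> borel_measurable M"
  unfolding profile_of_def by measurable

text \<open>The Gaussian of width \<open>R\<close>, normalised so that its \<open>L\<^sup>2\<close> norm does not depend on \<open>R\<close>.\<close>

definition bump :: "real \<Rightarrow> 'a::euclidean_space \<Rightarrow> complex" where
  "bump R x = of_real (R powr (- (real DIM('a) / 2)) * exp (- ((norm x)\<^sup>2 / R\<^sup>2)))"

lemma borel_measurable_bump [measurable]: "bump R \<in> borel_measurable borel"
  unfolding bump_def by measurable

text \<open>In the variable \<open>y = x/2s\<close>, \<open>s = R\<sigma>\<close>, the Gaussian becomes independent of \<open>R\<close>, and \<open>R\<close> enters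
  the integral only through the phase.\<close>

lemma pairing_profile_bump:
  fixes W :: "'a::euclidean_space \<Rightarrow> complex"
  assumes [measurable]: "W \<in> borel_measurable borel" "H \<in> borel_measurable borel"
    and hom: "\<And>\<mu> z. \<mu> > 0 \<Longrightarrow> H (of_real \<mu> * z) = of_real (\<mu> powr r) * H z"
    and R: "R > 0" and \<sigma>: "\<sigma> > 0"
  shows "(LINT x|lborel. H (profile_of lam W (R * \<sigma>) x) * bump R x) =
    of_real ((2 * (R * \<sigma>)) powr (real DIM('a) - r * (real DIM('a) / 2)) * R powr (- (real DIM('a) / 2))) *
    (LINT y|lborel. H (cis (profile_phase lam W (R * \<sigma>) y) * W y) * of_real (exp (- 4 * \<sigma>\<^sup>2 * (norm y)\<^sup>2)))"
proof -
  let ?d = "real DIM('a)"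
  define c where "c = 2 * (R * \<sigma>)"
  have c: "c > 0" using R \<sigma> by (simp add: c_def)
  have E: "H (profile_of lam W (R * \<sigma>) (0 + c *\<^sub>R y)) * bump R (0 + c *\<^sub>R y) =
    of_real (c powr (- r * (?d / 2)) * R powr (- (?d / 2))) *
     (H (cis (profile_phase lam W (R * \<sigma>) y) * W y) * of_real (exp (- 4 * \<sigma>\<^sup>2 * (norm y)\<^sup>2)))" for y
  proof -
    have y: "(1 / c) *\<^sub>R (0 + c *\<^sub>R y) = y" using c by simp
    have "(norm (0 + c *\<^sub>R y))\<^sup>2 / R\<^sup>2 = 4 * \<sigma>\<^sup>2 * (norm y)\<^sup>2"
      using R by (simp add: c_def power_mult_distrib)
    then have "bump R (0 + c *\<^sub>R y) = of_real (R powr (- (?d / 2))) * of_real (exp (- 4 * \<sigma>\<^sup>2 * (norm y)\<^sup>2))"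
      unfolding bump_def by simp
    moreover have "H (profile_of lam W (R * \<sigma>) (0 + c *\<^sub>R y)) = of_real (c powr (- r * (?d / 2))) * H (cis (profile_phase lam W (R * \<sigma>) y) * W y)"
      unfolding profile_of_def c_def[symmetric] y using c by (subst hom) (auto simp: powr_powr mult_ac)
    ultimately show ?thesis by (simp add: mult_ac)
  qed
  have "(LINT x|lborel. H (profile_of lam W (R * \<sigma>) x) * bump R x) =
    \<bar>c\<bar> ^ DIM('a) *\<^sub>R (LINT y|lborel. H (profile_of lam W (R * \<sigma>) (0 + c *\<^sub>R y)) * bump R (0 + c *\<^sub>R y))"
    using c by (intro integral_lborel_affine) auto
  also have "\<dots> =
    of_real (\<bar>c\<bar> ^ DIM('a) * (c powr (- r * (?d / 2)) * R powr (- (?d / 2)))) *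
    (LINT y|lborel. H (cis (profile_phase lam W (R * \<sigma>) y) * W y) * of_real (exp (- 4 * \<sigma>\<^sup>2 * (norm y)\<^sup>2)))"
    unfolding E integral_mult_right_zero by (simp add: scaleR_conv_of_real mult.assoc)
  also have "\<bar>c\<bar> ^ DIM('a) * (c powr (- r * (?d / 2)) * R powr (- (?d / 2))) = c powr (?d - r * (?d / 2)) * R powr (- (?d / 2))"
    using c by (simp add: powr_realpow[symmetric] powr_add[symmetric])
  finally show ?thesis unfolding c_def .
qed

text \<open>For each \<open>y \<noteq> 0\<close> the integral over \<open>\<sigma>\<close> converges because the phase has frequency \<open>n|y|\<^sup>2\<close>; Fubini and
  dominated convergence in \<open>y\<close> do the rest.\<close>

lemma oscillating_pairing_tendsto:
  fixes W :: "'a::euclidean_space \<Rightarrow> complex" and H :: "complex \<Rightarrow> complex" and a :: "int \<Rightarrow> complex \<Rightarrow> complex"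
  assumes Wm[measurable]: "W \<in> borel_measurable borel" and Hm[measurable]: "H \<in> borel_measurable borel"
    and sum: "\<And>z. (\<lambda>j. norm (a j z)) summable_on UNIV"
    and modes: "\<And>z \<theta>. ((\<lambda>j. a j z * cis (of_int j * \<theta>)) has_sum H (cis \<theta> * z)) UNIV"
    and g: "integrable lborel g"
    and le: "\<And>y \<theta> \<sigma>. \<sigma> \<ge> \<alpha> \<Longrightarrow> norm (H (cis \<theta> * W y)) * exp (- 4 * \<sigma>\<^sup>2 * (norm y)\<^sup>2) \<le> g y"
    and w: "continuous_on {\<alpha>..\<beta>} w" and \<alpha>: "0 < \<alpha>"
  shows "(\<lambda>n. LINT \<sigma>|lborel. indicator {\<alpha>..\<beta>} \<sigma> * (complex_of_real (w \<sigma>) *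
      (LINT y|lborel. H (cis (profile_phase lam W (real n * \<sigma>) y) * W y) * of_real (exp (- 4 * \<sigma>\<^sup>2 * (norm y)\<^sup>2)))))
    \<longlonglongrightarrow> (LINT y|lborel. a 0 (W y) * (LINT \<sigma>|lborel. indicator {\<alpha>..\<beta>} \<sigma> * complex_of_real (w \<sigma> * exp (- 4 * \<sigma>\<^sup>2 * (norm y)\<^sup>2))))"
proof -
  define K where "K \<sigma> = indicator {\<alpha>..\<beta>} \<sigma> * complex_of_real (w \<sigma>)" for \<sigma>
  have K_eq: "K = (\<lambda>\<sigma>. indicator {\<alpha>..\<beta>} \<sigma> *\<^sub>R complex_of_real (w \<sigma>))" by (auto simp: K_def indicator_def)
  have wc: "continuous_on {\<alpha>..\<beta>} (\<lambda>\<sigma>. complex_of_real (w \<sigma>))" by (intro continuous_intros w)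
  have Km[measurable]: "K \<in> borel_measurable borel"
    unfolding K_eq by (rule borel_measurable_continuous_on_indicator[OF _ wc]) simp
  have Ki: "integrable lborel K"
    unfolding K_eq by (rule borel_integrable_compact[OF _ wc]) simp
  have K0: "K \<sigma> = 0" if "\<sigma> < \<alpha>" for \<sigma> using that by (simp add: K_def)
  have gm[measurable]: "g \<in> borel_measurable borel" using g by (simp add: integrable_iff_bounded)
  let ?h = "\<lambda>n \<sigma> y. H (cis (profile_phase lam W (real n * \<sigma>) y) * W y) * of_real (exp (- 4 * \<sigma>\<^sup>2 * (norm y)\<^sup>2))"
  have hb: "norm (K \<sigma> * ?h n \<sigma> y) \<le> norm (K \<sigma>) * g y" for n \<sigma> y
    using le[of \<sigma> _ y] K0[of \<sigma>] by (cases "\<sigma> < \<alpha>") (auto simp: norm_mult intro!: mult_left_mono)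
  have int: "integrable (lborel \<Otimes>\<^sub>M lborel) (\<lambda>(\<sigma>, y). K \<sigma> * ?h n \<sigma> y)" for n
  proof (rule Bochner_Integration.integrable_bound)
    show "integrable (lborel \<Otimes>\<^sub>M lborel) (\<lambda>(\<sigma>, y). K \<sigma> * complex_of_real (g y))"
      using Ki g by (intro lborel_pair.Fubini_integrable) (auto simp: norm_mult)
    show "AE z in lborel \<Otimes>\<^sub>M lborel. norm (case z of (\<sigma>, y) \<Rightarrow> K \<sigma> * ?h n \<sigma> y) \<le> norm (case z of (\<sigma>, y) \<Rightarrow> K \<sigma> * complex_of_real (g y))"
    proof (intro AE_I2)
      fix z :: "real \<times> 'a"
      obtain \<sigma> y where z: "z = (\<sigma>, y)" by (cases z)
      have "norm (K \<sigma> * ?h n \<sigma> y) \<le> norm (K \<sigma>) * g y" by (rule hb)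
      also have "\<dots> \<le> norm (K \<sigma>) * \<bar>g y\<bar>" by (intro mult_left_mono) auto
      finally show "norm (case z of (\<sigma>, y) \<Rightarrow> K \<sigma> * ?h n \<sigma> y) \<le> norm (case z of (\<sigma>, y) \<Rightarrow> K \<sigma> * complex_of_real (g y))"
        by (simp only: z prod.case norm_mult norm_of_real)
    qed
  qed measurable
  have swap: "(LINT \<sigma>|lborel. K \<sigma> * (LINT y|lborel. ?h n \<sigma> y)) = (LINT y|lborel. LINT \<sigma>|lborel. K \<sigma> * ?h n \<sigma> y)" for n
    using lborel_pair.Fubini_integral[OF int] by simp
  have "(\<lambda>n. LINT y|lborel. LINT \<sigma>|lborel. K \<sigma> * ?h n \<sigma> y) \<longlonglongrightarrow>
      (LINT y|lborel. a 0 (W y) * (LINT \<sigma>|lborel. K \<sigma> * complex_of_real (exp (- 4 * \<sigma>\<^sup>2 * (norm y)\<^sup>2))))"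
  proof (rule integral_dominated_convergence[where w="\<lambda>y. (LINT \<sigma>|lborel. norm (K \<sigma>)) * g y"])
    have lim: "(\<lambda>n. LINT \<sigma>|lborel. K \<sigma> * ?h n \<sigma> y) \<longlonglongrightarrow> a 0 (W y) * (LINT \<sigma>|lborel. K \<sigma> * complex_of_real (exp (- 4 * \<sigma>\<^sup>2 * (norm y)\<^sup>2)))"
      if "y \<noteq> 0" for y
    proof -
      let ?k = "\<lambda>\<sigma>. complex_of_real (w \<sigma>) * complex_of_real (exp (- 4 * \<sigma>\<^sup>2 * (norm y)\<^sup>2))"
      have "continuous_on {\<alpha>..\<beta>} ?k" by (intro continuous_intros w)
      from oscillation_averages_out[OF sum[of "W y"] modes[of "W y"] _ this \<alpha>, of "(norm y)\<^sup>2"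
        "lam * norm (W y) powr (2 / real DIM('a))" "- (real DIM('a) * pi / 4)"]
      show ?thesis using that by (simp add: K_def profile_phase_def mult_ac)
    qed
    have "AE y in lborel. y \<notin> {0::'a}" by (intro AE_not_in countable_imp_null_set_lborel) auto
    then show "AE y in lborel. (\<lambda>n. LINT \<sigma>|lborel. K \<sigma> * ?h n \<sigma> y) \<longlonglongrightarrow> a 0 (W y) * (LINT \<sigma>|lborel. K \<sigma> * complex_of_real (exp (- 4 * \<sigma>\<^sup>2 * (norm y)\<^sup>2)))"
      by eventually_elim (rule lim, simp)
    show "AE y in lborel. norm (LINT \<sigma>|lborel. K \<sigma> * ?h n \<sigma> y) \<le> (LINT \<sigma>|lborel. norm (K \<sigma>)) * g y" for n
    proof (intro AE_I2)
      fix y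
      have "norm (LINT \<sigma>|lborel. K \<sigma> * ?h n \<sigma> y) \<le> (LINT \<sigma>|lborel. norm (K \<sigma>) * g y)"
      proof (cases "integrable lborel (\<lambda>\<sigma>. K \<sigma> * ?h n \<sigma> y)")
        case True
        show ?thesis
        proof (rule order_trans[OF integral_norm_bound], rule integral_mono)
          show "integrable lborel (\<lambda>\<sigma>. norm (K \<sigma> * ?h n \<sigma> y))" using True by (rule integrable_norm)
          show "integrable lborel (\<lambda>\<sigma>. norm (K \<sigma>) * g y)" by (intro integrable_mult_left integrable_norm Ki)
        qed (rule hb)
      next
        case False
        have "0 \<le> g y" using le[of \<alpha> 0 y] by (smt (verit) exp_gt_zero mult_nonneg_nonneg norm_ge_zero order_refl)
        then show ?thesis using False by (simp add: not_integrable_integral_eq)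
      qed
      then show "norm (LINT \<sigma>|lborel. K \<sigma> * ?h n \<sigma> y) \<le> (LINT \<sigma>|lborel. norm (K \<sigma>)) * g y" by simp
    qed
    show "integrable lborel (\<lambda>y. (LINT \<sigma>|lborel. norm (K \<sigma>)) * g y)" using g by simp
    show m: "(\<lambda>y. LINT \<sigma>|lborel. K \<sigma> * ?h n \<sigma> y) \<in> borel_measurable lborel" for n by measurable
    show "(\<lambda>y. a 0 (W y) * (LINT \<sigma>|lborel. K \<sigma> * complex_of_real (exp (- 4 * \<sigma>\<^sup>2 * (norm y)\<^sup>2)))) \<in> borel_measurable lborel"
    proof -
      \<comment> \<open>this function is the limit of measurable ones off the origin\<close>
      let ?L = "\<lambda>y. a 0 (W y) * (LINT \<sigma>|lborel. K \<sigma> * complex_of_real (exp (- 4 * \<sigma>\<^sup>2 * (norm y)\<^sup>2)))"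
      have "(\<lambda>y. if y = 0 then ?L 0 else ?L y) \<in> borel_measurable lborel"
      proof (rule borel_measurable_LIMSEQ_metric)
        show "(\<lambda>y. if y = 0 then ?L 0 else (LINT \<sigma>|lborel. K \<sigma> * ?h n \<sigma> y)) \<in> borel_measurable lborel" for n
          using m by (intro measurable_If) auto
        show "(\<lambda>n. if y = 0 then ?L 0 else (LINT \<sigma>|lborel. K \<sigma> * ?h n \<sigma> y)) \<longlonglongrightarrow> (if y = 0 then ?L 0 else ?L y)" for y
          using lim[of y] by simp
      qed
      also have "(\<lambda>y. if y = 0 then ?L 0 else ?L y) = ?L" by auto
      finally show ?thesis .
    qed
  qed
  then show ?thesis unfolding swap[symmetric] by (simp add: K_def mult_ac)
qed

section \<open>The nonlinearity\<close>

lemma norm_nl_mode: "norm (nl_mode d n z) = norm z powr (1 + 2 / real d)"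
proof (cases "z = 0")
  case False
  have "norm (nl_mode d n z) = norm z powr (1 + 2 / real d - of_int n) * norm z powi n"
    by (simp add: nl_mode_def norm_power_int)
  also have "norm z powi n = norm z powr of_int n" using False by (simp add: powr_real_of_int')
  finally show ?thesis using False by (simp add: powr_add[symmetric])
qed (simp add: nl_mode_def)

lemma nl_mode_rotate: "nl_mode d n (cis \<theta> * z) = nl_mode d n z * cis (of_int n * \<theta>)"
  by (simp add: nl_mode_def norm_mult power_int_mult_distrib cis_power_int scaleR_conv_of_real mult_ac)

lemma continuous_nl_mode: "continuous_on UNIV (nl_mode d n)"
proof -
  have "isCont (nl_mode d n) z" for z
  proof (cases "z = 0")
    case True
    have "((\<lambda>z. norm z powr (1 + 2 / real d)) \<longlongrightarrow> 0) (at (0::complex))"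
    proof -
      have "((\<lambda>z. norm z powr (1 + 2 / real d)) \<longlongrightarrow> 0 powr (1 + 2 / real d)) (at (0::complex))"
        by (rule tendsto_powr') (auto intro!: tendsto_eq_intros always_eventually simp: add_pos_nonneg)
      then show ?thesis by simp
    qed
    then have "((\<lambda>z. norm (nl_mode d n z)) \<longlongrightarrow> 0) (at 0)" by (simp add: norm_nl_mode)
    then have "(nl_mode d n \<longlongrightarrow> 0) (at 0)" by (rule tendsto_norm_zero_cancel)
    then show ?thesis using True by (simp add: isCont_def nl_mode_def)
  next
    case False
    then show ?thesis unfolding nl_mode_def by (intro continuous_intros) auto
  qed
  then show ?thesis by (simp add: continuous_on_eq_continuous_at)
qed

text \<open>The series converges uniformly on balls, since every mode has modulus \<open>|z|\<^sup>1\<^sup>+\<^sup>2\<^sup>/\<^sup>d\<close>.\<close>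

lemma nl_series_continuous:
  assumes F: "\<And>z. ((\<lambda>n. c n * nl_mode d n z) has_sum F z) UNIV"
    and sum: "(\<lambda>n. norm (c n)) summable_on UNIV"
  shows "continuous_on UNIV F"
proof -
  have "continuous_on (ball 0 M) F" if M: "M > 0" for M
  proof -
    let ?B = "M powr (1 + 2 / real d)"
    have B: "?B > 0" using M by simp
    have "\<exists>S. finite S \<and> (\<forall>z\<in>ball 0 M. norm (F z - (\<Sum>j\<in>S. c j * nl_mode d j z)) \<le> \<epsilon>)" if e: "\<epsilon> > 0" for \<epsilon>
    proof -
      have s: "(\<lambda>n. norm (c n * of_real ?B)) summable_on UNIV"
        using summable_on_cmult_left[OF sum, of ?B] by (simp add: norm_mult)
      obtain S where S: "finite S" "0 \<in> S" "\<And>b f. (\<And>j. norm (b j) \<le> 1) \<Longrightarrow> ((\<lambda>j. (c j * of_real ?B) * b j) has_sum f) UNIV \<Longrightarrow>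
          norm (f - (\<Sum>j\<in>S. (c j * of_real ?B) * b j)) \<le> \<epsilon>"
        by (rule has_sum_finite_tail[OF s e], rule that, assumption, assumption, blast)
      have "norm (F z - (\<Sum>j\<in>S. c j * nl_mode d j z)) \<le> \<epsilon>" if z: "z \<in> ball 0 M" for z
      proof -
        let ?b = "\<lambda>j. nl_mode d j z / of_real ?B"
        have eq: "(c j * of_real ?B) * ?b j = c j * nl_mode d j z" for j using B by simp
        have b1: "norm (?b j) \<le> 1" for j
          using B z by (simp add: norm_divide norm_nl_mode) (intro powr_mono2, auto)
        have "norm (F z - (\<Sum>j\<in>S. (c j * of_real ?B) * ?b j)) \<le> \<epsilon>"
          by (rule S(3)) (use b1 F in \<open>simp_all only: eq\<close>)
        then show ?thesis by (simp only: eq)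
      qed
      then show ?thesis using S(1) by blast
    qed
    then have "\<forall>n. \<exists>S. finite S \<and> (\<forall>z\<in>ball 0 M. norm (F z - (\<Sum>j\<in>S. c j * nl_mode d j z)) \<le> 1 / real (Suc n))"
      by simp
    from choice[OF this] obtain S where "\<forall>n. finite (S n) \<and>
        (\<forall>z\<in>ball 0 M. norm (F z - (\<Sum>j\<in>S n. c j * nl_mode d j z)) \<le> 1 / real (Suc n))" by blast
    then have S: "\<And>n. finite (S n)"
      "\<And>n z. z \<in> ball 0 M \<Longrightarrow> norm (F z - (\<Sum>j\<in>S n. c j * nl_mode d j z)) \<le> 1 / real (Suc n)"
      by blast+
    have "uniform_limit (ball 0 M) (\<lambda>n z. \<Sum>j\<in>S n. c j * nl_mode d j z) F sequentially"
    proof (rule uniform_limitI)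
      fix e :: real assume "e > 0"
      then obtain N :: nat where N: "1 / real (Suc N) < e" using nat_approx_posE by blast
      show "\<forall>\<^sub>F n in sequentially. \<forall>z\<in>ball 0 M. dist (\<Sum>j\<in>S n. c j * nl_mode d j z) (F z) < e"
      proof (intro eventually_sequentiallyI[of N] ballI)
        fix n z assume n: "N \<le> n" and z: "z \<in> ball (0::complex) M"
        have "1 / real (Suc n) \<le> 1 / real (Suc N)" using n by (simp add: divide_simps)
        then show "dist (\<Sum>j\<in>S n. c j * nl_mode d j z) (F z) < e"
          using S(2)[OF z, of n] N by (simp add: dist_norm norm_minus_commute)
      qed
    qed
    moreover have "continuous_on (ball 0 M) (\<lambda>z. \<Sum>j\<in>S n. c j * nl_mode d j z)" for n
      by (intro continuous_intros continuous_on_subset[OF continuous_nl_mode]) auto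
    ultimately show ?thesis
      by (intro uniform_limit_theorem[where F=sequentially]) auto
  qed
  then have "isCont F z" for z
  proof -
    have "continuous_on (ball 0 (norm z + 1)) F" using \<open>\<And>M. M > 0 \<Longrightarrow> continuous_on (ball 0 M) F\<close> by (simp add: add_nonneg_pos)
    then show ?thesis by (simp add: continuous_on_eq_continuous_at)
  qed
  then show ?thesis by (simp add: continuous_on_eq_continuous_at)
qed

lemma nl_series_bound:
  assumes F: "((\<lambda>n. c n * nl_mode d n z) has_sum F) UNIV"
    and A: "((\<lambda>n. norm (c n)) has_sum A) UNIV"
  shows "norm F \<le> A * norm z powr (1 + 2 / real d)"
proof (rule norm_has_sum_bound[OF _ F])
  show "((\<lambda>n. norm (c n * nl_mode d n z)) has_sum A * norm z powr (1 + 2 / real d)) UNIV"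
    unfolding norm_mult norm_nl_mode by (intro has_sum_cmult_left A)
qed

text \<open>Summability of the \<open>g\<^sub>n\<close> makes \<open>F\<close> continuous but gives no Lipschitz bound. Homogeneity extends the uniform
  continuity on the unit disc to the whole plane: either \<open>a\<close> and \<open>b\<close> are close relative to their size, or
  \<open>|a - b|\<close> dominates both.\<close>

lemma homogeneous_continuity_estimate:
  fixes F :: "complex \<Rightarrow> complex"
  assumes cont: "continuous_on UNIV F" and p: "p > 0"
    and hom: "\<And>\<mu> z. \<mu> > 0 \<Longrightarrow> F (of_real \<mu> * z) = of_real (\<mu> powr p) * F z"
    and bd: "\<And>z. norm (F z) \<le> A * norm z powr p" and A: "A \<ge> 0"
    and \<epsilon>: "\<epsilon> > 0"
  shows "\<exists>C\<ge>0. \<forall>a b. (norm (F a - F b))\<^sup>2 \<le> \<epsilon> * norm b powr (2 * p) + C * norm (a - b) powr (2 * p)"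
proof -
  \<comment> \<open>the power of two pays for \<open>m \<le> 2 max |b| |a - b|\<close> in the case where \<open>a\<close> and \<open>b\<close> are close\<close>
  define \<eta> where "\<eta> = sqrt (\<epsilon> / 2 powr (2 * p))"
  have \<eta>: "\<eta> > 0" "\<eta>\<^sup>2 * 2 powr (2 * p) = \<epsilon>" using \<epsilon> by (auto simp: \<eta>_def)
  have "uniformly_continuous_on (cball 0 1) F"
    using cont by (intro compact_uniformly_continuous) (auto intro: continuous_on_subset)
  then obtain \<delta> where \<delta>: "\<delta> > 0" "\<And>u v. norm u \<le> 1 \<Longrightarrow> norm v \<le> 1 \<Longrightarrow> norm (u - v) < \<delta> \<Longrightarrow> norm (F u - F v) < \<eta>"
    unfolding uniformly_continuous_on_def using \<eta>(1) by (metis dist_norm mem_cball_0 norm_minus_commute)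
  define C where "C = \<epsilon> + (2 * A)\<^sup>2 * (1 / \<delta>) powr (2 * p)"
  have sq: "(x powr p)\<^sup>2 = x powr (2 * p)" if "x \<ge> 0" for x :: real
    by (simp add: power2_eq_square powr_add[symmetric])
  have C0: "C \<ge> 0" using \<epsilon> by (simp add: C_def add_nonneg_nonneg)
  have "(norm (F a - F b))\<^sup>2 \<le> \<epsilon> * norm b powr (2 * p) + C * norm (a - b) powr (2 * p)" for a b
  proof -
    define m where "m = max (norm a) (norm b)"
    consider "m = 0" | "m > 0" "norm (a - b) < \<delta> * m" | "m > 0" "\<delta> * m \<le> norm (a - b)"
      by (metis m_def max.cobounded1 norm_ge_zero order_less_le order_trans linorder_not_less)
    then show ?thesis
    proof cases
      case 1
      then have "a = 0" "b = 0" by (auto simp: m_def max_def split: if_splits)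
      then show ?thesis using \<epsilon> p by simp
    next
      case 2
      have s: "F z = of_real (m powr p) * F (z / of_real m)" for z
        using hom[OF 2(1), of "z / of_real m"] 2(1) by simp
      have "norm (F (a / of_real m) - F (b / of_real m)) < \<eta>"
        using 2 by (intro \<delta>(2)) (auto simp: norm_divide m_def diff_divide_distrib[symmetric] divide_simps)
      then have "norm (F a - F b) \<le> m powr p * \<eta>"
        unfolding s[of a] s[of b] right_diff_distrib[symmetric] norm_mult using 2(1) by (intro mult_mono) auto
      then have "(norm (F a - F b))\<^sup>2 \<le> (m powr p * \<eta>)\<^sup>2" by (intro power_mono) auto
      also have "\<dots> = \<eta>\<^sup>2 * m powr (2 * p)" using 2(1) sq[of m] by (simp add: power_mult_distrib)
      also have "\<dots> \<le> \<eta>\<^sup>2 * (2 powr (2 * p) * (norm b powr (2 * p) + norm (a - b) powr (2 * p)))"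
      proof (rule mult_left_mono)
        have "m powr (2 * p) \<le> (2 * max (norm b) (norm (a - b))) powr (2 * p)"
        proof (rule powr_mono2)
          have "norm a \<le> norm b + norm (a - b)" using norm_triangle_sub[of a b] by simp
          then show "m \<le> 2 * max (norm b) (norm (a - b))"
            using norm_ge_zero[of b] norm_ge_zero[of "a - b"] unfolding m_def max_def by argo
        qed (use p 2 in auto)
        also have "\<dots> = 2 powr (2 * p) * max (norm b) (norm (a - b)) powr (2 * p)"
          by (rule powr_mult)
        also have "\<dots> \<le> 2 powr (2 * p) * (norm b powr (2 * p) + norm (a - b) powr (2 * p))"
          by (rule mult_left_mono) (auto simp: max_def)
        finally show "m powr (2 * p) \<le> 2 powr (2 * p) * (norm b powr (2 * p) + norm (a - b) powr (2 * p))" .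
      qed simp
      also have "\<dots> = \<epsilon> * (norm b powr (2 * p) + norm (a - b) powr (2 * p))"
        by (simp only: mult.assoc[symmetric] \<eta>(2))
      also have "\<dots> \<le> \<epsilon> * norm b powr (2 * p) + C * norm (a - b) powr (2 * p)"
        by (simp add: C_def distrib_left distrib_right)
      finally show ?thesis .
    next
      case 3
      have mle: "m \<le> norm (a - b) * (1 / \<delta>)" using 3 \<delta>(1) by (simp add: field_simps)
      have "norm (F z) \<le> A * m powr p" if "norm z \<le> m" for z
        using that p A by (intro order_trans[OF bd] mult_left_mono powr_mono2) auto
      then have "norm (F a - F b) \<le> A * m powr p + A * m powr p"
        by (intro order_trans[OF norm_triangle_ineq4] add_mono) (auto simp: m_def)
      then have "(norm (F a - F b))\<^sup>2 \<le> (2 * A * m powr p)\<^sup>2" by (intro power_mono) auto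
      also have "\<dots> = (2 * A)\<^sup>2 * m powr (2 * p)" using 3(1) sq[of m] by (simp add: power_mult_distrib)
      also have "\<dots> \<le> (2 * A)\<^sup>2 * (norm (a - b) * (1 / \<delta>)) powr (2 * p)"
        using mle 3(1) p by (intro mult_left_mono powr_mono2) auto
      also have "\<dots> = (2 * A)\<^sup>2 * (1 / \<delta>) powr (2 * p) * norm (a - b) powr (2 * p)"
        using \<delta>(1) by (subst powr_mult) auto
      also have "\<dots> \<le> \<epsilon> * norm b powr (2 * p) + C * norm (a - b) powr (2 * p)"
        using \<epsilon> by (simp add: C_def distrib_right)
      finally show ?thesis .
    qed
  qed
  then show ?thesis using C0 by blast
qed

section \<open>The test function\<close>

text \<open>Cauchy--Schwarz in the form of Young's inequality: it is linear in the squared norms and can be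
  integrated in time term by term, with a weight \<open>a\<close> chosen later.\<close>

lemma pairing_Young:
  fixes f g :: "'a::euclidean_space \<Rightarrow> complex"
  assumes "f \<in> borel_measurable borel" "g \<in> borel_measurable borel"
    and "nsq f \<le> ennreal A" "nsq g \<le> ennreal B" "a > 0"
  shows "norm (LINT x|lborel. f x * g x) \<le> a * max 0 A / 2 + max 0 B / (2 * a)"
proof -
  define A' B' where "A' = max 0 A" and "B' = max 0 B"
  have AB: "nsq f \<le> ennreal A'" "nsq g \<le> ennreal B'" "A' \<ge> 0" "B' \<ge> 0"
    using assms(3,4) by (auto simp: A'_def B'_def max_def ennreal_neg)
  have fin: "nsq f < top" "nsq g < top" using AB by (auto intro: order_le_less_trans)
  have "ennreal ((norm (LINT x|lborel. f x * g x))\<^sup>2) \<le> nsq f * nsq g"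
    by (rule integrable_mult_nsq(2)[OF assms(1,2) fin])
  also have "\<dots> \<le> ennreal A' * ennreal B'" by (intro mult_mono AB) auto
  also have "\<dots> = ennreal (A' * B')" using AB by (simp add: ennreal_mult)
  finally have "(norm (LINT x|lborel. f x * g x))\<^sup>2 \<le> A' * B'" using AB by (simp add: ennreal_le_iff)
  also have "\<dots> \<le> (a * A' / 2 + B' / (2 * a))\<^sup>2"
  proof -
    have "(a * A' / 2 + B' / (2 * a))\<^sup>2 - A' * B' = (a * A' / 2 - B' / (2 * a))\<^sup>2"
      using assms(5) by (simp add: power2_eq_square field_simps)
    then show ?thesis by (metis diff_ge_0_iff_ge zero_le_power2)
  qed
  finally have "norm (LINT x|lborel. f x * g x) \<le> a * A' / 2 + B' / (2 * a)"
    by (rule power2_le_imp_le) (use AB assms(5) in auto)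
  then show ?thesis by (simp add: A'_def B'_def)
qed

lemma bump_eq_wave_packet:
  "bump R = (\<lambda>x::'a::euclidean_space. of_real (R powr (- (real DIM('a) / 2))) * wave_packet (1 / R\<^sup>2) 0 x)"
  by (simp add: fun_eq_iff bump_def wave_packet_def)

lemma bump_schwartz: "R > 0 \<Longrightarrow> bump R \<in> schwartz"
  unfolding bump_eq_wave_packet by (intro polyfun_wave_packet_schwartz polyfun.const) auto

lemma gaussian_nn_integral:
  assumes "a > 0"
  shows "(\<integral>\<^sup>+ x. ennreal (exp (- a * (norm (x::'a::euclidean_space))\<^sup>2)) \<partial>lborel) = ennreal ((pi / a) powr (DIM('a) / 2))"
proof -
  let ?c = "(pi / a) powr (- (real DIM('a) / 2))"
  have "ennreal ?c * (\<integral>\<^sup>+ x. ennreal (exp (- a * (norm (x::'a))\<^sup>2)) \<partial>lborel) = 1"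
    using gaussian_total_mass[OF assms, of "0::'a"] by (simp add: ennreal_mult nn_integral_cmult)
  then have "ennreal (inverse ?c) * (ennreal ?c * (\<integral>\<^sup>+ x. ennreal (exp (- a * (norm (x::'a))\<^sup>2)) \<partial>lborel)) = ennreal (inverse ?c)"
    by simp
  moreover have "ennreal (inverse ?c) * ennreal ?c = 1"
    using assms by (subst ennreal_mult[symmetric]) auto
  moreover have "inverse ?c = (pi / a) powr (DIM('a) / 2)" by (simp add: powr_minus)
  ultimately show ?thesis by (simp add: mult.assoc[symmetric])
qed

lemma nsq_bump:
  assumes R: "R > 0"
  shows "nsq (bump R :: 'a::euclidean_space \<Rightarrow> complex) = ennreal ((pi / 2) powr (DIM('a) / 2))"
proof -
  let ?d = "real DIM('a)"
  have "nsq (bump R :: 'a \<Rightarrow> complex) = (\<integral>\<^sup>+ x. ennreal (R powr (- ?d)) * ennreal (exp (- (2 / R\<^sup>2) * (norm (x::'a))\<^sup>2)) \<partial>lborel)"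
    unfolding nsq_def
  proof (intro nn_integral_cong)
    fix x :: 'a
    have "(norm (bump R x :: complex))\<^sup>2 = (R powr (- (?d / 2)))\<^sup>2 * (exp (- ((norm x)\<^sup>2 / R\<^sup>2)))\<^sup>2"
      by (simp add: bump_def power_mult_distrib norm_mult)
    also have "(R powr (- (?d / 2)))\<^sup>2 = R powr (- ?d)" by (simp add: power2_eq_square powr_add[symmetric])
    also have "(exp (- ((norm x)\<^sup>2 / R\<^sup>2)))\<^sup>2 = exp (- (2 / R\<^sup>2) * (norm x)\<^sup>2)"
      by (simp add: power2_eq_square exp_add[symmetric])
    finally show "ennreal ((norm (bump R x :: complex))\<^sup>2) = ennreal (R powr (- ?d)) * ennreal (exp (- (2 / R\<^sup>2) * (norm x)\<^sup>2))"
      by (simp add: ennreal_mult)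
  qed
  also have "\<dots> = ennreal (R powr (- ?d)) * ennreal ((pi / (2 / R\<^sup>2)) powr (?d / 2))"
  proof -
    have "2 / R\<^sup>2 > 0" using R by simp
    from gaussian_nn_integral[OF this, where 'a='a] show ?thesis
      by (subst nn_integral_cmult) (simp, simp only:)
  qed
  also have "\<dots> = ennreal ((pi / 2) powr (?d / 2))"
  proof -
    have "pi / (2 / R\<^sup>2) = (pi / 2) * R powr 2" using R by (simp add: powr_numeral)
    then have "(pi / (2 / R\<^sup>2)) powr (?d / 2) = (pi / 2) powr (?d / 2) * R powr ?d"
      by (simp only: powr_mult powr_powr) simp
    then show ?thesis using R by (simp add: ennreal_mult[symmetric] powr_minus)
  qed
  finally show ?thesis .
qed

lemma fourier_cmult: "fourier (\<lambda>x. c * f x) \<xi> = c * fourier f \<xi>"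
proof -
  have "exp (- \<i> * complex_of_real (x \<bullet> \<xi>)) * (c * f x) = c * (exp (- \<i> * complex_of_real (x \<bullet> \<xi>)) * f x)" for x
    by (rule mult.left_commute)
  then show ?thesis unfolding fourier_def by (simp only: integral_mult_right_zero mult_scaleR_right)
qed

lemma fourier_bump:
  fixes \<xi> :: "'a::euclidean_space"
  assumes R: "R > 0"
  shows "fourier (bump R) \<xi> = of_real ((R / 2) powr (DIM('a) / 2) * exp (- (R\<^sup>2 / 4) * (norm \<xi>)\<^sup>2))"
proof -
  let ?d = "real DIM('a)"
  have "fourier (bump R) \<xi> = of_real (R powr (- (?d / 2))) * fourier (wave_packet (1 / R\<^sup>2) 0) \<xi>"
    unfolding bump_eq_wave_packet by (rule fourier_cmult)
  also have "\<dots> = of_real (R powr (- (?d / 2)) * (2 * (1 / R\<^sup>2)) powr (- (?d / 2)) * exp (- (R\<^sup>2 / 4) * (norm \<xi>)\<^sup>2))"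
    using R by (subst fourier_wave_packet) (auto simp: mult_ac)
  also have "R powr (- (?d / 2)) * (2 * (1 / R\<^sup>2)) powr (- (?d / 2)) = (R / 2) powr (?d / 2)"
  proof -
    have "R powr (- (?d / 2)) * (2 * (1 / R\<^sup>2)) powr (- (?d / 2)) = (R * (2 * (1 / R\<^sup>2))) powr (- (?d / 2))"
      by (rule powr_mult[symmetric])
    also have "R * (2 * (1 / R\<^sup>2)) = inverse (R / 2)" using R by (simp add: power2_eq_square)
    also have "inverse (R / 2) powr (- (?d / 2)) = (R / 2) powr (?d / 2)"
    proof -
      have "inverse (R / 2) = (R / 2) powr (- 1)" using R by (simp add: powr_minus)
      then show ?thesis by (simp only: powr_powr) simp
    qed
    finally show ?thesis .
  qed
  finally show ?thesis .
qed

lemma bump_inversion: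
  fixes x :: "'a::euclidean_space"
  assumes R: "R > 0"
  shows "fourier (fourier (bump R)) x = bump R x"
proof -
  let ?d = "real DIM('a)"
  have "fourier (bump R) = (\<lambda>\<xi>::'a. of_real ((R / 2) powr (?d / 2)) * wave_packet (R\<^sup>2 / 4) 0 \<xi>)"
    by (rule ext) (simp add: fourier_bump[OF R] wave_packet_def)
  then have "fourier (fourier (bump R)) x = of_real ((R / 2) powr (?d / 2)) * fourier (wave_packet (R\<^sup>2 / 4) 0) x"
    by (simp only: fourier_cmult)
  also have "\<dots> = of_real ((R / 2) powr (?d / 2) * (2 * (R\<^sup>2 / 4)) powr (- (?d / 2)) * exp (- ((norm x)\<^sup>2 / R\<^sup>2)))"
    using R by (subst fourier_wave_packet) (auto simp: mult_ac)
  also have "(R / 2) powr (?d / 2) * (2 * (R\<^sup>2 / 4)) powr (- (?d / 2)) = R powr (- (?d / 2))"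
  proof -
    have "2 * (R\<^sup>2 / 4) = (R / 2) * R" by (simp add: power2_eq_square)
    then have "(2 * (R\<^sup>2 / 4)) powr (- (?d / 2)) = (R / 2) powr (- (?d / 2)) * R powr (- (?d / 2))"
      by (simp only: powr_mult)
    then show ?thesis using R by (simp add: powr_minus)
  qed
  finally show ?thesis by (simp only: bump_def[of R x])
qed

text \<open>At spatial scale \<open>R\<close> the free evolution is almost stationary over times \<open>\<tau>\<close> much shorter than
  \<open>R\<^sup>2\<close>, because the frequencies present are of order \<open>1 / R\<close>.\<close>

lemma nsq_schrodinger_bump_diff:
  obtains C where "C \<ge> 0"
    "\<And>R \<tau>. R > 0 \<Longrightarrow> nsq (\<lambda>x::'a::euclidean_space. schrodinger \<tau> (bump R) x - bump R x) \<le> ennreal (C * \<tau>\<^sup>2 / R ^ 4)"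
proof -
  let ?d = "real DIM('a)"
  obtain K where K: "\<And>r::real. r \<ge> 0 \<Longrightarrow> (1 + r) ^ 4 * exp (- (1 / 4) * r\<^sup>2) \<le> K"
    using one_plus_power_le_exp[of "1/4" 4] by auto
  have K0: "K \<ge> 0" using K[of 0] by simp
  define C where "C = K * (1 / 2) ^ DIM('a) * (pi / (1 / 4)) powr (?d / 2)"
  have C: "C \<ge> 0" using K0 by (simp add: C_def)
  show thesis
  proof (rule that[OF C])
    fix R \<tau> :: real assume R: "R > 0"
    define m where "m \<xi> = exp (- \<i> * complex_of_real (\<tau> * (norm \<xi>)\<^sup>2))" for \<xi> :: 'a
    have [measurable]: "m \<in> borel_measurable borel" unfolding m_def by simp
    have m1: "norm (m \<xi>) = 1" for \<xi> by (simp add: m_def)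
    let ?h = "\<lambda>\<xi>. (m \<xi> - 1) * fourier (bump R) \<xi>"
    define G where "G \<xi> = \<tau>\<^sup>2 * (norm \<xi>) ^ 4 * ((R / 2) powr ?d * exp (- (R\<^sup>2 / 2) * (norm \<xi>)\<^sup>2))" for \<xi> :: 'a
    have Gm: "(\<lambda>\<xi>. ennreal (G \<xi>)) \<in> borel_measurable borel" unfolding G_def by measurable
    have i: "integrable lborel (fourier (bump R :: 'a \<Rightarrow> complex))"
      by (rule fourier_schwartz_integrable[OF bump_schwartz[OF R]])
    have im: "integrable lborel (\<lambda>\<xi>. m \<xi> * fourier (bump R) \<xi>)"
      by (rule Bochner_Integration.integrable_bound[OF i]) (auto simp: norm_mult m1)
    have ih: "integrable lborel ?h" using im i by (simp add: left_diff_distrib)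
    have "schrodinger \<tau> (bump R) x - bump R x = fourier ?h (- x)" for x
    proof -
      have "bump R x = fourier (fourier (bump R)) (- x)" using bump_inversion[OF R, of "- x"] by (simp add: bump_def)
      moreover have "schrodinger \<tau> (bump R) x = fourier (\<lambda>\<xi>. m \<xi> * fourier (bump R) \<xi>) (- x)"
        by (simp add: schrodinger_def inv_fourier_eq m_def)
      moreover have "fourier ?h (- x) = fourier (\<lambda>\<xi>. m \<xi> * fourier (bump R) \<xi>) (- x) - fourier (fourier (bump R)) (- x)"
      proof -
        have "(LINT \<xi>|lborel. exp (- \<i> * complex_of_real (\<xi> \<bullet> (- x))) * ?h \<xi>) =
          (LINT \<xi>|lborel. exp (- \<i> * complex_of_real (\<xi> \<bullet> (- x))) * (m \<xi> * fourier (bump R) \<xi>) - exp (- \<i> * complex_of_real (\<xi> \<bullet> (- x))) * fourier (bump R) \<xi>)"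
          by (intro Bochner_Integration.integral_cong refl) (simp add: algebra_simps)
        also have "\<dots> = (LINT \<xi>|lborel. exp (- \<i> * complex_of_real (\<xi> \<bullet> (- x))) * (m \<xi> * fourier (bump R) \<xi>)) - (LINT \<xi>|lborel. exp (- \<i> * complex_of_real (\<xi> \<bullet> (- x))) * fourier (bump R) \<xi>)"
          by (intro Bochner_Integration.integral_diff integrable_character_mult im i)
        finally show ?thesis by (simp add: fourier_borel scaleR_diff_right)
      qed
      ultimately show ?thesis by simp
    qed
    then have "nsq (\<lambda>x::'a. schrodinger \<tau> (bump R) x - bump R x) = nsq (\<lambda>x. fourier ?h (- x))" by simp
    also have "\<dots> = nsq (fourier ?h)" by (rule nsq_reflect) simp
    also have "\<dots> \<le> nsq ?h" by (rule nsq_fourier_le[OF ih])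
    also have "\<dots> \<le> (\<integral>\<^sup>+ \<xi>. ennreal (G \<xi>) \<partial>lborel)"
      unfolding nsq_def
    proof (intro nn_integral_mono ennreal_leI)
      fix \<xi> :: 'a
      have "norm (m \<xi> - 1) \<le> \<bar>\<tau> * (norm \<xi>)\<^sup>2\<bar>"
      proof -
        have "m \<xi> = cis (- (\<tau> * (norm \<xi>)\<^sup>2))" by (simp add: m_def cis_conv_exp)
        then show ?thesis using equation_minus_iff[of "\<tau> * (norm \<xi>)\<^sup>2"] iexp_approx1[of "- (\<tau> * (norm \<xi>)\<^sup>2)" 0]
          by (simp add: cis_conv_exp)
      qed
      then have "(norm (m \<xi> - 1))\<^sup>2 \<le> \<bar>\<tau> * (norm \<xi>)\<^sup>2\<bar>\<^sup>2" by (intro power_mono) auto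
      also have "\<dots> = \<tau>\<^sup>2 * (norm \<xi>) ^ 4" by (simp add: power_mult_distrib power_mult[symmetric])
      finally have 1: "(norm (m \<xi> - 1))\<^sup>2 \<le> \<tau>\<^sup>2 * (norm \<xi>) ^ 4" .
      have 2: "(norm (fourier (bump R) \<xi>))\<^sup>2 = (R / 2) powr ?d * exp (- (R\<^sup>2 / 2) * (norm \<xi>)\<^sup>2)"
      proof -
        have "(norm (fourier (bump R) \<xi>))\<^sup>2 = ((R / 2) powr (?d / 2))\<^sup>2 * (exp (- (R\<^sup>2 / 4) * (norm \<xi>)\<^sup>2))\<^sup>2"
          unfolding fourier_bump[OF R] norm_of_real by (simp add: power_mult_distrib)
        also have "((R / 2) powr (?d / 2))\<^sup>2 = (R / 2) powr ?d"
          unfolding power2_eq_square powr_add[symmetric] by simp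
        also have "(exp (- (R\<^sup>2 / 4) * (norm \<xi>)\<^sup>2))\<^sup>2 = exp (- (R\<^sup>2 / 2) * (norm \<xi>)\<^sup>2)"
          unfolding power2_eq_square[of "exp _"] exp_add[symmetric] by simp
        finally show ?thesis .
      qed
      have "(norm (?h \<xi>))\<^sup>2 = (norm (m \<xi> - 1))\<^sup>2 * ((R / 2) powr ?d * exp (- (R\<^sup>2 / 2) * (norm \<xi>)\<^sup>2))"
        by (simp only: norm_mult power_mult_distrib 2)
      then show "(norm (?h \<xi>))\<^sup>2 \<le> G \<xi>"
        unfolding G_def by (simp only:) (intro mult_right_mono 1, auto)
    qed
    also have "\<dots> = ennreal (\<bar>1 / R\<bar> ^ DIM('a)) * (\<integral>\<^sup>+ \<xi>. ennreal (G (0 + (1 / R) *\<^sub>R \<xi>)) \<partial>lborel)"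
      using R by (intro nn_integral_lborel_affine Gm) auto
    also have "\<dots> = (\<integral>\<^sup>+ \<xi>. ennreal (\<bar>1 / R\<bar> ^ DIM('a)) * ennreal (G (0 + (1 / R) *\<^sub>R \<xi>)) \<partial>lborel)"
      by (rule nn_integral_cmult[symmetric]) (simp add: G_def)
    also have "\<dots> \<le> (\<integral>\<^sup>+ \<xi>. ennreal (\<tau>\<^sup>2 / R ^ 4 * (1 / 2) ^ DIM('a) * K) * ennreal (exp (- (1 / 4) * (norm (\<xi>::'a))\<^sup>2)) \<partial>lborel)"
    proof (intro nn_integral_mono)
      fix \<xi> :: 'a
      have nx: "norm (0 + (1 / R) *\<^sub>R \<xi>) = norm \<xi> / R" using R by simp
      have e1: "(norm \<xi>) ^ 4 * exp (- (1 / 4) * (norm \<xi>)\<^sup>2) \<le> K"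
        by (rule order_trans[OF mult_right_mono K]) (auto intro!: power_mono)
      have e2: "exp (- (R\<^sup>2 / 2) * (norm \<xi> / R)\<^sup>2) = exp (- (1 / 4) * (norm \<xi>)\<^sup>2) * exp (- (1 / 4) * (norm \<xi>)\<^sup>2)"
        using R by (simp add: exp_add[symmetric] power_divide)
      have e3: "\<bar>1 / R\<bar> ^ DIM('a) * (R / 2) powr ?d = (1 / 2) ^ DIM('a)"
        using R by (simp add: powr_realpow power_mult_distrib[symmetric])
      have "\<bar>1 / R\<bar> ^ DIM('a) * (\<tau>\<^sup>2 * (norm \<xi> / R) ^ 4 * ((R / 2) powr ?d * exp (- (R\<^sup>2 / 2) * (norm \<xi> / R)\<^sup>2))) =
          \<tau>\<^sup>2 / R ^ 4 * (\<bar>1 / R\<bar> ^ DIM('a) * (R / 2) powr ?d) * ((norm \<xi>) ^ 4 * exp (- (1 / 4) * (norm \<xi>)\<^sup>2)) * exp (- (1 / 4) * (norm \<xi>)\<^sup>2)"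
        unfolding e2 by (simp add: power_divide mult_ac)
      also have "\<dots> \<le> \<tau>\<^sup>2 / R ^ 4 * (1 / 2) ^ DIM('a) * K * exp (- (1 / 4) * (norm \<xi>)\<^sup>2)"
        unfolding e3 using R by (intro mult_right_mono mult_left_mono e1) auto
      finally have "\<bar>1 / R\<bar> ^ DIM('a) * G (0 + (1 / R) *\<^sub>R \<xi>) \<le> \<tau>\<^sup>2 / R ^ 4 * (1 / 2) ^ DIM('a) * K * exp (- (1 / 4) * (norm \<xi>)\<^sup>2)"
        unfolding G_def nx .
      moreover have "G \<eta> \<ge> 0" for \<eta> by (simp add: G_def)
      moreover have "\<tau>\<^sup>2 / R ^ 4 * (1 / 2) ^ DIM('a) * K \<ge> 0" using K0 R by simp
      ultimately show "ennreal (\<bar>1 / R\<bar> ^ DIM('a)) * ennreal (G (0 + (1 / R) *\<^sub>R \<xi>))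
        \<le> ennreal (\<tau>\<^sup>2 / R ^ 4 * (1 / 2) ^ DIM('a) * K) * ennreal (exp (- (1 / 4) * (norm \<xi>)\<^sup>2))"
        by (simp only: ennreal_mult[symmetric] abs_ge_zero zero_le_power exp_ge_zero ennreal_leI)
    qed
    also have "\<dots> = ennreal (\<tau>\<^sup>2 / R ^ 4 * (1 / 2) ^ DIM('a) * K) * ennreal ((pi / (1 / 4)) powr (?d / 2))"
      by (subst nn_integral_cmult) (simp_all only: gaussian_nn_integral[of "1/4"], simp_all)
    also have "\<dots> = ennreal (C * \<tau>\<^sup>2 / R ^ 4)"
      using K0 R by (simp add: C_def ennreal_mult[symmetric] mult_ac)
    finally show "nsq (\<lambda>x::'a. schrodinger \<tau> (bump R) x - bump R x) \<le> ennreal (C * \<tau>\<^sup>2 / R ^ 4)" .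
  qed
qed

section \<open>Space-time norms\<close>

lemma pmass_cong_AE: "AE x in lborel. f x = g x \<Longrightarrow> pmass q f = pmass q g"
  unfolding pmass_def by (intro nn_integral_cong_AE) auto

lemma powr_add_le:
  fixes x y q :: real
  assumes "x \<ge> 0" "y \<ge> 0" "q \<ge> 0"
  shows "(x + y) powr q \<le> 2 powr q * (x powr q + y powr q)"
proof -
  have "(x + y) powr q \<le> (2 * max x y) powr q" using assms by (intro powr_mono2) auto
  also have "\<dots> = 2 powr q * max x y powr q" by (rule powr_mult)
  also have "\<dots> \<le> 2 powr q * (x powr q + y powr q)" by (rule mult_left_mono) (auto simp: max_def)
  finally show ?thesis .
qed

lemma pmass_add_le:
  assumes "f \<in> borel_measurable borel" "g \<in> borel_measurable borel" "q \<ge> 0"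
  shows "pmass q (\<lambda>x. f x + g x) \<le> ennreal (2 powr q) * (pmass q f + pmass q g)"
proof -
  note [measurable] = assms(1,2)
  have "pmass q (\<lambda>x. f x + g x) \<le> (\<integral>\<^sup>+ x. ennreal (2 powr q) * (ennreal (norm (f x) powr q) + ennreal (norm (g x) powr q)) \<partial>lborel)"
    unfolding pmass_def
  proof (intro nn_integral_mono)
    fix x
    have "norm (f x + g x) powr q \<le> (norm (f x) + norm (g x)) powr q"
      using assms(3) by (intro powr_mono2 norm_triangle_ineq) auto
    also have "\<dots> \<le> 2 powr q * (norm (f x) powr q + norm (g x) powr q)"
      using assms(3) by (intro powr_add_le) auto
    finally show "ennreal (norm (f x + g x) powr q) \<le> ennreal (2 powr q) * (ennreal (norm (f x) powr q) + ennreal (norm (g x) powr q))"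
      by (simp add: ennreal_mult[symmetric] ennreal_plus[symmetric] ennreal_leI del: ennreal_plus)
  qed
  also have "\<dots> = ennreal (2 powr q) * (pmass q f + pmass q g)"
    unfolding pmass_def by (subst nn_integral_cmult) (simp_all add: nn_integral_add)
  finally show ?thesis .
qed

lemma pmass_profile_of:
  fixes W :: "'a::euclidean_space \<Rightarrow> complex"
  assumes [measurable]: "W \<in> borel_measurable borel" and s: "s > 0"
  shows "pmass q (profile_of lam W s) = ennreal ((2 * s) powr (real DIM('a) - q * (real DIM('a) / 2))) * pmass q W"
proof -
  let ?d = "real DIM('a)"
  have "pmass q (profile_of lam W s) = ennreal (\<bar>2 * s\<bar> ^ DIM('a)) * (\<integral>\<^sup>+ y. ennreal (norm (profile_of lam W s (0 + (2 * s) *\<^sub>R y)) powr q) \<partial>lborel)"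
    unfolding pmass_def using s by (intro nn_integral_lborel_affine) auto
  also have "(\<integral>\<^sup>+ y. ennreal (norm (profile_of lam W s (0 + (2 * s) *\<^sub>R y)) powr q) \<partial>lborel) = (\<integral>\<^sup>+ y. ennreal ((2 * s) powr (- q * (?d / 2))) * ennreal (norm (W y) powr q) \<partial>lborel)"
  proof (intro nn_integral_cong)
    fix y
    have "norm (profile_of lam W s (0 + (2 * s) *\<^sub>R y)) = (2 * s) powr (- (?d / 2)) * norm (W y)"
      using s by (simp add: profile_of_def norm_mult)
    then have "norm (profile_of lam W s (0 + (2 * s) *\<^sub>R y)) powr q = (2 * s) powr (- q * (?d / 2)) * norm (W y) powr q"
      by (simp only: powr_mult powr_powr) (simp add: mult_ac)
    then show "ennreal (norm (profile_of lam W s (0 + (2 * s) *\<^sub>R y)) powr q) = ennreal ((2 * s) powr (- q * (?d / 2))) * ennreal (norm (W y) powr q)"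
      by (simp add: ennreal_mult)
  qed
  also have "\<dots> = ennreal ((2 * s) powr (- q * (?d / 2))) * pmass q W"
    unfolding pmass_def by (rule nn_integral_cmult) simp
  also have "ennreal (\<bar>2 * s\<bar> ^ DIM('a)) * \<dots> = ennreal ((2 * s) powr (?d - q * (?d / 2))) * pmass q W"
  proof -
    have 1: "\<bar>2 * s\<bar> ^ DIM('a) = (2 * s) powr ?d" using s powr_realpow[of "2 * s" "DIM('a)"] by simp
    have 2: "(2 * s) powr ?d * (2 * s) powr (- q * (?d / 2)) = (2 * s) powr (?d - q * (?d / 2))"
      unfolding powr_add[symmetric] by simp
    have 3: "ennreal ((2 * s) powr ?d) * ennreal ((2 * s) powr (- q * (?d / 2))) = ennreal ((2 * s) powr (?d - q * (?d / 2)))"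
      unfolding 2[symmetric] by (rule ennreal_mult[symmetric]) auto
    show ?thesis unfolding 1 mult.assoc[symmetric] 3 ..
  qed
  finally show ?thesis .
qed

lemma nsq_profile_of:
  fixes W :: "'a::euclidean_space \<Rightarrow> complex"
  assumes "W \<in> borel_measurable borel" "s > 0"
  shows "nsq (profile_of lam W s) = nsq W"
  using pmass_profile_of[OF assms, of 2 lam] assms(2) by (simp add: nsq_eq_pmass)

lemma spacetime_norm_eq:
  assumes "q > 0" "J \<in> sets borel"
  shows "spacetime_norm q J v = epowr (\<integral>\<^sup>+ t. pmass q (v t) * indicator J t \<partial>lborel) (1 / q)"
  unfolding spacetime_norm_def eLp_def Lp_norm_epowr[OF assms(1)] pmass_def[symmetric]
  using assms(2) by (subst nn_integral_restrict_space) (simp_all add: nn_integral_completion)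

lemma epowr_mult:
  assumes "c > 0" "p > 0"
  shows "epowr (ennreal c * x) p = ennreal (c powr p) * epowr x p"
proof (cases x)
  case (real r)
  have "epowr (ennreal c * ennreal r) p = ennreal ((c * r) powr p)"
    using assms real(1) by (simp only: ennreal_mult[symmetric] less_imp_le epowr_ennreal mult_nonneg_nonneg)
  also have "\<dots> = ennreal (c powr p) * ennreal (r powr p)" by (simp add: powr_mult ennreal_mult)
  finally show ?thesis unfolding real(2) epowr_ennreal[OF real(1)] .
next
  case top
  have "c powr p > 0" using assms by simp
  with top assms show ?thesis by (simp add: epowr_def ennreal_mult_top)
qed

text \<open>The scalar bound survives integration even though \<open>X\<close> is not assumed measurable: only the
  measurable excess of \<open>f\<close> over \<open>h\<close> is compared with it.\<close>

lemma nn_integral_le_nonmeasurable: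
  assumes [measurable]: "f \<in> borel_measurable M" "h \<in> borel_measurable M"
    and c: "c > 0" and le: "\<And>x. x \<in> space M \<Longrightarrow> f x \<le> h x + ennreal c * X x" and h: "\<And>x. h x < top"
  shows "(\<integral>\<^sup>+ x. f x \<partial>M) \<le> (\<integral>\<^sup>+ x. h x \<partial>M) + ennreal c * (\<integral>\<^sup>+ x. X x \<partial>M)"
proof -
  have cc: "ennreal c * ennreal (1 / c) = 1" using c by (subst ennreal_mult[symmetric]) auto
  have "f x \<le> h x + (f x - h x)" for x
  proof (cases "h x \<le> f x")
    case True
    then show ?thesis by (simp add: add_diff_inverse_ennreal)
  next
    case False
    then have "f x \<le> h x" by simp
    then show ?thesis by (rule order_trans) simp
  qed
  then have "(\<integral>\<^sup>+ x. f x \<partial>M) \<le> (\<integral>\<^sup>+ x. h x + (f x - h x) \<partial>M)" by (intro nn_integral_mono)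
  also have "\<dots> = (\<integral>\<^sup>+ x. h x \<partial>M) + (\<integral>\<^sup>+ x. f x - h x \<partial>M)" by (rule nn_integral_add) measurable
  also have "(\<integral>\<^sup>+ x. f x - h x \<partial>M) = (\<integral>\<^sup>+ x. ennreal c * (ennreal (1 / c) * (f x - h x)) \<partial>M)"
    by (simp only: mult.assoc[symmetric] cc mult_1)
  also have "\<dots> = ennreal c * (\<integral>\<^sup>+ x. ennreal (1 / c) * (f x - h x) \<partial>M)"
    by (intro nn_integral_cmult) measurable
  also have "\<dots> \<le> ennreal c * (\<integral>\<^sup>+ x. X x \<partial>M)"
  proof (intro mult_left_mono nn_integral_mono)
    fix x assume "x \<in> space M"
    then have "f x - h x \<le> ennreal c * X x"
      using le[of x] h[of x] by (auto simp: ennreal_minus_le_iff)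
    then have "ennreal (1 / c) * (f x - h x) \<le> ennreal (1 / c) * (ennreal c * X x)" by (intro mult_left_mono) auto
    also have "\<dots> = X x" by (simp only: mult.assoc[symmetric] mult.commute[of "ennreal (1 / c)"] cc mult_1)
    finally show "ennreal (1 / c) * (f x - h x) \<le> X x" .
  qed simp
  finally show ?thesis by (simp add: add_left_mono)
qed

section \<open>Solutions close to a profile\<close>

text \<open>Continuity in \<open>L\<^sup>2\<close> makes the \<open>L\<^sup>q\<close> norm lower semicontinuous in time: along a suitable
  subsequence the slices converge almost everywhere, and Fatou's lemma applies.\<close>

lemma pmass_measurable_in_time:
  fixes u :: "real \<Rightarrow> 'a::euclidean_space \<Rightarrow> complex"
  assumes um: "\<And>t. t \<in> I \<Longrightarrow> u t \<in> borel_measurable borel" and I: "closed I"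
    and cont: "\<And>t. t \<in> I \<Longrightarrow> ((\<lambda>s. nsq (\<lambda>x. u s x - u t x)) \<longlongrightarrow> 0) (at t within I)" and q: "q > 0"
  shows "(\<lambda>t. pmass q (u t) * indicator I t) \<in> borel_measurable borel"
proof (rule borel_measurableI_le)
  fix c :: ennreal
  have "closed {t \<in> I. pmass q (u t) \<le> c}"
    unfolding closed_sequential_limits
  proof (intro allI impI, elim conjE)
    fix x l assume x: "\<forall>n. x n \<in> {t \<in> I. pmass q (u t) \<le> c}" and xl: "x \<longlonglongrightarrow> l"
    then have xI: "x n \<in> I" "pmass q (u (x n)) \<le> c" for n by auto
    have l: "l \<in> I" using I xI(1) xl closed_sequentially by blast
    let ?D = "\<lambda>s. nsq (\<lambda>y. u s y - u l y)"
    have "?D l = 0" by (simp add: nsq_def)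
    then have "continuous (at l within I) ?D" using cont[OF l] by (simp add: continuous_within)
    then have "(?D \<circ> x) \<longlonglongrightarrow> ?D l" using xI(1) xl unfolding continuous_within_sequentially by blast
    then have D0: "(\<lambda>n. ?D (x n)) \<longlonglongrightarrow> 0" using \<open>?D l = 0\<close> by (simp add: comp_def)
    have "\<exists>n. ?D (x n) < ennreal ((1 / 4) ^ k)" for k
      using order_tendstoD(2)[OF D0, of "ennreal ((1 / 4) ^ k)"] by (auto simp: eventually_sequentially)
    then obtain r where r: "\<And>k. ?D (x (r k)) < ennreal ((1 / 4) ^ k)" by metis
    have "AE y in lborel. summable (\<lambda>k. norm (u (x (r k)) y - u l y))"
      by (rule AE_summable_of_nsq_le) (use r um xI(1) l in \<open>auto intro: less_imp_le\<close>)
    then have "AE y in lborel. (\<lambda>k. u (x (r k)) y) \<longlonglongrightarrow> u l y"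
    proof eventually_elim
      case (elim y)
      then have "(\<lambda>k. norm (u (x (r k)) y - u l y)) \<longlonglongrightarrow> 0" by (rule summable_LIMSEQ_zero)
      then show ?case by (simp add: tendsto_norm_zero_iff LIM_zero_iff)
    qed
    then have "pmass q (u l) \<le> c"
      by (rule pmass_Fatou[rotated]) (use um xI q in auto)
    then show "l \<in> {t \<in> I. pmass q (u t) \<le> c}" using l by simp
  qed
  moreover have "{t \<in> space borel. pmass q (u t) * indicator I t \<le> c} = {t \<in> I. pmass q (u t) \<le> c} \<union> - I"
    by (auto simp: indicator_def)
  ultimately show "{t \<in> space borel. pmass q (u t) * indicator I t \<le> c} \<in> sets borel"
    using I by (auto intro!: sets.Un borel_closed borel_open simp: open_Compl)
qed

text \<open>The data of the theorem for Borel representatives, with the norms replaced by their powers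
  and Duhamel's formula tested against Schwartz functions.\<close>

locale nls_profile =
  fixes F :: "complex \<Rightarrow> complex" and g :: "int \<Rightarrow> complex"
    and u :: "real \<Rightarrow> 'a::euclidean_space \<Rightarrow> complex" and W :: "'a \<Rightarrow> complex"
    and T lam p q :: real
  assumes p_def: "p = 1 + 2 / real DIM('a)" and q_def: "q = 2 * p"
    and F_sum: "\<And>z. ((\<lambda>n. g n * nl_mode DIM('a) n z) has_sum F z) UNIV"
    and g_sum: "(\<lambda>n. norm (g n)) summable_on UNIV" and g0: "g 0 = 1"
    and Wm [measurable]: "W \<in> borel_measurable borel" and W2: "nsq W < top"
    and um: "\<And>t. t \<ge> T \<Longrightarrow> u t \<in> borel_measurable borel" and u2: "\<And>t. t \<ge> T \<Longrightarrow> nsq (u t) < top"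
    and u_cont: "\<And>t. t \<ge> T \<Longrightarrow> ((\<lambda>s. nsq (\<lambda>x. u s x - u t x)) \<longlongrightarrow> 0) (at t within {T..})"
    and u_loc: "\<And>a b. T \<le> a \<Longrightarrow> (\<integral>\<^sup>+ t. pmass q (u t) * indicator {a..b} t \<partial>lborel) < top"
    and duhamel_int: "\<And>t1 t2 \<phi>. T \<le> t1 \<Longrightarrow> t1 \<le> t2 \<Longrightarrow> \<phi> \<in> schwartz \<Longrightarrow>
      integrable lebesgue (\<lambda>s. indicator {t1<..<t2} s *\<^sub>R (LINT x|lborel. F (u s x) * schrodinger (t2 - s) \<phi> x))"
    and duhamel: "\<And>t1 t2 \<phi>. T \<le> t1 \<Longrightarrow> t1 \<le> t2 \<Longrightarrow> \<phi> \<in> schwartz \<Longrightarrow>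
      (LINT x|lborel. u t2 x * \<phi> x) = (LINT x|lborel. u t1 x * schrodinger (t2 - t1) \<phi> x)
       - \<i> * (LINT s|lebesgue. indicator {t1<..<t2} s *\<^sub>R (LINT x|lborel. F (u s x) * schrodinger (t2 - s) \<phi> x))"
    and conv2: "((\<lambda>t. nsq (\<lambda>x. u t x - profile_of lam W t x)) \<longlongrightarrow> 0) at_top"
    and convq: "((\<lambda>t. ennreal t * (\<integral>\<^sup>+ s. pmass q (\<lambda>x. u s x - profile_of lam W s x) * indicator {t..} s \<partial>lborel)) \<longlongrightarrow> 0) at_top"
begin

abbreviation "V \<equiv> profile_of lam W"

definition tail :: "real \<Rightarrow> ennreal" where
  "tail t = (\<integral>\<^sup>+ s. pmass q (\<lambda>x. u s x - V s x) * indicator {t..} s \<partial>lborel)"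

lemma p_pos: "p > 0" and q_pos: "q > 0" and d_pos: "real DIM('a) > 0"
  by (auto simp: p_def q_def add_pos_nonneg)

lemma F_cont: "continuous_on UNIV F"
  by (rule nl_series_continuous[OF F_sum g_sum])

lemma Fm [measurable]: "F \<in> borel_measurable borel"
  using F_cont by (rule borel_measurable_continuous_onI)

lemma F_hom: "\<mu> > 0 \<Longrightarrow> F (of_real \<mu> * z) = of_real (\<mu> powr p) * F z"
proof -
  assume \<mu>: "\<mu> > 0"
  have "nl_mode DIM('a) n (of_real \<mu> * z) = of_real (\<mu> powr p) * nl_mode DIM('a) n z" for n
  proof -
    have "\<mu> powr (1 + 2 / real DIM('a) - of_int n) * (\<mu> powi n) = \<mu> powr p"
      using \<mu> by (simp add: p_def powr_real_of_int'[symmetric] powr_add[symmetric])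
    then have "complex_of_real (\<mu> powr p) = of_real (\<mu> powr (1 + 2 / real DIM('a) - of_int n)) * of_real \<mu> powi n"
      by (metis of_real_mult of_real_power_int)
    then show ?thesis
      using \<mu> by (simp add: nl_mode_def norm_mult powr_mult power_int_mult_distrib scaleR_conv_of_real mult_ac)
  qed
  then have "((\<lambda>n. of_real (\<mu> powr p) * (g n * nl_mode DIM('a) n z)) has_sum F (of_real \<mu> * z)) UNIV"
    using F_sum[of "of_real \<mu> * z"] by (simp add: mult_ac)
  moreover have "((\<lambda>n. of_real (\<mu> powr p) * (g n * nl_mode DIM('a) n z)) has_sum of_real (\<mu> powr p) * F z) UNIV"
    by (rule has_sum_cmult_right[OF F_sum])
  ultimately show ?thesis by (rule has_sum_unique)
qed

definition FA :: real where "FA = (\<Sum>\<^sub>\<infinity>n. norm (g n))"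

lemma F_bound: "norm (F z) \<le> FA * norm z powr p" and FA_nonneg: "FA \<ge> 0"
proof -
  have A: "((\<lambda>n. norm (g n)) has_sum FA) UNIV" unfolding FA_def using g_sum by (rule has_sum_infsum)
  show "norm (F z) \<le> FA * norm z powr p" unfolding p_def by (rule nl_series_bound[OF F_sum A])
  show "FA \<ge> 0" unfolding FA_def by (intro infsum_nonneg) auto
qed

lemma nsq_F_le:
  assumes [measurable]: "f \<in> borel_measurable borel"
  shows "nsq (\<lambda>x. F (f x)) \<le> ennreal (FA\<^sup>2) * pmass q f"
proof -
  have "nsq (\<lambda>x. F (f x)) \<le> (\<integral>\<^sup>+ x. ennreal (FA\<^sup>2) * ennreal (norm (f x) powr q) \<partial>lborel)"
    unfolding nsq_def
  proof (intro nn_integral_mono)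
    fix x
    have "(norm (F (f x)))\<^sup>2 \<le> (FA * norm (f x) powr p)\<^sup>2" by (intro power_mono F_bound) auto
    also have "\<dots> = FA\<^sup>2 * norm (f x) powr q"
      by (simp add: power_mult_distrib q_def power2_eq_square powr_add[symmetric])
    finally show "ennreal ((norm (F (f x)))\<^sup>2) \<le> ennreal (FA\<^sup>2) * ennreal (norm (f x) powr q)"
      by (simp add: ennreal_mult[symmetric] ennreal_leI)
  qed
  also have "\<dots> = ennreal (FA\<^sup>2) * pmass q f" unfolding pmass_def by (rule nn_integral_cmult) simp
  finally show ?thesis .
qed

lemma pmass_V: "s > 0 \<Longrightarrow> pmass q (V s) = ennreal ((2 * s) powr (- 2)) * pmass q W"
proof -
  have "real DIM('a) - q * (real DIM('a) / 2) = - 2"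
    using d_pos by (simp add: q_def p_def field_simps)
  then show "s > 0 \<Longrightarrow> pmass q (V s) = ennreal ((2 * s) powr (- 2)) * pmass q W"
    using pmass_profile_of[OF Wm, of s q lam] by simp
qed

lemma tail_finite: "\<forall>\<^sub>F t in at_top. tail t < top"
proof -
  have "\<forall>\<^sub>F t in at_top. ennreal t * tail t < 1"
    using order_tendstoD(2)[OF convq, of 1] by (simp add: tail_def)
  then show ?thesis using eventually_gt_at_top[of 0]
  proof eventually_elim
    case (elim t)
    show ?case
    proof (rule ccontr)
      assume "\<not> tail t < top"
      then have "tail t = top" by (simp add: less_top[symmetric])
      then show False using elim by (simp add: ennreal_mult_top)
    qed
  qed
qed

text \<open>The \<open>L\<^sup>q\<close> norm of \<open>V(s)\<close> is a multiple of that of \<open>W\<close>. If it were infinite, then at every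
  time \<open>u\<close> or \<open>u - V\<close> would have infinite norm, although the \<open>q\<close>-th powers of both are integrable over short intervals.\<close>

lemma pmass_W: "pmass q W < top"
proof (rule ccontr)
  assume "\<not> pmass q W < top"
  then have Winf: "pmass q W = top" by (simp add: less_top[symmetric])
  have "\<forall>\<^sub>F t in at_top. tail t < top \<and> t > 0 \<and> t \<ge> T"
    using tail_finite eventually_gt_at_top[of 0] eventually_ge_at_top[of T] by eventually_elim auto
  then obtain t where t: "tail t < top" "t > 0" "t \<ge> T"
    unfolding eventually_at_top_linorder by blast
  let ?J = "{t..t+1}"
  have [measurable]: "(\<lambda>s. pmass q (u s) * indicator {T..} s) \<in> borel_measurable borel"
    by (rule pmass_measurable_in_time) (use um u_cont q_pos in auto)
  have "(\<lambda>s. pmass q (u s) * indicator {T..} s * indicator ?J s) \<in> borel_measurable borel"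
    by measurable
  moreover have "pmass q (u s) * indicator {T..} s * indicator ?J s = pmass q (u s) * indicator ?J s" for s
    using t by (auto simp: indicator_def)
  ultimately have m: "(\<lambda>s. pmass q (u s) * indicator ?J s) \<in> borel_measurable lborel" by simp
  have "AE s in lborel. pmass q (u s) * indicator ?J s \<noteq> \<infinity>"
    using u_loc[OF t(3), of "t + 1"] by (intro nn_integral_noteq_infinite m) (simp add: less_top[symmetric])
  then have "AE s in lborel. top * indicator ?J s \<le> pmass q (\<lambda>x. u s x - V s x) * indicator {t..} s"
  proof eventually_elim
    case (elim s)
    show ?case
    proof (cases "s \<in> ?J")
      case True
      then have s: "s > 0" "s \<ge> T" "s \<ge> t" using t by auto
      note [measurable] = um[OF s(2)]
      have "top = pmass q (V s)" using s by (simp add: pmass_V Winf ennreal_mult_top)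
      also have "\<dots> = pmass q (\<lambda>x. u s x + (V s x - u s x))" by simp
      also have "\<dots> \<le> ennreal (2 powr q) * (pmass q (u s) + pmass q (\<lambda>x. V s x - u s x))"
        using q_pos by (intro pmass_add_le) auto
      finally have "pmass q (u s) + pmass q (\<lambda>x. V s x - u s x) = top"
        by (simp add: top_unique ennreal_mult_eq_top_iff)
      then have "pmass q (\<lambda>x. V s x - u s x) = top" using elim True by simp
      then show ?thesis using s True by (simp add: pmass_def norm_minus_commute)
    qed simp
  qed
  then have "(\<integral>\<^sup>+ s. top * indicator ?J s \<partial>lborel) \<le> tail t"
    unfolding tail_def by (rule nn_integral_mono_AE)
  moreover have "(\<integral>\<^sup>+ s. top * indicator ?J s \<partial>lborel) = top"
    by (subst nn_integral_cmult_indicator) auto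
  ultimately show False using t(1) by (simp add: top_unique)
qed

definition mass_q :: real where "mass_q = enn2real (pmass q W)"
definition mass_2 :: real where "mass_2 = enn2real (nsq W)"
definition bump_mass :: real where "bump_mass = (pi / 2) powr (DIM('a) / 2)"

lemma nonneg_consts: "mass_q \<ge> 0" "mass_2 \<ge> 0" "bump_mass > 0"
  by (auto simp: mass_q_def mass_2_def bump_mass_def)

lemma nsq_bump_eq: "R > 0 \<Longrightarrow> nsq (bump R :: 'a \<Rightarrow> complex) = ennreal bump_mass"
  by (simp add: nsq_bump bump_mass_def)

lemma nsq_V: "s > 0 \<Longrightarrow> nsq (V s) = ennreal mass_2"
  using W2 by (simp add: nsq_profile_of mass_2_def)

lemma pmass_V_le:
  assumes "R > 0" "s \<ge> R"
  shows "pmass q (V s) \<le> ennreal (mass_q / (4 * R\<^sup>2))"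
proof -
  have s: "s > 0" using assms by simp
  have 1: "(2 * s) powr (- 2) * mass_q = mass_q / (4 * s\<^sup>2)"
  proof -
    have "(2 * s) powr (- 2) = inverse ((2 * s) powr 2)" by (rule powr_minus)
    also have "(2 * s) powr 2 = (2 * s)\<^sup>2" using s by (intro powr_numeral) auto
    also have "\<dots> = 4 * s\<^sup>2" by (simp add: power_mult_distrib)
    finally show ?thesis by (simp only: divide_inverse mult.commute)
  qed
  have 2: "pmass q W = ennreal mass_q" using pmass_W unfolding mass_q_def by (rule ennreal_enn2real[symmetric])
  have "pmass q (V s) = ennreal ((2 * s) powr (- 2)) * ennreal mass_q"
    unfolding pmass_V[OF s] 2 ..
  also have "\<dots> = ennreal (mass_q / (4 * s\<^sup>2))"
    unfolding 1[symmetric] by (rule ennreal_mult[symmetric]) (use nonneg_consts in auto)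
  also have "\<dots> \<le> ennreal (mass_q / (4 * R\<^sup>2))"
  proof (intro ennreal_leI frac_le)
    show "4 * R\<^sup>2 \<le> 4 * s\<^sup>2" using assms by (intro mult_left_mono power_mono) auto
  qed (use assms nonneg_consts in auto)
  finally show ?thesis .
qed

lemma Vm [measurable]: "V s \<in> borel_measurable borel" by measurable

lemma bump_window:
  assumes Cb: "Cb \<ge> 0" "\<And>R \<tau>. R > 0 \<Longrightarrow> nsq (\<lambda>x::'a. schrodinger \<tau> (bump R) x - bump R x) \<le> ennreal (Cb * \<tau>\<^sup>2 / R ^ 4)"
    and R: "R > 0" and \<tau>: "\<bar>\<tau>\<bar> \<le> 2 * R"
  shows "nsq (\<lambda>x::'a. schrodinger \<tau> (bump R) x - bump R x) \<le> ennreal (4 * Cb / R\<^sup>2)"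
proof (rule order_trans[OF Cb(2)[OF R]], rule ennreal_leI)
  have "\<tau>\<^sup>2 \<le> (2 * R)\<^sup>2" using \<tau> R by (intro abs_le_square_iff[THEN iffD1]) simp
  then have "Cb * \<tau>\<^sup>2 / R ^ 4 \<le> Cb * (2 * R)\<^sup>2 / R ^ 4" using Cb(1) by (intro divide_right_mono mult_left_mono) auto
  also have "\<dots> = 4 * Cb / R\<^sup>2" using R by (simp add: power2_eq_square power4_eq_xxxx)
  finally show "Cb * \<tau>\<^sup>2 / R ^ 4 \<le> 4 * Cb / R\<^sup>2" .
qed

text \<open>The first two terms of the constant part come from replacing the free evolution of the Gaussian by
  the Gaussian itself, the other two from replacing \<open>F(u)\<close> by \<open>F(V)\<close>. The bound has the form constant
  plus multiple of \<open>|u - V|\<^sup>q\<close>, which is what the hypotheses control after integration in time. The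
  summand \<open>1\<close> keeps the multiple positive, so that the bound is trivial where \<open>u - V\<close> is not in \<open>L\<^sup>q\<close>.\<close>

lemma duhamel_integrand_bound:
  assumes Cb: "Cb \<ge> 0" "\<And>R \<tau>. R > 0 \<Longrightarrow> nsq (\<lambda>x::'a. schrodinger \<tau> (bump R) x - bump R x) \<le> ennreal (Cb * \<tau>\<^sup>2 / R ^ 4)"
    and C: "C \<ge> 0" "\<And>a b. (norm (F a - F b))\<^sup>2 \<le> \<epsilon> * norm b powr (2 * p) + C * norm (a - b) powr (2 * p)"
    and \<epsilon>: "\<epsilon> > 0" and \<kappa>: "\<kappa> > 0" and s: "s \<ge> T" "R > 0" "s \<ge> R" and \<tau>: "\<bar>\<tau>\<bar> \<le> 2 * R"
  shows "ennreal (norm ((LINT x|lborel. F (u s x) * schrodinger \<tau> (bump R) x) - (LINT x|lborel. F (V s x) * bump R x)))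
     \<le> ennreal (FA\<^sup>2 * 2 powr q * mass_q / (8 * R\<^sup>2) + 2 * Cb / R\<^sup>2 + \<kappa> * \<epsilon> * mass_q / (8 * R) + bump_mass / (2 * \<kappa> * R))
       + ennreal (FA\<^sup>2 * 2 powr q / 2 + \<kappa> * C * R / 2 + 1) * pmass q (\<lambda>x. u s x - V s x)"
    (is "_ \<le> ennreal ?g + ennreal ?c * ?X")
proof (cases "?X = top")
  case True
  have "?c > 0" using C(1) \<kappa> s(2) by (intro add_nonneg_pos add_nonneg_nonneg) auto
  then show ?thesis unfolding True by (simp add: ennreal_mult_top)
next
  case False
  define x where "x = enn2real ?X"
  have x: "?X = ennreal x" "x \<ge> 0" using False by (auto simp: x_def less_top)
  define v where "v = mass_q / (4 * R\<^sup>2)"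
  have v: "pmass q (V s) \<le> ennreal v" "v \<ge> 0" using pmass_V_le[OF s(2,3)] nonneg_consts by (auto simp: v_def)
  note [measurable] = um[OF s(1)]
  have [measurable]: "schrodinger \<tau> (bump R :: 'a \<Rightarrow> complex) \<in> borel_measurable borel" by simp
  have pu: "pmass q (u s) \<le> ennreal (2 powr q * (x + v))"
  proof -
    have "pmass q (u s) = pmass q (\<lambda>y. (u s y - V s y) + V s y)" by simp
    also have "\<dots> \<le> ennreal (2 powr q) * (?X + pmass q (V s))" using q_pos by (intro pmass_add_le) auto
    also have "\<dots> \<le> ennreal (2 powr q) * (ennreal x + ennreal v)" unfolding x(1) using v by (intro mult_left_mono add_left_mono) auto
    also have "\<dots> = ennreal (2 powr q * (x + v))" using x v by (simp add: ennreal_mult[symmetric] ennreal_plus[symmetric] del: ennreal_plus)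
    finally show ?thesis .
  qed
  have nu: "nsq (\<lambda>y. F (u s y)) \<le> ennreal (FA\<^sup>2 * (2 powr q * (x + v)))"
  proof -
    have "nsq (\<lambda>y. F (u s y)) \<le> ennreal (FA\<^sup>2) * pmass q (u s)" by (rule nsq_F_le) simp
    also have "\<dots> \<le> ennreal (FA\<^sup>2) * ennreal (2 powr q * (x + v))" by (intro mult_left_mono pu) auto
    also have "\<dots> = ennreal (FA\<^sup>2 * (2 powr q * (x + v)))" using x v by (simp add: ennreal_mult[symmetric])
    finally show ?thesis .
  qed
  have nV: "nsq (\<lambda>y. F (V s y)) < top"
  proof -
    have "nsq (\<lambda>y. F (V s y)) \<le> ennreal (FA\<^sup>2) * pmass q (V s)" by (rule nsq_F_le) simp
    also have "\<dots> < top" using v(1) by (auto simp: ennreal_mult_less_top intro: order_le_less_trans)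
    finally show ?thesis .
  qed
  have nd: "nsq (\<lambda>y. F (u s y) - F (V s y)) \<le> ennreal (\<epsilon> * v + C * x)"
  proof -
    have "nsq (\<lambda>y. F (u s y) - F (V s y)) \<le> (\<integral>\<^sup>+ y. ennreal \<epsilon> * ennreal (norm (V s y) powr q) + ennreal C * ennreal (norm (u s y - V s y) powr q) \<partial>lborel)"
      unfolding nsq_def
    proof (intro nn_integral_mono)
      fix y
      have "ennreal ((norm (F (u s y) - F (V s y)))\<^sup>2) \<le> ennreal (\<epsilon> * norm (V s y) powr q + C * norm (u s y - V s y) powr q)"
        using C(2)[of "u s y" "V s y"] by (intro ennreal_leI) (simp add: q_def)
      then show "ennreal ((norm (F (u s y) - F (V s y)))\<^sup>2) \<le> ennreal \<epsilon> * ennreal (norm (V s y) powr q) + ennreal C * ennreal (norm (u s y - V s y) powr q)"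
        using C(1) \<epsilon> by (simp add: ennreal_mult)
    qed
    also have "\<dots> = ennreal \<epsilon> * pmass q (V s) + ennreal C * ?X"
      unfolding pmass_def by (subst nn_integral_add) (simp_all add: nn_integral_cmult)
    also have "\<dots> \<le> ennreal \<epsilon> * ennreal v + ennreal C * ennreal x"
      unfolding x(1) by (intro add_mono mult_left_mono v) auto
    also have "\<dots> = ennreal (\<epsilon> * v + C * x)" using C(1) \<epsilon> x v by (simp add: ennreal_mult)
    finally show ?thesis .
  qed
  have nb: "nsq (\<lambda>y::'a. schrodinger \<tau> (bump R) y - bump R y) \<le> ennreal (4 * Cb / R\<^sup>2)"
  by (rule bump_window[OF Cb s(2) \<tau>])
  have fin: "nsq (\<lambda>y. F (u s y)) < top" "nsq (\<lambda>y::'a. schrodinger \<tau> (bump R) y - bump R y) < top"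
    "nsq (bump R :: 'a \<Rightarrow> complex) < top"
    using nu nb nsq_bump_eq[OF s(2)] by (auto intro: order_le_less_trans)
  have i1: "integrable lborel (\<lambda>y. F (u s y) * (schrodinger \<tau> (bump R) y - bump R y))"
    by (intro integrable_mult_nsq(1) fin) auto
  have i2: "integrable lborel (\<lambda>y. F (u s y) * bump R y)" by (intro integrable_mult_nsq(1) fin) auto
  have i3: "integrable lborel (\<lambda>y. F (V s y) * bump R y)" by (intro integrable_mult_nsq(1) fin nV) auto
  have "(LINT x|lborel. F (u s x) * schrodinger \<tau> (bump R) x) = (LINT y|lborel. F (u s y) * (schrodinger \<tau> (bump R) y - bump R y) + F (u s y) * bump R y)"
    by (simp add: right_diff_distrib)
  also have "\<dots> = (LINT y|lborel. F (u s y) * (schrodinger \<tau> (bump R) y - bump R y)) + (LINT y|lborel. F (u s y) * bump R y)"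
    by (rule Bochner_Integration.integral_add[OF i1 i2])
  finally have "(LINT x|lborel. F (u s x) * schrodinger \<tau> (bump R) x) - (LINT x|lborel. F (V s x) * bump R x) =
     (LINT y|lborel. F (u s y) * (schrodinger \<tau> (bump R) y - bump R y)) + (LINT y|lborel. (F (u s y) - F (V s y)) * bump R y)"
    using i2 i3 by (simp add: left_diff_distrib)
  also have "norm \<dots> \<le> norm (LINT y|lborel. F (u s y) * (schrodinger \<tau> (bump R) y - bump R y)) + norm (LINT y|lborel. (F (u s y) - F (V s y)) * bump R y)"
    by (rule norm_triangle_ineq)
  also have "\<dots> \<le> ?g + ?c * x"
  proof -
    have "norm (LINT y|lborel. F (u s y) * (schrodinger \<tau> (bump R) y - bump R y)) \<le> 1 * max 0 (FA\<^sup>2 * (2 powr q * (x + v))) / 2 + max 0 (4 * Cb / R\<^sup>2) / (2 * 1)"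
      by (rule pairing_Young[OF _ _ nu nb]) auto
    also have "max 0 (FA\<^sup>2 * (2 powr q * (x + v))) = FA\<^sup>2 * (2 powr q * (x + v))"
      using x(2) v(2) by (intro max_absorb2 mult_nonneg_nonneg add_nonneg_nonneg) auto
    also have "max 0 (4 * Cb / R\<^sup>2) = 4 * Cb / R\<^sup>2" using Cb(1) by (intro max_absorb2) auto
    also have "1 * (FA\<^sup>2 * (2 powr q * (x + v))) / 2 + 4 * Cb / R\<^sup>2 / (2 * 1) =
        FA\<^sup>2 * 2 powr q / 2 * x + FA\<^sup>2 * 2 powr q * mass_q / (8 * R\<^sup>2) + 2 * Cb / R\<^sup>2"
      by (simp add: v_def field_simps)
    finally have 1: "norm (LINT y|lborel. F (u s y) * (schrodinger \<tau> (bump R) y - bump R y)) \<le> \<dots>" .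
    have "norm (LINT y|lborel. (F (u s y) - F (V s y)) * bump R y) \<le> (\<kappa> * R) * max 0 (\<epsilon> * v + C * x) / 2 + max 0 bump_mass / (2 * (\<kappa> * R))"
      by (rule pairing_Young[OF _ _ nd]) (use nsq_bump_eq[OF s(2)] \<kappa> s(2) in auto)
    also have "max 0 (\<epsilon> * v + C * x) = \<epsilon> * v + C * x"
      using x(2) v(2) \<epsilon> C(1) by (intro max_absorb2 add_nonneg_nonneg mult_nonneg_nonneg) auto
    also have "max 0 bump_mass = bump_mass" using nonneg_consts by (intro max_absorb2) auto
    also have "(\<kappa> * R) * (\<epsilon> * v + C * x) / 2 + bump_mass / (2 * (\<kappa> * R)) = \<kappa> * \<epsilon> * mass_q / (8 * R) + \<kappa> * C * R / 2 * x + bump_mass / (2 * \<kappa> * R)"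
      using s(2) by (simp add: v_def field_simps power2_eq_square)
    finally have 2: "norm (LINT y|lborel. (F (u s y) - F (V s y)) * bump R y) \<le> \<dots>" .
    show ?thesis using 1 2 x(2) by (simp add: distrib_right)
  qed
  finally have "norm ((LINT x|lborel. F (u s x) * schrodinger \<tau> (bump R) x) - (LINT x|lborel. F (V s x) * bump R x)) \<le> ?g + ?c * x" .
  then have "ennreal (norm ((LINT x|lborel. F (u s x) * schrodinger \<tau> (bump R) x) - (LINT x|lborel. F (V s x) * bump R x))) \<le> ennreal (?g + ?c * x)"
    by (rule ennreal_leI)
  also have "\<dots> = ennreal ?g + ennreal ?c * ennreal x"
  proof -
    have "?g \<ge> 0" using nonneg_consts Cb(1) \<epsilon> \<kappa> s(2) by (intro add_nonneg_nonneg) auto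
    moreover have "?c \<ge> 0" using C(1) \<kappa> s(2) by (intro add_nonneg_nonneg) auto
    ultimately show ?thesis using x(2) by (simp only: ennreal_mult ennreal_plus mult_nonneg_nonneg)
  qed
  finally show ?thesis unfolding x(1) .
qed

lemma V_pairing_measurable [measurable]: "(\<lambda>s. LINT x|lborel. F (V s x) * bump R x) \<in> borel_measurable borel"
  by measurable

lemma V_pairing_bound:
  assumes "R > 0" "s \<ge> R"
  shows "norm (LINT x|lborel. F (V s x) * bump R x) \<le> (FA\<^sup>2 * mass_q / (4 * R\<^sup>2) + bump_mass) / 2"
proof -
  have n: "nsq (\<lambda>y. F (V s y)) \<le> ennreal (FA\<^sup>2 * (mass_q / (4 * R\<^sup>2)))"
  proof -
    have "nsq (\<lambda>y. F (V s y)) \<le> ennreal (FA\<^sup>2) * pmass q (V s)" by (rule nsq_F_le) simp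
    also have "\<dots> \<le> ennreal (FA\<^sup>2) * ennreal (mass_q / (4 * R\<^sup>2))" by (intro mult_left_mono pmass_V_le assms) auto
    also have "\<dots> = ennreal (FA\<^sup>2 * (mass_q / (4 * R\<^sup>2)))" using nonneg_consts by (simp add: ennreal_mult[symmetric])
    finally show ?thesis .
  qed
  have "norm (LINT x|lborel. F (V s x) * bump R x) \<le> 1 * max 0 (FA\<^sup>2 * (mass_q / (4 * R\<^sup>2))) / 2 + max 0 bump_mass / (2 * 1)"
    by (rule pairing_Young[OF _ _ n]) (use nsq_bump_eq[OF assms(1)] in auto)
  then show ?thesis using nonneg_consts by (simp add: max_def add_divide_distrib)
qed

lemma tail_mult_tendsto: "((\<lambda>R. R * enn2real (tail R)) \<longlongrightarrow> 0) at_top"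
proof -
  have "((\<lambda>t. enn2real (ennreal t * tail t)) \<longlongrightarrow> enn2real 0) at_top"
    using convq unfolding tail_def[symmetric] by (intro tendsto_enn2real) auto
  moreover have "\<forall>\<^sub>F t in at_top. enn2real (ennreal t * tail t) = t * enn2real (tail t)"
    using eventually_ge_at_top[of 0] by eventually_elim (simp add: enn2real_mult)
  ultimately have "((\<lambda>R. R * enn2real (tail R)) \<longlongrightarrow> enn2real 0) at_top"
    by (rule Lim_transform_eventually)
  then show ?thesis by simp
qed

text \<open>Over the window \<open>[R, 3R]\<close> the mismatch between the true nonlinear term and the one
  of the profile is negligible: the two Young parameters \<open>\<kappa>\<close> and \<open>\<epsilon>\<close> are fixed before \<open>R\<close> is sent to infinity.\<close>

lemma duhamel_integral_close:
  assumes \<eta>: "\<eta> > 0"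
  shows "\<forall>\<^sub>F R in at_top. \<forall>t1 t2. R \<le> t1 \<longrightarrow> t1 \<le> t2 \<longrightarrow> t2 \<le> 3 * R \<longrightarrow>
    norm ((LINT s|lebesgue. indicator {t1<..<t2} s *\<^sub>R (LINT x|lborel. F (u s x) * schrodinger (t2 - s) (bump R) x))
        - (LINT s|lborel. indicator {t1<..<t2} s *\<^sub>R (LINT x|lborel. F (V s x) * bump R x))) \<le> \<eta>"
proof -
  obtain Cb where Cb: "Cb \<ge> 0" "\<And>R \<tau>. R > 0 \<Longrightarrow> nsq (\<lambda>x::'a. schrodinger \<tau> (bump R) x - bump R x) \<le> ennreal (Cb * \<tau>\<^sup>2 / R ^ 4)"
    by (rule nsq_schrodinger_bump_diff, rule that, assumption, blast)
  \<comment> \<open>\<open>\<kappa>\<close> and \<open>\<epsilon>\<close> are chosen so that each of the two terms that do not decay in \<open>R\<close> is at most \<open>\<eta>/4\<close>\<close>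
  define \<kappa> where "\<kappa> = 4 * bump_mass / \<eta>"
  have \<kappa>: "\<kappa> > 0" using nonneg_consts \<eta> by (simp add: \<kappa>_def)
  define \<epsilon> where "\<epsilon> = \<eta> / (\<kappa> * (mass_q + 1))"
  have \<epsilon>: "\<epsilon> > 0" using \<kappa> \<eta> nonneg_consts by (simp add: \<epsilon>_def)
  obtain C where C: "C \<ge> 0" "\<And>a b. (norm (F a - F b))\<^sup>2 \<le> \<epsilon> * norm b powr (2 * p) + C * norm (a - b) powr (2 * p)"
    using homogeneous_continuity_estimate[OF F_cont p_pos F_hom F_bound FA_nonneg \<epsilon>] by metis
  define g where "g R = FA\<^sup>2 * 2 powr q * mass_q / (8 * R\<^sup>2) + 2 * Cb / R\<^sup>2 + \<kappa> * \<epsilon> * mass_q / (8 * R) + bump_mass / (2 * \<kappa> * R)" for R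
  define c where "c R = FA\<^sup>2 * 2 powr q / 2 + \<kappa> * C * R / 2 + 1" for R
  define D where "D = FA\<^sup>2 * 2 powr q / 2 + \<kappa> * C / 2 + 1"
  define e where "e R = R * enn2real (tail R)" for R
  have small1: "\<kappa> * \<epsilon> * mass_q / 4 \<le> \<eta> / 4"
  proof -
    have "\<kappa> * \<epsilon> * mass_q = \<eta> * (mass_q / (mass_q + 1))" using \<kappa> by (simp add: \<epsilon>_def)
    also have "\<dots> \<le> \<eta> * 1" using \<eta> nonneg_consts by (intro mult_left_mono) auto
    finally show ?thesis by simp
  qed
  have small2: "bump_mass / \<kappa> = \<eta> / 4" using \<eta> nonneg_consts by (simp add: \<kappa>_def)
  have e0: "(e \<longlongrightarrow> 0) at_top" unfolding e_def by (rule tail_mult_tendsto)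
  have i0: "((\<lambda>R. inverse R) \<longlongrightarrow> 0) (at_top :: real filter)" by (rule tendsto_inverse_0_at_top) (rule filterlim_ident)
  have "((\<lambda>R. (FA\<^sup>2 * 2 powr q * mass_q / 4 + 4 * Cb) * inverse R + D * e R) \<longlongrightarrow> (FA\<^sup>2 * 2 powr q * mass_q / 4 + 4 * Cb) * 0 + D * 0) at_top"
    by (intro tendsto_intros e0 i0)
  then have "\<forall>\<^sub>F R in at_top. (FA\<^sup>2 * 2 powr q * mass_q / 4 + 4 * Cb) * inverse R + D * e R < \<eta> / 2"
    using \<eta> by (intro order_tendstoD(2)) auto
  then show ?thesis using eventually_ge_at_top[of 1] eventually_ge_at_top[of T] tail_finite
  proof eventually_elim
    case (elim R)
    then have R: "R > 0" by simp
    have c0: "c R > 0" "g R \<ge> 0"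
      using C(1) \<kappa> \<epsilon> Cb(1) R nonneg_consts by (auto simp: c_def g_def intro!: add_nonneg_pos add_nonneg_nonneg)
    show ?case
    proof (intro allI impI)
      fix t1 t2 assume t: "R \<le> t1" "t1 \<le> t2" "t2 \<le> 3 * R"
      let ?A = "\<lambda>s. LINT x|lborel. F (u s x) * schrodinger (t2 - s) (bump R) x"
      let ?B = "\<lambda>s. LINT x|lborel. F (V s x) * bump R x"
      let ?i = "\<lambda>s. indicator {t1<..<t2} s :: real"
      have iA: "integrable lebesgue (\<lambda>s. ?i s *\<^sub>R ?A s)"
        using duhamel_int[OF _ t(2) bump_schwartz[OF R]] t(1) elim by simp
      have mB: "(\<lambda>s. ?i s *\<^sub>R ?B s) \<in> borel_measurable lborel" by measurable
      have iB: "integrable lborel (\<lambda>s. ?i s *\<^sub>R ?B s)"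
      proof (rule Bochner_Integration.integrable_bound[OF _ mB])
        let ?K = "(FA\<^sup>2 * mass_q / (4 * R\<^sup>2) + bump_mass) / 2"
        show "integrable lborel (\<lambda>s. ?K * indicator {t1..t2} s)" by simp
        show "AE s in lborel. norm (?i s *\<^sub>R ?B s) \<le> norm (?K * indicator {t1..t2} s)"
          using V_pairing_bound[OF R] t(1) by (intro AE_I2) (auto simp: indicator_def intro: order_trans[OF _ abs_ge_self])
      qed
      have iB': "integrable lebesgue (\<lambda>s. ?i s *\<^sub>R ?B s)" and eB: "(LINT s|lebesgue. ?i s *\<^sub>R ?B s) = (LINT s|lborel. ?i s *\<^sub>R ?B s)"
        using iB mB by (simp_all add: integrable_completion integral_completion)
      define G where "G s = ?i s *\<^sub>R (?A s - ?B s)" for s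
      have iG: "integrable lebesgue G"
        using Bochner_Integration.integrable_diff[OF iA iB'] by (simp add: scaleR_diff_right G_def[abs_def])
      have Gm: "G \<in> borel_measurable lebesgue" by (rule borel_measurable_integrable[OF iG])
      have "(LINT s|lebesgue. ?i s *\<^sub>R ?A s) - (LINT s|lborel. ?i s *\<^sub>R ?B s) = (LINT s|lebesgue. G s)"
        unfolding eB[symmetric] G_def scaleR_diff_right by (rule Bochner_Integration.integral_diff[OF iA iB', symmetric])
      also have "ennreal (norm \<dots>) \<le> (\<integral>\<^sup>+ s. ennreal (norm (G s)) \<partial>lebesgue)" by (rule integral_norm_bound_ennreal[OF iG])
      also have "\<dots> \<le> (\<integral>\<^sup>+ s. ennreal (g R) * indicator {t1<..<t2} s \<partial>lebesgue) + ennreal (c R) * (\<integral>\<^sup>+ s. pmass q (\<lambda>x. u s x - V s x) * indicator {R..} s \<partial>lebesgue)"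
      proof (rule nn_integral_le_nonmeasurable)
        show "(\<lambda>s. ennreal (norm (G s))) \<in> borel_measurable lebesgue" using Gm by simp
        show "(\<lambda>s. ennreal (g R) * indicator {t1<..<t2} s) \<in> borel_measurable lebesgue" by (intro measurable_completion) simp
        show "ennreal (norm (G s)) \<le> ennreal (g R) * indicator {t1<..<t2} s + ennreal (c R) * (pmass q (\<lambda>x. u s x - V s x) * indicator {R..} s)" for s
        proof (cases "s \<in> {t1<..<t2}")
          case True
          have "ennreal (norm (?A s - ?B s)) \<le> ennreal (g R) + ennreal (c R) * pmass q (\<lambda>x. u s x - V s x)"
            unfolding g_def c_def
            by (rule duhamel_integrand_bound[OF Cb C \<epsilon> \<kappa>]) (use True t elim R in auto)
          moreover have "?i s = 1" using True by simp
          then have "G s = ?A s - ?B s" unfolding G_def by (simp only: scaleR_one)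
          moreover have "indicator {t1<..<t2} s = (1 :: ennreal)" "indicator {R..} s = (1 :: ennreal)"
            using True t by (simp_all add: indicator_def)
          ultimately show ?thesis by (simp only: mult_1_right)
        next
          case False
          then have "?i s = 0" by simp
          then have "G s = 0" unfolding G_def by (simp only: scaleR_zero_left)
          then show ?thesis by (simp only: norm_zero ennreal_0 zero_le)
        qed
        show "ennreal (g R) * indicator {t1<..<t2} s < top" for s :: real by (simp add: indicator_def)
      qed (rule c0)
      also have "\<dots> = ennreal (g R * (t2 - t1)) + ennreal (c R) * tail R"
        using t c0 by (simp add: nn_integral_completion tail_def nn_integral_cmult_indicator ennreal_mult)
      also have "\<dots> = ennreal (g R * (t2 - t1) + c R * enn2real (tail R))"
        using t c0 elim by (simp add: ennreal_mult)
      finally have "norm ((LINT s|lebesgue. ?i s *\<^sub>R ?A s) - (LINT s|lborel. ?i s *\<^sub>R ?B s)) \<le> g R * (t2 - t1) + c R * enn2real (tail R)"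
        using t c0 by (subst (asm) ennreal_le_iff) (auto intro!: add_nonneg_nonneg mult_nonneg_nonneg)
      also have "\<dots> \<le> g R * (2 * R) + D * e R"
      proof (rule add_mono)
        show "g R * (t2 - t1) \<le> g R * (2 * R)" using t c0 by (intro mult_left_mono) auto
        have "c R \<le> D * R"
        proof -
          have "(FA\<^sup>2 * 2 powr q / 2 + 1) * 1 \<le> (FA\<^sup>2 * 2 powr q / 2 + 1) * R" using elim by (intro mult_left_mono) auto
          then show ?thesis by (simp add: c_def D_def distrib_right)
        qed
        then show "c R * enn2real (tail R) \<le> D * e R" unfolding e_def mult.assoc[symmetric] by (intro mult_right_mono) auto
      qed
      also have "g R * (2 * R) = (FA\<^sup>2 * 2 powr q * mass_q / 4 + 4 * Cb) * inverse R + \<kappa> * \<epsilon> * mass_q / 4 + bump_mass / \<kappa>"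
        using R \<kappa> by (simp add: g_def field_simps power2_eq_square)
      finally show "norm ((LINT s|lebesgue. ?i s *\<^sub>R ?A s) - (LINT s|lborel. ?i s *\<^sub>R ?B s)) \<le> \<eta>"
        using elim(1) small1 small2 by linarith
    qed
  qed
qed

lemma u_mass_bounded: "\<forall>\<^sub>F t in at_top. \<forall>s\<ge>t. s \<ge> T \<longrightarrow> nsq (u s) \<le> ennreal (2 + 2 * mass_2)"
proof -
  have "\<forall>\<^sub>F t in at_top. nsq (\<lambda>x. u t x - V t x) < 1 \<and> t > 0"
    using order_tendstoD(2)[OF conv2, of 1] eventually_gt_at_top[of 0] by (intro eventually_conj) auto
  then obtain N where N: "\<And>t. t \<ge> N \<Longrightarrow> nsq (\<lambda>x. u t x - V t x) < 1 \<and> t > 0"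
    unfolding eventually_at_top_linorder by blast
  have "nsq (u s) \<le> ennreal (2 + 2 * mass_2)" if s: "s \<ge> N" "s \<ge> T" for s
  proof -
    note [measurable] = um[OF s(2)]
    have "nsq (u s) = nsq (\<lambda>x. (u s x - V s x) + V s x)" by simp
    also have "\<dots> \<le> 2 * nsq (\<lambda>x. u s x - V s x) + 2 * nsq (V s)" by (intro nsq_add_le) auto
    also have "\<dots> \<le> 2 * 1 + 2 * ennreal mass_2" using N[OF s(1)] by (intro add_mono mult_left_mono) (auto simp: nsq_V)
    also have "\<dots> = ennreal (2 + 2 * mass_2)" using nonneg_consts by (simp add: ennreal_mult)
    finally show ?thesis .
  qed
  then show ?thesis unfolding eventually_at_top_linorder by (meson order_trans)
qed

text \<open>The weights in Young's inequality are \<open>1/R\<close> for the error of the free evolution, against the bounded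
  mass of \<open>u\<close>, and \<open>1/\<delta>\<close> for \<open>u - V\<close>, whose mass tends to zero.\<close>

lemma linear_pairing_close:
  assumes \<eta>: "\<eta> > 0"
  shows "\<forall>\<^sub>F R in at_top. \<forall>t \<tau>. R \<le> t \<longrightarrow> \<bar>\<tau>\<bar> \<le> 2 * R \<longrightarrow>
    norm ((LINT x|lborel. u t x * schrodinger \<tau> (bump R) x) - (LINT x|lborel. V t x * bump R x)) \<le> \<eta> \<and>
    norm ((LINT x|lborel. u t x * bump R x) - (LINT x|lborel. V t x * bump R x)) \<le> \<eta>"
proof -
  obtain Cb where Cb: "Cb \<ge> 0" "\<And>R \<tau>. R > 0 \<Longrightarrow> nsq (\<lambda>x::'a. schrodinger \<tau> (bump R) x - bump R x) \<le> ennreal (Cb * \<tau>\<^sup>2 / R ^ 4)"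
    by (rule nsq_schrodinger_bump_diff, rule that, assumption, blast)
  define \<delta> where "\<delta> = \<eta> / (2 * bump_mass)"
  have \<delta>: "\<delta> > 0" using \<eta> nonneg_consts by (simp add: \<delta>_def)
  have \<delta>b: "\<delta> * bump_mass / 2 = \<eta> / 4" using nonneg_consts by (simp add: \<delta>_def)
  define M where "M = 2 + 2 * mass_2"
  have M: "M \<ge> 0" using nonneg_consts by (simp add: M_def)
  have i0: "((\<lambda>R. inverse R) \<longlongrightarrow> 0) (at_top :: real filter)" by (rule tendsto_inverse_0_at_top) (rule filterlim_ident)
  have "((\<lambda>R. (M / 2 + 2 * Cb) * inverse R) \<longlongrightarrow> (M / 2 + 2 * Cb) * 0) at_top" by (intro tendsto_intros i0)
  then have ev1: "\<forall>\<^sub>F R in at_top. (M / 2 + 2 * Cb) * inverse R < \<eta> / 2" using \<eta> by (intro order_tendstoD(2)) auto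
  have ev2: "\<forall>\<^sub>F R in at_top. \<forall>t\<ge>R. nsq (\<lambda>x. u t x - V t x) \<le> ennreal (\<eta> * \<delta> / 2)"
  proof -
    have "\<forall>\<^sub>F t in at_top. nsq (\<lambda>x. u t x - V t x) < ennreal (\<eta> * \<delta> / 2)"
      using order_tendstoD(2)[OF conv2] \<eta> \<delta> by simp
    then obtain N where "\<And>t. t \<ge> N \<Longrightarrow> nsq (\<lambda>x. u t x - V t x) < ennreal (\<eta> * \<delta> / 2)"
      unfolding eventually_at_top_linorder by blast
    then show ?thesis unfolding eventually_at_top_linorder by (meson order_trans less_imp_le)
  qed
  from ev1 ev2 u_mass_bounded eventually_ge_at_top[of 1] eventually_ge_at_top[of T] show ?thesis
  proof eventually_elim
    case (elim R)
    then have R: "R > 0" by simp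
    show ?case
    proof (intro allI impI)
      fix t \<tau> assume t: "R \<le> t" and \<tau>: "\<bar>\<tau>\<bar> \<le> 2 * R"
      have tT: "t \<ge> T" "t > 0" using t elim by auto
      note [measurable] = um[OF tT(1)]
      have [measurable]: "schrodinger \<tau> (bump R :: 'a \<Rightarrow> complex) \<in> borel_measurable borel" by simp
      have nu: "nsq (u t) \<le> ennreal M" using elim t tT by (simp add: M_def)
      have nb: "nsq (\<lambda>y::'a. schrodinger \<tau> (bump R) y - bump R y) \<le> ennreal (4 * Cb / R\<^sup>2)"
      by (rule bump_window[OF Cb R \<tau>])
      have nd: "nsq (\<lambda>x. u t x - V t x) \<le> ennreal (\<eta> * \<delta> / 2)" using elim t by blast
      have fin: "nsq (u t) < top" "nsq (\<lambda>y::'a. schrodinger \<tau> (bump R) y - bump R y) < top"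
        "nsq (bump R :: 'a \<Rightarrow> complex) < top" "nsq (V t) < top"
        using nu nb nsq_bump_eq[OF R] nsq_V[OF tT(2)] by (auto intro: order_le_less_trans)
      have i1: "integrable lborel (\<lambda>y. u t y * (schrodinger \<tau> (bump R) y - bump R y))"
        by (intro integrable_mult_nsq(1) fin) auto
      have i2: "integrable lborel (\<lambda>y. u t y * bump R y)" by (intro integrable_mult_nsq(1) fin) auto
      have i3: "integrable lborel (\<lambda>y. V t y * bump R y)" by (intro integrable_mult_nsq(1) fin) auto
      have e1: "(LINT x|lborel. u t x * bump R x) - (LINT x|lborel. V t x * bump R x) = (LINT x|lborel. (u t x - V t x) * bump R x)"
        using i2 i3 by (simp add: left_diff_distrib)
      have b1: "norm (LINT x|lborel. (u t x - V t x) * bump R x) \<le> \<eta> / 2"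
      proof -
        have "norm (LINT x|lborel. (u t x - V t x) * bump R x) \<le> (1 / \<delta>) * max 0 (\<eta> * \<delta> / 2) / 2 + max 0 bump_mass / (2 * (1 / \<delta>))"
          by (rule pairing_Young[OF _ _ nd]) (use nsq_bump_eq[OF R] \<delta> in auto)
        also have "\<dots> = \<eta> / 4 + \<delta> * bump_mass / 2" using \<delta> \<eta> nonneg_consts by (simp add: max_def)
        finally show ?thesis using \<delta>b by simp
      qed
      have e2: "(LINT x|lborel. u t x * schrodinger \<tau> (bump R) x) = (LINT y|lborel. u t y * (schrodinger \<tau> (bump R) y - bump R y)) + (LINT y|lborel. u t y * bump R y)"
        by (subst Bochner_Integration.integral_add[OF i1 i2, symmetric]) (simp add: right_diff_distrib)
      have b2: "norm (LINT y|lborel. u t y * (schrodinger \<tau> (bump R) y - bump R y)) \<le> \<eta> / 2"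
      proof -
        have "norm (LINT y|lborel. u t y * (schrodinger \<tau> (bump R) y - bump R y)) \<le> (1 / R) * max 0 M / 2 + max 0 (4 * Cb / R\<^sup>2) / (2 * (1 / R))"
          by (rule pairing_Young[OF _ _ nu nb]) (use R in auto)
        also have "\<dots> = (M / 2 + 2 * Cb) * inverse R" using R M Cb(1) by (simp add: max_def field_simps power2_eq_square)
        finally show ?thesis using elim by linarith
      qed
      have "(LINT x|lborel. u t x * schrodinger \<tau> (bump R) x) - (LINT x|lborel. V t x * bump R x) =
         (LINT y|lborel. u t y * (schrodinger \<tau> (bump R) y - bump R y)) + (LINT x|lborel. (u t x - V t x) * bump R x)"
        unfolding e2 e1[symmetric] by (rule add_diff_eq[symmetric])
      then have "norm ((LINT x|lborel. u t x * schrodinger \<tau> (bump R) x) - (LINT x|lborel. V t x * bump R x)) \<le>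
         norm (LINT y|lborel. u t y * (schrodinger \<tau> (bump R) y - bump R y)) + norm (LINT x|lborel. (u t x - V t x) * bump R x)"
        by (simp only: norm_triangle_ineq)
      then show "norm ((LINT x|lborel. u t x * schrodinger \<tau> (bump R) x) - (LINT x|lborel. V t x * bump R x)) \<le> \<eta> \<and>
        norm ((LINT x|lborel. u t x * bump R x) - (LINT x|lborel. V t x * bump R x)) \<le> \<eta>"
        unfolding e1 using b1 b2 \<eta> by linarith
    qed
  qed
qed

lemma duhamel_perturbation:
  fixes u1 u2 v1 v2 N M :: complex
  assumes "u2 = u1 - \<i> * N" "norm (u2 - v2) \<le> e" "norm (u1 - v1) \<le> e" "norm (N - M) \<le> e"
  shows "norm (v2 - v1 + \<i> * M) \<le> 3 * e"
proof -
  have eq: "v2 - v1 + \<i> * M = - (u2 - v2) + (u1 - v1) - \<i> * (N - M)"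
    unfolding assms(1) by (simp add: algebra_simps)
  show ?thesis
    unfolding eq using norm_triangle_ineq4[of "- (u2 - v2) + (u1 - v1)" "\<i> * (N - M)"] norm_triangle_ineq[of "- (u2 - v2)" "u1 - v1"] assms(2-4)
    unfolding norm_mult norm_minus_cancel norm_ii mult_1 by linarith
qed

text \<open>Duhamel's formula for \<open>u\<close>, tested with the Gaussian, holds for \<open>V\<close> up to \<open>o(1)\<close> and without the
  free group.\<close>

lemma profile_almost_solves:
  assumes \<eta>: "\<eta> > 0"
  shows "\<forall>\<^sub>F R in at_top. \<forall>t1 t2. R \<le> t1 \<longrightarrow> t1 \<le> t2 \<longrightarrow> t2 \<le> 3 * R \<longrightarrow>
    norm ((LINT x|lborel. V t2 x * bump R x) - (LINT x|lborel. V t1 x * bump R x)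
      + \<i> * (LINT s|lborel. indicator {t1<..<t2} s *\<^sub>R (LINT x|lborel. F (V s x) * bump R x))) \<le> \<eta>"
proof -
  have "\<eta> / 3 > 0" using \<eta> by simp
  from linear_pairing_close[OF this] duhamel_integral_close[OF this] eventually_ge_at_top[of 1] eventually_ge_at_top[of T]
  show ?thesis
  proof eventually_elim
    case (elim R)
    show ?case
    proof (intro allI impI)
      fix t1 t2 assume t: "R \<le> t1" "t1 \<le> t2" "t2 \<le> 3 * R"
      let ?N = "LINT s|lebesgue. indicator {t1<..<t2} s *\<^sub>R (LINT x|lborel. F (u s x) * schrodinger (t2 - s) (bump R) x)"
      let ?NV = "LINT s|lborel. indicator {t1<..<t2} s *\<^sub>R (LINT x|lborel. F (V s x) * bump R x)"
      let ?u2 = "LINT x|lborel. u t2 x * bump R x" and ?v2 = "LINT x|lborel. V t2 x * bump R x"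
      let ?u1 = "LINT x|lborel. u t1 x * schrodinger (t2 - t1) (bump R) x" and ?v1 = "LINT x|lborel. V t1 x * bump R x"
      have D: "?u2 = ?u1 - \<i> * ?N"
        using duhamel[OF _ t(2) bump_schwartz] elim t by simp
      have a: "norm (?u2 - ?v2) \<le> \<eta> / 3" using elim(1)[rule_format, of t2 0] elim(3) t by auto
      have b: "norm (?u1 - ?v1) \<le> \<eta> / 3" using elim(1)[rule_format, of t1 "t2 - t1"] elim(3) t by auto
      have c: "norm (?N - ?NV) \<le> \<eta> / 3" using elim(2) t by blast
      show "norm (?v2 - ?v1 + \<i> * ?NV) \<le> \<eta>"
        using duhamel_perturbation[OF D a b c] by simp
    qed
  qed
qed

subsection \<open>The resonant mode\<close>

text \<open>The pairing \<open>lin\<close> is the boundary term of Duhamel's formula at time \<open>n\<sigma>\<close>, and \<open>nonlin\<close> is its integrand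
  after the substitution \<open>s = n\<sigma>\<close>; the factor \<open>n\<close> is the Jacobian. In the limit only \<open>resonance\<close> survives, the
  contribution of the mode \<open>|V|\<^sup>p\<close>.\<close>

definition lin :: "nat \<Rightarrow> real \<Rightarrow> complex" where
  "lin n \<sigma> = (LINT x|lborel. V (real n * \<sigma>) x * bump (real n) x)"

definition nonlin :: "nat \<Rightarrow> real \<Rightarrow> complex" where
  "nonlin n \<sigma> = of_nat n * (LINT x|lborel. F (V (real n * \<sigma>) x) * bump (real n) x)"

definition resonance :: "real \<Rightarrow> real \<Rightarrow> complex" where
  "resonance \<alpha> \<beta> = (LINT y|lborel. of_real (norm (W y) powr p) *
     (LINT \<sigma>|lborel. indicator {\<alpha>..\<beta>} \<sigma> * complex_of_real ((2 * \<sigma>) powr (real DIM('a) / 2 - 1) * exp (- 4 * \<sigma>\<^sup>2 * (norm y)\<^sup>2))))"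

lemma lin_measurable [measurable]: "lin n \<in> borel_measurable borel"
  unfolding lin_def by measurable

lemma gaussian_square_integrable:
  assumes "a > 0"
  shows "nsq (\<lambda>y::'a. complex_of_real (exp (- a * (norm y)\<^sup>2))) < top"
proof -
  have "wave_packet a (0::'a) = (\<lambda>y. complex_of_real (exp (- a * (norm y)\<^sup>2)))"
    by (simp add: wave_packet_def fun_eq_iff)
  then show ?thesis using schwartz_nsq[OF wave_packet_schwartz[OF assms, of "0::'a"]] by simp
qed

lemma W_gaussian_integrable:
  assumes "a > 0"
  shows "integrable lborel (\<lambda>y. norm (W y) * exp (- a * (norm y)\<^sup>2))"
    and "integrable lborel (\<lambda>y. norm (W y) powr p * exp (- a * (norm y)\<^sup>2))"
proof -
  have "integrable lborel (\<lambda>y. W y * complex_of_real (exp (- a * (norm y)\<^sup>2)))"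
    by (intro integrable_mult_nsq(1) W2 gaussian_square_integrable assms) auto
  from integrable_norm[OF this] show "integrable lborel (\<lambda>y. norm (W y) * exp (- a * (norm y)\<^sup>2))"
    by (simp add: norm_mult)
  have "nsq (\<lambda>y. complex_of_real (norm (W y) powr p)) = pmass q W"
    unfolding nsq_def pmass_def
    by (intro nn_integral_cong) (simp add: q_def power2_eq_square powr_add[symmetric])
  then have "integrable lborel (\<lambda>y. complex_of_real (norm (W y) powr p) * complex_of_real (exp (- a * (norm y)\<^sup>2)))"
    by (intro integrable_mult_nsq(1) gaussian_square_integrable assms) (auto simp: pmass_W)
  from integrable_norm[OF this] show "integrable lborel (\<lambda>y. norm (W y) powr p * exp (- a * (norm y)\<^sup>2))"
    by (simp add: norm_mult)
qed

lemma gaussian_mono: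
  assumes "\<alpha> \<ge> 1" "\<sigma> \<ge> \<alpha>"
  shows "exp (- 4 * \<sigma>\<^sup>2 * (norm (y::'a))\<^sup>2) \<le> exp (- 4 * (norm y)\<^sup>2)"
proof -
  have "1 \<le> \<sigma>\<^sup>2" using assms by (simp add: one_le_power)
  then have "1 * (norm y)\<^sup>2 \<le> \<sigma>\<^sup>2 * (norm y)\<^sup>2" by (intro mult_right_mono) auto
  then show ?thesis by simp
qed

text \<open>The identity is a nonlinearity with the single mode \<open>n = 1\<close>, so the boundary terms have no
  constant mode.\<close>

lemma lin_average_tendsto:
  assumes "\<alpha> \<ge> 1"
  shows "(\<lambda>n. LINT \<sigma>|lborel. indicator {\<alpha>..\<beta>} \<sigma> * lin n \<sigma>) \<longlonglongrightarrow> 0"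
proof -
  let ?a = "\<lambda>(j::int) (z::complex). if j = 1 then z else 0"
  let ?w = "\<lambda>\<sigma>::real. (2 * \<sigma>) powr (real DIM('a) / 2)"
  have "(\<lambda>n. LINT \<sigma>|lborel. indicator {\<alpha>..\<beta>} \<sigma> * (complex_of_real (?w \<sigma>) *
      (LINT y|lborel. (\<lambda>z. z) (cis (profile_phase lam W (real n * \<sigma>) y) * W y) * of_real (exp (- 4 * \<sigma>\<^sup>2 * (norm y)\<^sup>2)))))
    \<longlonglongrightarrow> (LINT y|lborel. ?a 0 (W y) * (LINT \<sigma>|lborel. indicator {\<alpha>..\<beta>} \<sigma> * complex_of_real (?w \<sigma> * exp (- 4 * \<sigma>\<^sup>2 * (norm y)\<^sup>2))))"
  proof (rule oscillating_pairing_tendsto[where g="\<lambda>y. norm (W y) * exp (- 4 * (norm y)\<^sup>2)"])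
    have fin: "(f has_sum f 1) UNIV" if "\<And>j. j \<noteq> 1 \<Longrightarrow> f j = 0" for f :: "int \<Rightarrow> 'c::{comm_monoid_add,topological_space}"
      using has_sum_finite_neutralI[of "{1}" UNIV f] that by fastforce
    show "(\<lambda>j. norm (?a j z)) summable_on UNIV" for z
      using fin[of "\<lambda>j. norm (?a j z)"] by (auto simp: summable_on_def)
    show "((\<lambda>j. ?a j z * cis (of_int j * \<theta>)) has_sum cis \<theta> * z) UNIV" for z \<theta>
      using fin[of "\<lambda>j. ?a j z * cis (of_int j * \<theta>)"] by (simp add: mult.commute)
    show "integrable lborel (\<lambda>y. norm (W y) * exp (- 4 * (norm y)\<^sup>2))" by (rule W_gaussian_integrable) simp
    show "norm (cis \<theta> * W y) * exp (- 4 * \<sigma>\<^sup>2 * (norm y)\<^sup>2) \<le> norm (W y) * exp (- 4 * (norm y)\<^sup>2)" if "\<sigma> \<ge> \<alpha>" for y \<theta> \<sigma>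
      unfolding norm_mult norm_cis mult_1 by (intro mult_left_mono gaussian_mono[OF assms that]) auto
    show "continuous_on {\<alpha>..\<beta>} ?w" using assms by (intro continuous_intros) auto
  qed (use assms in auto)
  then have l: "(\<lambda>n. LINT \<sigma>|lborel. indicator {\<alpha>..\<beta>} \<sigma> * (complex_of_real (?w \<sigma>) *
      (LINT y|lborel. (cis (profile_phase lam W (real n * \<sigma>) y) * W y) * of_real (exp (- 4 * \<sigma>\<^sup>2 * (norm y)\<^sup>2))))) \<longlonglongrightarrow> 0"
    by simp
  have e: "indicator {\<alpha>..\<beta>} \<sigma> * (complex_of_real (?w \<sigma>) *
      (LINT y|lborel. (cis (profile_phase lam W (real n * \<sigma>) y) * W y) * of_real (exp (- 4 * \<sigma>\<^sup>2 * (norm y)\<^sup>2)))) = indicator {\<alpha>..\<beta>} \<sigma> * lin n \<sigma>" if n: "n \<ge> 1" for n \<sigma>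
  proof (cases "\<sigma> \<in> {\<alpha>..\<beta>}")
    case True
    then have \<sigma>: "\<sigma> > 0" "real n > 0" using assms n by auto
    have "(2 * (real n * \<sigma>)) powr (real DIM('a) - 1 * (real DIM('a) / 2)) * real n powr (- (real DIM('a) / 2)) = ?w \<sigma>"
    proof -
      have "2 * (real n * \<sigma>) = (2 * \<sigma>) * real n" by simp
      then have "(2 * (real n * \<sigma>)) powr (real DIM('a) / 2) = ?w \<sigma> * real n powr (real DIM('a) / 2)"
        by (simp only: powr_mult)
      then show ?thesis using \<sigma> by (simp add: powr_minus)
    qed
    then show ?thesis
      using pairing_profile_bump[OF Wm, of "\<lambda>z. z" 1 "real n" \<sigma> lam] \<sigma> by (simp add: lin_def)
  qed simp
  show ?thesis
    by (rule Lim_transform_eventually[OF l]) (intro eventually_sequentiallyI[of 1] Bochner_Integration.integral_cong refl e)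
qed

lemma F_modes:
  "((\<lambda>j. (g j * nl_mode DIM('a) j z) * cis (of_int j * \<theta>)) has_sum F (cis \<theta> * z)) UNIV"
  using F_sum[of "cis \<theta> * z"] by (simp add: nl_mode_rotate mult.assoc)

lemma nonlin_average_tendsto:
  assumes "\<alpha> \<ge> 1"
  shows "(\<lambda>n. LINT \<sigma>|lborel. indicator {\<alpha>..\<beta>} \<sigma> * nonlin n \<sigma>) \<longlonglongrightarrow> resonance \<alpha> \<beta>"
proof -
  let ?a = "\<lambda>j z. g j * nl_mode DIM('a) j z"
  let ?w = "\<lambda>\<sigma>::real. (2 * \<sigma>) powr (real DIM('a) / 2 - 1)"
  have l: "(\<lambda>n. LINT \<sigma>|lborel. indicator {\<alpha>..\<beta>} \<sigma> * (complex_of_real (?w \<sigma>) *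
      (LINT y|lborel. F (cis (profile_phase lam W (real n * \<sigma>) y) * W y) * of_real (exp (- 4 * \<sigma>\<^sup>2 * (norm y)\<^sup>2)))))
    \<longlonglongrightarrow> (LINT y|lborel. ?a 0 (W y) * (LINT \<sigma>|lborel. indicator {\<alpha>..\<beta>} \<sigma> * complex_of_real (?w \<sigma> * exp (- 4 * \<sigma>\<^sup>2 * (norm y)\<^sup>2))))"
  proof (rule oscillating_pairing_tendsto[where g="\<lambda>y. FA * (norm (W y) powr p * exp (- 4 * (norm y)\<^sup>2))"])
    show "(\<lambda>j. norm (?a j z)) summable_on UNIV" for z
      unfolding norm_mult norm_nl_mode by (intro summable_on_cmult_left g_sum)
    show "((\<lambda>j. ?a j z * cis (of_int j * \<theta>)) has_sum F (cis \<theta> * z)) UNIV" for z \<theta> by (rule F_modes)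
    show "integrable lborel (\<lambda>y. FA * (norm (W y) powr p * exp (- 4 * (norm y)\<^sup>2)))"
      by (intro integrable_mult_right W_gaussian_integrable) simp
    show "norm (F (cis \<theta> * W y)) * exp (- 4 * \<sigma>\<^sup>2 * (norm y)\<^sup>2) \<le> FA * (norm (W y) powr p * exp (- 4 * (norm y)\<^sup>2))" if "\<sigma> \<ge> \<alpha>" for y \<theta> \<sigma>
    proof -
      have "norm (F (cis \<theta> * W y)) * exp (- 4 * \<sigma>\<^sup>2 * (norm y)\<^sup>2) \<le> (FA * norm (cis \<theta> * W y) powr p) * exp (- 4 * (norm y)\<^sup>2)"
        using FA_nonneg by (intro mult_mono F_bound gaussian_mono[OF assms that]) auto
      then show ?thesis by (simp add: norm_mult mult.assoc)
    qed
    show "continuous_on {\<alpha>..\<beta>} ?w" using assms by (intro continuous_intros) auto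
  qed (use assms in auto)
  have a0: "?a 0 z = of_real (norm z powr p)" for z
    using g0 by (simp add: nl_mode_def p_def scaleR_conv_of_real)
  have e: "indicator {\<alpha>..\<beta>} \<sigma> * (complex_of_real (?w \<sigma>) *
      (LINT y|lborel. F (cis (profile_phase lam W (real n * \<sigma>) y) * W y) * of_real (exp (- 4 * \<sigma>\<^sup>2 * (norm y)\<^sup>2)))) = indicator {\<alpha>..\<beta>} \<sigma> * nonlin n \<sigma>" if n: "n \<ge> 1" for n \<sigma>
  proof (cases "\<sigma> \<in> {\<alpha>..\<beta>}")
    case True
    then have \<sigma>: "\<sigma> > 0" "real n > 0" using assms n by auto
    have "real n * ((2 * (real n * \<sigma>)) powr (real DIM('a) - p * (real DIM('a) / 2)) * real n powr (- (real DIM('a) / 2))) = ?w \<sigma>"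
    proof -
      have x: "real DIM('a) - p * (real DIM('a) / 2) = real DIM('a) / 2 - 1"
        using d_pos by (simp add: p_def field_simps)
      have "2 * (real n * \<sigma>) = (2 * \<sigma>) * real n" by simp
      then have 1: "(2 * (real n * \<sigma>)) powr (real DIM('a) / 2 - 1) = ?w \<sigma> * real n powr (real DIM('a) / 2 - 1)"
        by (simp only: powr_mult)
      have "real n * (real n powr (real DIM('a) / 2 - 1) * real n powr (- (real DIM('a) / 2))) = real n powr (1 + ((real DIM('a) / 2 - 1) + (- (real DIM('a) / 2))))"
        unfolding powr_add using \<sigma> by simp
      also have "\<dots> = 1" using \<sigma> by simp
      finally show ?thesis unfolding x 1 by (simp add: mult_ac)
    qed
    then have c: "complex_of_real (real n) * complex_of_real ((2 * (real n * \<sigma>)) powr (real DIM('a) - p * (real DIM('a) / 2)) * real n powr (- (real DIM('a) / 2))) = complex_of_real (?w \<sigma>)"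
      by (simp only: of_real_mult[symmetric])
    define I where "I = (LINT y|lborel. F (cis (profile_phase lam W (real n * \<sigma>) y) * W y) * of_real (exp (- 4 * \<sigma>\<^sup>2 * (norm y)\<^sup>2)))"
    have "nonlin n \<sigma> = complex_of_real (real n) * (complex_of_real ((2 * (real n * \<sigma>)) powr (real DIM('a) - p * (real DIM('a) / 2)) * real n powr (- (real DIM('a) / 2))) * I)"
      unfolding nonlin_def I_def by (subst pairing_profile_bump[OF Wm Fm F_hom \<sigma>(2,1)]) (simp_all only: of_real_of_nat_eq)
    also have "\<dots> = complex_of_real (?w \<sigma>) * I"
      unfolding c[symmetric] by (rule mult.assoc[symmetric])
    finally have "nonlin n \<sigma> = complex_of_real (?w \<sigma>) * I" .
    then show ?thesis unfolding I_def by simp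
  qed simp
  show ?thesis
    using l unfolding a0 resonance_def[symmetric]
    by (rule Lim_transform_eventually) (intro eventually_sequentiallyI[of 1] Bochner_Integration.integral_cong refl e)
qed

lemma lin_bound: "n \<ge> 1 \<Longrightarrow> \<sigma> > 0 \<Longrightarrow> norm (lin n \<sigma>) \<le> (mass_2 + bump_mass) / 2"
proof -
  assume n: "n \<ge> 1" "\<sigma> > 0"
  have "norm (LINT x|lborel. V (real n * \<sigma>) x * bump (real n) x) \<le> 1 * max 0 mass_2 / 2 + max 0 bump_mass / (2 * 1)"
    by (rule pairing_Young) (use n in \<open>auto simp: nsq_V nsq_bump_eq\<close>)
  then show ?thesis using nonneg_consts by (simp add: lin_def max_def add_divide_distrib)
qed

text \<open>For \<open>\<rho> \<in> [1, 3]\<close> the weight \<open>(2\<rho>)\<^sup>d\<^sup>/\<^sup>2\<^sup>-\<^sup>1\<close> is at least \<open>(2\<rho>)\<^sup>-\<^sup>1 \<ge> 1/6\<close>, and \<open>4\<rho>\<^sup>2 \<le> 36\<close>.\<close>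

lemma resonance_lower_bound:
  assumes \<sigma>: "1 \<le> \<sigma>" "\<sigma> \<le> 2"
  shows "(1 / 6) * (LINT y|lborel. norm (W y) powr p * exp (- 36 * (norm y)\<^sup>2)) \<le> Re (resonance \<sigma> (\<sigma> + 1))"
proof -
  let ?w = "\<lambda>\<rho>::real. (2 * \<rho>) powr (real DIM('a) / 2 - 1)"
  define k where "k y = (LINT \<rho>|lborel. indicator {\<sigma>..\<sigma>+1} \<rho> * (?w \<rho> * exp (- 4 * \<rho>\<^sup>2 * (norm (y::'a))\<^sup>2)))" for y
  have cw: "continuous_on {\<sigma>..\<sigma>+1} (\<lambda>\<rho>. ?w \<rho> * exp (- 4 * \<rho>\<^sup>2 * (norm (y::'a))\<^sup>2))" for y
    using \<sigma> by (intro continuous_intros) auto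
  have ik: "integrable lborel (\<lambda>\<rho>. indicator {\<sigma>..\<sigma>+1} \<rho> * (?w \<rho> * exp (- 4 * \<rho>\<^sup>2 * (norm (y::'a))\<^sup>2)))" for y
    using borel_integrable_compact[OF _ cw] by simp
  have [measurable]: "k \<in> borel_measurable borel" unfolding k_def by measurable
  have wl: "1 / 6 \<le> ?w \<rho>" and wu: "?w \<rho> \<le> 6 powr (real DIM('a) / 2)" if "\<rho> \<in> {\<sigma>..\<sigma>+1}" for \<rho>
  proof -
    have r: "2 \<le> 2 * \<rho>" "2 * \<rho> \<le> 6" using that \<sigma> by auto
    have "1 / 6 \<le> 1 / (2 * \<rho>)" using r by (intro divide_left_mono) auto
    also have "\<dots> = (2 * \<rho>) powr (- 1)" using r by (intro powr_neg_one[symmetric]) auto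
    also have "\<dots> \<le> ?w \<rho>" using r by (intro powr_mono) auto
    finally show "1 / 6 \<le> ?w \<rho>" .
    have "?w \<rho> \<le> (2 * \<rho>) powr (real DIM('a) / 2)" using r by (intro powr_mono) auto
    also have "\<dots> \<le> 6 powr (real DIM('a) / 2)" using r by (intro powr_mono2) auto
    finally show "?w \<rho> \<le> 6 powr (real DIM('a) / 2)" .
  qed
  have one: "(LINT \<rho>|lborel. indicator {\<sigma>..\<sigma>+1} \<rho> :: real) = 1" by simp
  have kl: "(1 / 6) * exp (- 36 * (norm y)\<^sup>2) \<le> k y" for y
  proof -
    have "(1 / 6) * exp (- 36 * (norm y)\<^sup>2) = (LINT \<rho>|lborel. ((1 / 6) * exp (- 36 * (norm y)\<^sup>2)) * indicator {\<sigma>..\<sigma>+1} \<rho>)"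
      unfolding integral_mult_right_zero one by simp
    also have "\<dots> \<le> k y"
      unfolding k_def
    proof (rule integral_mono[OF _ ik])
      fix \<rho>
      show "((1 / 6) * exp (- 36 * (norm y)\<^sup>2)) * indicator {\<sigma>..\<sigma>+1} \<rho> \<le> indicator {\<sigma>..\<sigma>+1} \<rho> * (?w \<rho> * exp (- 4 * \<rho>\<^sup>2 * (norm y)\<^sup>2))"
      proof (cases "\<rho> \<in> {\<sigma>..\<sigma>+1}")
        case True
        then have "\<rho>\<^sup>2 \<le> 3\<^sup>2" using \<sigma> by (intro power_mono) auto
        then have "4 * \<rho>\<^sup>2 * (norm y)\<^sup>2 \<le> 36 * (norm y)\<^sup>2" by (intro mult_right_mono) auto
        then have "(1 / 6) * exp (- 36 * (norm y)\<^sup>2) \<le> ?w \<rho> * exp (- 4 * \<rho>\<^sup>2 * (norm y)\<^sup>2)"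
          using wl[OF True] by (intro mult_mono) auto
        then show ?thesis using True by simp
      qed simp
    qed (intro integrable_mult_right, simp)
    finally show ?thesis .
  qed
  have ku: "k y \<le> 6 powr (real DIM('a) / 2) * exp (- 4 * (norm y)\<^sup>2)" for y
  proof -
    have "k y \<le> (LINT \<rho>|lborel. (6 powr (real DIM('a) / 2) * exp (- 4 * (norm y)\<^sup>2)) * indicator {\<sigma>..\<sigma>+1} \<rho>)"
      unfolding k_def
    proof (rule integral_mono[OF ik])
      fix \<rho>
      show "indicator {\<sigma>..\<sigma>+1} \<rho> * (?w \<rho> * exp (- 4 * \<rho>\<^sup>2 * (norm y)\<^sup>2)) \<le> (6 powr (real DIM('a) / 2) * exp (- 4 * (norm y)\<^sup>2)) * indicator {\<sigma>..\<sigma>+1} \<rho>"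
      proof (cases "\<rho> \<in> {\<sigma>..\<sigma>+1}")
        case True
        then have "?w \<rho> * exp (- 4 * \<rho>\<^sup>2 * (norm y)\<^sup>2) \<le> 6 powr (real DIM('a) / 2) * exp (- 4 * (norm y)\<^sup>2)"
          using wu[OF True] \<sigma> by (intro mult_mono gaussian_mono[of \<sigma>]) auto
        then show ?thesis using True by simp
      qed simp
    qed (intro integrable_mult_right, simp)
    also have "\<dots> = 6 powr (real DIM('a) / 2) * exp (- 4 * (norm y)\<^sup>2)" unfolding integral_mult_right_zero one by simp
    finally show ?thesis .
  qed
  have "(LINT \<rho>|lborel. indicator {\<sigma>..\<sigma>+1} \<rho> * complex_of_real (?w \<rho> * exp (- 4 * \<rho>\<^sup>2 * (norm y)\<^sup>2))) = of_real (k y)" for y :: 'a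
  proof -
    have "indicator {\<sigma>..\<sigma>+1} \<rho> * complex_of_real (?w \<rho> * exp (- 4 * \<rho>\<^sup>2 * (norm y)\<^sup>2)) = complex_of_real (indicator {\<sigma>..\<sigma>+1} \<rho> * (?w \<rho> * exp (- 4 * \<rho>\<^sup>2 * (norm y)\<^sup>2)))" for \<rho>
      by (simp add: indicator_def)
    then show ?thesis unfolding k_def by (simp only: integral_complex_of_real)
  qed
  then have "resonance \<sigma> (\<sigma> + 1) = (LINT y|lborel. complex_of_real (norm (W y) powr p * k y))"
    unfolding resonance_def by (simp only: of_real_mult)
  then have R: "Re (resonance \<sigma> (\<sigma> + 1)) = (LINT y|lborel. norm (W y) powr p * k y)"
    by (simp only: integral_complex_of_real Re_complex_of_real)
  have iu: "integrable lborel (\<lambda>y. norm (W y) powr p * k y)"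
  proof (rule Bochner_Integration.integrable_bound)
    show "integrable lborel (\<lambda>y. 6 powr (real DIM('a) / 2) * (norm (W y) powr p * exp (- 4 * (norm y)\<^sup>2)))"
      by (intro integrable_mult_right W_gaussian_integrable) simp
    show "AE y in lborel. norm (norm (W y) powr p * k y) \<le> norm (6 powr (real DIM('a) / 2) * (norm (W y) powr p * exp (- 4 * (norm y)\<^sup>2)))"
    proof (intro AE_I2)
      fix y
      have "0 \<le> k y" by (rule order_trans[OF _ kl]) simp
      then have "norm (norm (W y) powr p * k y) = norm (W y) powr p * k y" by simp
      also have "\<dots> \<le> norm (W y) powr p * (6 powr (real DIM('a) / 2) * exp (- 4 * (norm y)\<^sup>2))" by (intro mult_left_mono ku) auto
      finally show "norm (norm (W y) powr p * k y) \<le> norm (6 powr (real DIM('a) / 2) * (norm (W y) powr p * exp (- 4 * (norm y)\<^sup>2)))"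
        by (simp add: mult_ac)
    qed
  qed measurable
  have "(1 / 6) * (LINT y|lborel. norm (W y) powr p * exp (- 36 * (norm y)\<^sup>2)) = (LINT y|lborel. (1 / 6) * (norm (W y) powr p * exp (- 36 * (norm y)\<^sup>2)))"
    by simp
  also have "\<dots> \<le> (LINT y|lborel. norm (W y) powr p * k y)"
  proof (rule integral_mono[OF _ iu])
    show "integrable lborel (\<lambda>y. (1 / 6) * (norm (W y) powr p * exp (- 36 * (norm y)\<^sup>2)))"
      by (intro integrable_mult_right W_gaussian_integrable) simp
    show "(1 / 6) * (norm (W y) powr p * exp (- 36 * (norm y)\<^sup>2)) \<le> norm (W y) powr p * k y" for y
      using mult_left_mono[OF kl[of y], of "norm (W y) powr p"] by (simp add: mult_ac)
  qed
  finally show ?thesis unfolding R .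
qed

lemma nonlin_rescale:
  assumes "n \<ge> 1"
  shows "(LINT s|lborel. indicator {real n * \<alpha><..<real n * \<beta>} s *\<^sub>R (LINT x|lborel. F (V s x) * bump (real n) x)) =
     (LINT \<sigma>|lborel. indicator {\<alpha>..\<beta>} \<sigma> * nonlin n \<sigma>)"
proof -
  let ?J = "\<lambda>s. LINT x|lborel. F (V s x) * bump (real n) x"
  have n: "real n > 0" using assms by simp
  have "(LINT s|lborel. indicator {real n * \<alpha><..<real n * \<beta>} s *\<^sub>R ?J s) =
    \<bar>real n\<bar> *\<^sub>R (LINT \<sigma>|lborel. indicator {real n * \<alpha><..<real n * \<beta>} (0 + real n * \<sigma>) *\<^sub>R ?J (0 + real n * \<sigma>))"
    using n by (intro lborel_integral_real_affine) auto
  also have "\<dots> = (LINT \<sigma>|lborel. real n *\<^sub>R (indicator {real n * \<alpha><..<real n * \<beta>} (0 + real n * \<sigma>) *\<^sub>R ?J (0 + real n * \<sigma>)))"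
    unfolding abs_of_nat by (rule integral_scaleR_right[symmetric])
  also have "\<dots> = (LINT \<sigma>|lborel. indicator {\<alpha>..\<beta>} \<sigma> * nonlin n \<sigma>)"
  proof (rule integral_cong_AE)
    show "(\<lambda>\<sigma>. real n *\<^sub>R (indicator {real n * \<alpha><..<real n * \<beta>} (0 + real n * \<sigma>) *\<^sub>R ?J (0 + real n * \<sigma>))) \<in> borel_measurable lborel"
      by measurable
    show "(\<lambda>\<sigma>. indicator {\<alpha>..\<beta>} \<sigma> * nonlin n \<sigma>) \<in> borel_measurable lborel"
      unfolding nonlin_def by measurable
    have "AE \<sigma> in lborel. \<sigma> \<notin> {\<alpha>, \<beta>}" by (intro AE_not_in countable_imp_null_set_lborel) auto
    then show "AE \<sigma> in lborel. real n *\<^sub>R (indicator {real n * \<alpha><..<real n * \<beta>} (0 + real n * \<sigma>) *\<^sub>R ?J (0 + real n * \<sigma>)) = indicator {\<alpha>..\<beta>} \<sigma> * nonlin n \<sigma>"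
    proof eventually_elim
      case (elim \<sigma>)
      have "0 + real n * \<sigma> \<in> {real n * \<alpha><..<real n * \<beta>} \<longleftrightarrow> \<sigma> \<in> {\<alpha>..\<beta>}" using n elim by auto
      then have "indicator {real n * \<alpha><..<real n * \<beta>} (0 + real n * \<sigma>) = (indicator {\<alpha>..\<beta>} \<sigma> :: real)" by (simp add: indicator_def)
      then show ?case by (cases "\<sigma> \<in> {\<alpha>..\<beta>}") (simp_all add: nonlin_def scaleR_conv_of_real)
    qed
  qed
  finally show ?thesis .
qed

text \<open>Averaging over the starting time kills the boundary terms \<open>lin\<close>, while their difference
  equals, up to \<open>o(1)\<close>, the accumulated non-oscillating mode \<open>|W|\<^sup>p\<close>, which has a sign.\<close>

lemma profile_vanishes: "AE y in lborel. W y = 0"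
proof -
  define \<Delta> where "\<Delta> n \<sigma> = indicator {1..2} \<sigma> * (\<i> * (lin n (\<sigma> + 1) - lin n \<sigma>))" for n \<sigma>
  have [measurable]: "\<Delta> n \<in> borel_measurable borel" for n unfolding \<Delta>_def by measurable
  have close: "(\<lambda>n. \<i> * (lin n (\<sigma> + 1) - lin n \<sigma>) - (LINT \<rho>|lborel. indicator {\<sigma>..\<sigma>+1} \<rho> * nonlin n \<rho>)) \<longlonglongrightarrow> 0"
    if \<sigma>: "1 \<le> \<sigma>" "\<sigma> \<le> 2" for \<sigma>
  proof (rule tendstoI)
    fix e :: real assume e: "e > 0"
    have "\<forall>\<^sub>F n in sequentially. \<forall>t1 t2. real n \<le> t1 \<longrightarrow> t1 \<le> t2 \<longrightarrow> t2 \<le> 3 * real n \<longrightarrow>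
      norm ((LINT x|lborel. V t2 x * bump (real n) x) - (LINT x|lborel. V t1 x * bump (real n) x)
      + \<i> * (LINT s|lborel. indicator {t1<..<t2} s *\<^sub>R (LINT x|lborel. F (V s x) * bump (real n) x))) \<le> e / 2"
      using eventually_compose_filterlim[OF profile_almost_solves[of "e / 2"] filterlim_real_sequentially] e by simp
    then show "\<forall>\<^sub>F n in sequentially. dist (\<i> * (lin n (\<sigma> + 1) - lin n \<sigma>) - (LINT \<rho>|lborel. indicator {\<sigma>..\<sigma>+1} \<rho> * nonlin n \<rho>)) 0 < e"
      using eventually_ge_at_top[of "1::nat"]
    proof eventually_elim
      case (elim n)
      define N where "N = (LINT \<rho>|lborel. indicator {\<sigma>..\<sigma>+1} \<rho> * nonlin n \<rho>)"
      have "norm (lin n (\<sigma> + 1) - lin n \<sigma> + \<i> * N) \<le> e / 2"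
        using elim(1)[rule_format, of "real n * \<sigma>" "real n * (\<sigma> + 1)"] elim(2) \<sigma>
        unfolding nonlin_rescale[OF elim(2)] lin_def[symmetric] N_def[symmetric] by simp
      moreover have "\<i> * (lin n (\<sigma> + 1) - lin n \<sigma>) - N = \<i> * (lin n (\<sigma> + 1) - lin n \<sigma> + \<i> * N)"
        by (simp add: algebra_simps)
      ultimately show ?case using e unfolding N_def[symmetric] by (simp add: norm_mult del: right_diff_distrib)
    qed
  qed
  define L where "L \<sigma> = indicator {1..2} \<sigma> * resonance \<sigma> (\<sigma> + 1)" for \<sigma>
  have lim: "(\<lambda>n. \<Delta> n \<sigma>) \<longlonglongrightarrow> L \<sigma>" for \<sigma>
  proof (cases "\<sigma> \<in> {1..2}")
    case True
    then have "(\<lambda>n. (\<i> * (lin n (\<sigma> + 1) - lin n \<sigma>) - (LINT \<rho>|lborel. indicator {\<sigma>..\<sigma>+1} \<rho> * nonlin n \<rho>))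
      + (LINT \<rho>|lborel. indicator {\<sigma>..\<sigma>+1} \<rho> * nonlin n \<rho>)) \<longlonglongrightarrow> 0 + resonance \<sigma> (\<sigma> + 1)"
      by (intro tendsto_add close nonlin_average_tendsto) auto
    then show ?thesis using True by (simp add: \<Delta>_def L_def)
  qed (simp add: \<Delta>_def L_def)
  have [measurable]: "L \<in> borel_measurable borel"
    by (rule borel_measurable_LIMSEQ_metric[OF _ lim]) simp
  have ilin: "integrable lborel (\<lambda>\<sigma>. indicator {\<alpha>..\<beta>} \<sigma> * lin n \<sigma>)" if "n \<ge> 1" "\<alpha> \<ge> 1" for n \<alpha> \<beta>
  proof (rule Bochner_Integration.integrable_bound)
    show "integrable lborel (\<lambda>\<sigma>. (mass_2 + bump_mass) / 2 * indicator {\<alpha>..\<beta>} \<sigma> :: real)"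
      by (intro integrable_mult_right) simp
    show "AE \<sigma> in lborel. norm (indicator {\<alpha>..\<beta>} \<sigma> * lin n \<sigma>) \<le> norm ((mass_2 + bump_mass) / 2 * indicator {\<alpha>..\<beta>} \<sigma> :: real)"
      using lin_bound[OF that(1)] that(2) nonneg_consts by (intro AE_I2) (auto simp: indicator_def)
  qed measurable
  have d1: "(\<lambda>n. LINT \<sigma>|lborel. \<Delta> n \<sigma>) \<longlonglongrightarrow> (LINT \<sigma>|lborel. L \<sigma>)" and iL: "integrable lborel L"
  proof -
    have b: "AE \<sigma> in lborel. norm (\<Delta> (Suc n) \<sigma>) \<le> (mass_2 + bump_mass) * indicator {1..2} \<sigma>" for n
    proof (intro AE_I2)
      fix \<sigma> :: real
      show "norm (\<Delta> (Suc n) \<sigma>) \<le> (mass_2 + bump_mass) * indicator {1..2} \<sigma>"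
      proof (cases "\<sigma> \<in> {1..2}")
        case True
        have "norm (lin (Suc n) (\<sigma> + 1) - lin (Suc n) \<sigma>) \<le> (mass_2 + bump_mass) / 2 + (mass_2 + bump_mass) / 2"
          using True by (intro order_trans[OF norm_triangle_ineq4] add_mono lin_bound) auto
        then show ?thesis using True by (simp add: \<Delta>_def norm_mult)
      qed (simp add: \<Delta>_def)
    qed
    have i: "integrable lborel (\<lambda>\<sigma>. (mass_2 + bump_mass) * indicator {1..2::real} \<sigma> :: real)" by (intro integrable_mult_right) simp
    have l: "AE \<sigma> in lborel. (\<lambda>n. \<Delta> (Suc n) \<sigma>) \<longlonglongrightarrow> L \<sigma>" by (intro AE_I2 LIMSEQ_Suc lim)
    show "integrable lborel L" by (rule integrable_dominated_convergence[OF _ _ i l b]) auto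
    have "(\<lambda>n. LINT \<sigma>|lborel. \<Delta> (Suc n) \<sigma>) \<longlonglongrightarrow> (LINT \<sigma>|lborel. L \<sigma>)"
      by (rule integral_dominated_convergence[OF _ _ i l b]) auto
    then show "(\<lambda>n. LINT \<sigma>|lborel. \<Delta> n \<sigma>) \<longlonglongrightarrow> (LINT \<sigma>|lborel. L \<sigma>)" by (rule LIMSEQ_imp_Suc)
  qed
  have d2: "(\<lambda>n. LINT \<sigma>|lborel. \<Delta> n \<sigma>) \<longlonglongrightarrow> 0"
  proof (rule Lim_transform_eventually)
    have "(\<lambda>n. \<i> * ((LINT \<sigma>|lborel. indicator {2..3} \<sigma> * lin n \<sigma>) - (LINT \<sigma>|lborel. indicator {1..2} \<sigma> * lin n \<sigma>))) \<longlonglongrightarrow> \<i> * (0 - 0)"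
      by (intro tendsto_intros lin_average_tendsto) auto
    then show "(\<lambda>n. \<i> * ((LINT \<sigma>|lborel. indicator {2..3} \<sigma> * lin n \<sigma>) - (LINT \<sigma>|lborel. indicator {1..2} \<sigma> * lin n \<sigma>))) \<longlonglongrightarrow> 0" by simp
    show "\<forall>\<^sub>F n in sequentially. \<i> * ((LINT \<sigma>|lborel. indicator {2..3} \<sigma> * lin n \<sigma>) - (LINT \<sigma>|lborel. indicator {1..2} \<sigma> * lin n \<sigma>)) = (LINT \<sigma>|lborel. \<Delta> n \<sigma>)"
    proof (rule eventually_sequentiallyI[of 1])
      fix n :: nat assume n: "1 \<le> n"
      let ?f = "\<lambda>\<sigma>. indicator {2..3} \<sigma> * lin n \<sigma>"
      have i23: "integrable lborel (\<lambda>\<sigma>. ?f (1 + 1 * \<sigma>))" by (intro lborel_integrable_real_affine ilin n) auto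
      have "(LINT \<sigma>|lborel. ?f \<sigma>) = (LINT \<sigma>|lborel. ?f (1 + 1 * \<sigma>))"
        by (subst lborel_integral_real_affine[of 1 _ 1]) auto
      then have "\<i> * ((LINT \<sigma>|lborel. ?f \<sigma>) - (LINT \<sigma>|lborel. indicator {1..2} \<sigma> * lin n \<sigma>)) =
         (LINT \<sigma>|lborel. \<i> * (?f (1 + 1 * \<sigma>) - indicator {1..2} \<sigma> * lin n \<sigma>))"
        using i23 ilin[OF n, of 1 2] by simp
      also have "\<dots> = (LINT \<sigma>|lborel. \<Delta> n \<sigma>)"
      proof (intro Bochner_Integration.integral_cong refl)
        fix \<sigma> :: real
        have "(indicator {2..3} (1 + 1 * \<sigma>) :: complex) = indicator {1..2} \<sigma>" by (simp add: indicator_def)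
        then show "\<i> * (?f (1 + 1 * \<sigma>) - indicator {1..2} \<sigma> * lin n \<sigma>) = \<Delta> n \<sigma>"
          by (simp add: \<Delta>_def algebra_simps)
      qed
      finally show "\<i> * ((LINT \<sigma>|lborel. ?f \<sigma>) - (LINT \<sigma>|lborel. indicator {1..2} \<sigma> * lin n \<sigma>)) = (LINT \<sigma>|lborel. \<Delta> n \<sigma>)" .
    qed
  qed
  have L0: "(LINT \<sigma>|lborel. L \<sigma>) = 0" by (rule LIMSEQ_unique[OF d1 d2])
  define B where "B = (LINT y|lborel. norm (W y) powr p * exp (- 36 * (norm y)\<^sup>2))"
  have B0: "B \<ge> 0" unfolding B_def by (intro Bochner_Integration.integral_nonneg) auto
  have "(1 / 6) * B = (LINT \<sigma>|lborel. (1 / 6) * B * indicator {1..2::real} \<sigma>)"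
    unfolding integral_mult_right_zero by simp
  also have "\<dots> \<le> (LINT \<sigma>|lborel. Re (L \<sigma>))"
  proof (rule integral_mono)
    show "integrable lborel (\<lambda>\<sigma>. (1 / 6) * B * indicator {1..2::real} \<sigma>)" by (intro integrable_mult_right) simp
    show "integrable lborel (\<lambda>\<sigma>. Re (L \<sigma>))" by (rule integrable_Re[OF iL])
    show "(1 / 6) * B * indicator {1..2::real} \<sigma> \<le> Re (L \<sigma>)" for \<sigma>
      using resonance_lower_bound[of \<sigma>] by (cases "\<sigma> \<in> {1..2}") (auto simp: L_def B_def)
  qed
  also have "\<dots> = Re (LINT \<sigma>|lborel. L \<sigma>)" by (rule integral_Re[OF iL])
  finally have "B = 0" using B0 L0 by simp
  then have "AE y in lborel. norm (W y) powr p * exp (- 36 * (norm y)\<^sup>2) = 0"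
    unfolding B_def using W_gaussian_integrable(2)[of 36] by (subst (asm) integral_nonneg_eq_0_iff_AE) auto
  then show ?thesis by eventually_elim simp
qed

end

section \<open>Nonexistence of modified scattering states\<close>

lemma epowr_tendsto_0:
  assumes f: "(f \<longlongrightarrow> 0) F" and p: "p > 0"
  shows "((\<lambda>x. epowr (f x) p) \<longlongrightarrow> 0) F"
proof (rule order_tendstoI)
  fix a :: ennreal assume a: "0 < a"
  obtain r where r: "r > 0" "ennreal r \<le> a"
  proof (cases a)
    case (real x)
    then show thesis using a that[of x] by (cases "x = 0") auto
  next
    case top
    then show thesis using that[of 1] by simp
  qed
  have "\<forall>\<^sub>F x in F. f x < ennreal (r powr (1 / p))"
    using r(1) by (intro order_tendstoD(2)[OF f]) simp
  then show "\<forall>\<^sub>F x in F. epowr (f x) p < a"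
  proof eventually_elim
    case (elim x)
    obtain y where y: "f x = ennreal y" "y \<ge> 0" using elim by (cases "f x") auto
    have "y < r powr (1 / p)" using elim y by (simp add: ennreal_less_iff)
    then have "y powr p < (r powr (1 / p)) powr p" using y p by (intro powr_less_mono2) auto
    also have "\<dots> = r" using r p by (simp add: powr_powr)
    finally have "ennreal (y powr p) < ennreal r" using y by (simp add: ennreal_less_iff)
    then show ?case using y r(2) by (simp add: epowr_ennreal)
  qed
qed simp

lemma AE_lborel_scaleR:
  fixes P :: "'a::euclidean_space \<Rightarrow> bool"
  assumes "AE x in lborel. P x" and c: "c \<noteq> 0"
  shows "AE x in lborel. P (c *\<^sub>R x)"
proof -
  obtain N where N: "{x \<in> space lborel. \<not> P x} \<subseteq> N" "emeasure lborel N = 0" "N \<in> sets lborel"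
    using AE_E[OF assms(1)] by blast
  have Nm[measurable]: "N \<in> sets borel" using N(3) by simp
  have "emeasure lborel N = ennreal (\<bar>c\<bar> ^ DIM('a)) * (\<integral>\<^sup>+ x. indicator N (0 + c *\<^sub>R x) \<partial>lborel)"
    using nn_integral_lborel_affine[of "indicator N" c 0] c by simp
  then have "(\<integral>\<^sup>+ x. indicator N (0 + c *\<^sub>R x) \<partial>(lborel :: 'a measure)) = 0" using N(2) c by simp
  then have "AE x in lborel. indicator N (0 + c *\<^sub>R x) = (0 :: ennreal)"
    by (subst (asm) nn_integral_0_iff_AE) auto
  then show ?thesis
  proof eventually_elim
    case (elim x)
    then have "c *\<^sub>R x \<notin> N" by (simp add: indicator_def split: if_splits)
    then show ?case using N(1) by auto
  qed
qed

theorem theorem1p2: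
  fixes F :: "complex \<Rightarrow> complex"
    and u :: "real \<Rightarrow> 'a::euclidean_space \<Rightarrow> complex"
    and u_plus :: "'a \<Rightarrow> complex"
    and T lam :: real
  assumes "homogeneous_nl DIM('a) F"
    and "\<And>z. ((\<lambda>n. nl_coeff F n * nl_mode DIM('a) n z) has_sum F z) UNIV"
    and "(\<lambda>n. norm (nl_coeff F n)) summable_on UNIV"
    and "nl_coeff F 0 = 1"
    and "is_solution F {T..} u"
    and "u_plus \<in> Lp 2"
    and "tdist u_plus \<in> weighted_sobolev 0 (real DIM('a) / (real DIM('a) + 2))"
    and "((\<lambda>t. Lp_norm 2 (\<lambda>x. u t x - profile lam u_plus t x)) \<longlongrightarrow> 0) at_top"
    and "((\<lambda>t. ennreal (t powr (real DIM('a) / (2 * (real DIM('a) + 2)))) *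
           spacetime_norm (2 * (real DIM('a) + 2) / real DIM('a)) {t..}
             (\<lambda>s x. u s x - profile lam u_plus s x)) \<longlongrightarrow> 0) at_top"
  shows "AE x in lebesgue. u_plus x = 0"
proof -
  define p where "p = 1 + 2 / real DIM('a)"
  define q where "q = 2 * p"
  have d: "real DIM('a) > 0" by simp
  have q: "2 * (real DIM('a) + 2) / real DIM('a) = q" by (simp add: q_def p_def field_simps)
  have q0: "q > 0" by (simp add: q_def p_def add_pos_nonneg)
  have aq: "real DIM('a) / (2 * (real DIM('a) + 2)) * q = 1"
  proof -
    have "x / (2 * (x + 2)) * (2 * (x + 2) / x) = 1" if "x > 0" for x :: real
      using that by simp
    from this[OF d] show ?thesis unfolding q .
  qed
  have Fm[measurable]: "F \<in> borel_measurable borel"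
    using nl_series_continuous[OF assms(2,3)] by (rule borel_measurable_continuous_onI)
  have uL: "u t \<in> Lp 2" if "t \<ge> T" for t using assms(5) that by (simp add: is_solution_def)
  have "\<forall>t. \<exists>v. t \<ge> T \<longrightarrow> v \<in> borel_measurable borel \<and> (AE x in lborel. u t x = v x)"
    using uL lebesgue_borel_representative Lp2_iff by metis
  from choice[OF this] obtain v where v: "\<And>t. t \<ge> T \<Longrightarrow> v t \<in> borel_measurable borel"
    "\<And>t. t \<ge> T \<Longrightarrow> AE x in lborel. u t x = v t x" by blast
  have FL: "L2_represents (fourier_L2 u_plus) (\<lambda>\<phi>. tdist u_plus (fourier \<phi>))"
    by (rule fourier_L2_represents[OF assms(6)])
  then have "fourier_L2 u_plus \<in> borel_measurable lebesgue" "nsq (fourier_L2 u_plus) < top"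
    by (auto simp: L2_represents_def Lp2_iff)
  moreover then obtain W where W: "W \<in> borel_measurable borel" "AE x in lborel. fourier_L2 u_plus x = W x"
    using lebesgue_borel_representative by blast
  ultimately have W2: "nsq W < top" using nsq_cong_AE[OF W(2)] by simp
  have diff: "AE x in lborel. u t x - profile lam u_plus t x = v t x - profile_of lam W t x" if t: "t \<ge> T" "t > 0" for t
  proof -
    have "AE x in lborel. fourier_L2 u_plus ((1 / (2 * t)) *\<^sub>R x) = W ((1 / (2 * t)) *\<^sub>R x)"
      using t by (intro AE_lborel_scaleR[OF W(2)]) auto
    with v(2)[OF t(1)] show ?thesis
      by eventually_elim (simp add: profile_eq_profile_of[OF t(2)] profile_of_def profile_phase_def)
  qed
  have uv: "AE x in lborel. u s x - u t x = v s x - v t x" if "s \<ge> T" "t \<ge> T" for s t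
    using v(2)[OF that(1)] v(2)[OF that(2)] by eventually_elim simp
  interpret nls_profile F "nl_coeff F" v W T lam p q
  proof
    show "p = 1 + 2 / real DIM('a)" "q = 2 * p" by (simp_all add: p_def q_def)
    show "((\<lambda>n. nl_coeff F n * nl_mode DIM('a) n z) has_sum F z) UNIV" for z by (rule assms(2))
    show "(\<lambda>n. norm (nl_coeff F n)) summable_on UNIV" "nl_coeff F 0 = 1" by (rule assms)+
    show "W \<in> borel_measurable borel" "nsq W < top" by (rule W W2)+
    show "v t \<in> borel_measurable borel" if "t \<ge> T" for t by (rule v(1)[OF that])
    show "nsq (v t) < top" if "t \<ge> T" for t
      using uL[OF that] nsq_cong_AE[OF v(2)[OF that]] by (simp add: Lp2_iff)
    show "((\<lambda>s. nsq (\<lambda>x. v s x - v t x)) \<longlongrightarrow> 0) (at t within {T..})" if t: "t \<ge> T" for t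
    proof (rule Lim_transform_eventually)
      have "((\<lambda>s. Lp_norm 2 (\<lambda>x. u s x - u t x)) \<longlongrightarrow> 0) (at t within {T..})"
        using assms(5) t by (simp add: is_solution_def)
      then show "((\<lambda>s. nsq (\<lambda>x. u s x - u t x)) \<longlongrightarrow> 0) (at t within {T..})"
        unfolding nsq_eq_epowr by (rule epowr_tendsto_0) simp
      show "\<forall>\<^sub>F s in at t within {T..}. nsq (\<lambda>x. u s x - u t x) = nsq (\<lambda>x. v s x - v t x)"
        unfolding eventually_at_filter using uv t by (intro always_eventually) (auto intro!: nsq_cong_AE)
    qed
    show "(\<integral>\<^sup>+ t. pmass q (v t) * indicator {a..b} t \<partial>lborel) < top" if a: "T \<le> a" for a b
    proof -
      have "spacetime_norm q {a..b} u < top"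
        using assms(5) a unfolding is_solution_def q by auto
      then have "(\<integral>\<^sup>+ t. pmass q (u t) * indicator {a..b} t \<partial>lborel) < top"
        using spacetime_norm_eq[OF q0, of "{a..b}" u] by (auto simp: epowr_eq_top less_top[symmetric])
      also have "(\<integral>\<^sup>+ t. pmass q (u t) * indicator {a..b} t \<partial>lborel) = (\<integral>\<^sup>+ t. pmass q (v t) * indicator {a..b} t \<partial>lborel)"
      proof (intro nn_integral_cong)
        fix t
        show "pmass q (u t) * indicator {a..b} t = pmass q (v t) * indicator {a..b} t"
          using pmass_cong_AE[OF v(2), of t] a by (cases "t \<in> {a..b}") auto
      qed
      finally show ?thesis .
    qed
    show "((\<lambda>t. nsq (\<lambda>x. v t x - profile_of lam W t x)) \<longlongrightarrow> 0) at_top"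
    proof (rule Lim_transform_eventually)
      show "((\<lambda>t. nsq (\<lambda>x. u t x - profile lam u_plus t x)) \<longlongrightarrow> 0) at_top"
        unfolding nsq_eq_epowr by (rule epowr_tendsto_0[OF assms(8)]) simp
      show "\<forall>\<^sub>F t in at_top. nsq (\<lambda>x. u t x - profile lam u_plus t x) = nsq (\<lambda>x. v t x - profile_of lam W t x)"
        using eventually_ge_at_top[of T] eventually_gt_at_top[of 0]
        by eventually_elim (intro nsq_cong_AE diff)
    qed
    show "((\<lambda>t. ennreal t * (\<integral>\<^sup>+ s. pmass q (\<lambda>x. v s x - profile_of lam W s x) * indicator {t..} s \<partial>lborel)) \<longlongrightarrow> 0) at_top"
    proof (rule Lim_transform_eventually)
      let ?A = "\<lambda>t. \<integral>\<^sup>+ s. pmass q (\<lambda>x. u s x - profile lam u_plus s x) * indicator {t..} s \<partial>lborel"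
      let ?a = "real DIM('a) / (2 * (real DIM('a) + 2))"
      show "((\<lambda>t. epowr (ennreal (t powr ?a) * epowr (?A t) (1 / q)) q) \<longlongrightarrow> 0) at_top"
        using epowr_tendsto_0[OF assms(9) q0] unfolding q by (simp add: spacetime_norm_eq[OF q0])
      show "\<forall>\<^sub>F t in at_top. epowr (ennreal (t powr ?a) * epowr (?A t) (1 / q)) q =
         ennreal t * (\<integral>\<^sup>+ s. pmass q (\<lambda>x. v s x - profile_of lam W s x) * indicator {t..} s \<partial>lborel)"
        using eventually_ge_at_top[of T] eventually_gt_at_top[of 0]
      proof eventually_elim
        case (elim t)
        have "epowr (ennreal (t powr ?a) * epowr (?A t) (1 / q)) q = ennreal ((t powr ?a) powr q) * ?A t"
          using elim by (subst epowr_mult) (simp_all add: q0 epowr_epowr)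
        moreover have "(t powr ?a) powr q = t" unfolding powr_powr aq using elim by simp
        moreover have "?A t = (\<integral>\<^sup>+ s. pmass q (\<lambda>x. v s x - profile_of lam W s x) * indicator {t..} s \<partial>lborel)"
        proof (intro nn_integral_cong)
          fix s
          show "pmass q (\<lambda>x. u s x - profile lam u_plus s x) * indicator {t..} s =
            pmass q (\<lambda>x. v s x - profile_of lam W s x) * indicator {t..} s"
            using pmass_cong_AE[OF diff, of s q] elim by (cases "s \<in> {t..}") auto
        qed
        ultimately show ?case by (simp only:)
      qed
    qed
    fix t1 t2 :: real and \<phi> :: "'a \<Rightarrow> complex"
    assume t: "T \<le> t1" "t1 \<le> t2" and \<phi>: "\<phi> \<in> schwartz"
    note \<phi>m[measurable] = schwartz_measurable[OF \<phi>]
    have t2: "T \<le> t2" using t by simp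
    let ?G = "\<lambda>s x. F (u s x)"
    obtain h where h: "is_duhamel_integral ?G t1 t2 h"
      "AE x in lebesgue. u t2 x = schrodinger_L2 (t2 - t1) (u t1) x - \<i> * h x"
      using assms(5) t t2 unfolding is_solution_def by (meson atLeast_iff)
    have G: "indicator {t1<..<t2} s *\<^sub>R schrodinger_dist (t2 - s) (tdist (?G s)) \<phi> =
        indicator {t1<..<t2} s *\<^sub>R (LINT x|lborel. F (v s x) * schrodinger (t2 - s) \<phi> x)" for s
    proof (cases "s \<in> {t1<..<t2}")
      case True
      then have s: "s \<ge> T" using t by simp
      have "tdist (?G s) (schrodinger (t2 - s) \<phi>) = (LINT x|lborel. F (v s x) * schrodinger (t2 - s) \<phi> x)"
      proof (rule tdist_borel)
        show "?G s \<in> borel_measurable lebesgue"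
          using uL[OF s] by (intro measurable_compose[OF _ Fm]) (simp add: Lp2_iff)
        show "(\<lambda>x. F (v s x)) \<in> borel_measurable borel" using v(1)[OF s] by simp
        show "AE x in lborel. F (u s x) = F (v s x)" using v(2)[OF s] by eventually_elim simp
      qed simp
      then show ?thesis by (simp add: schrodinger_dist_def)
    qed simp
    have "interval_lebesgue_integrable lebesgue (ereal t1) (ereal t2) (\<lambda>s. schrodinger_dist (t2 - s) (tdist (?G s)) \<phi>)"
      using h(1) \<phi> by (simp add: is_duhamel_integral_def)
    then show "integrable lebesgue (\<lambda>s. indicator {t1<..<t2} s *\<^sub>R (LINT x|lborel. F (v s x) * schrodinger (t2 - s) \<phi> x))"
      using t(2) by (simp add: interval_lebesgue_integrable_def set_integrable_def einterval_eq G)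
    have hL: "h \<in> Lp 2" and "(LINT s=ereal t1..ereal t2|lebesgue. schrodinger_dist (t2 - s) (tdist (?G s)) \<phi>) = tdist h \<phi>"
      using h(1) \<phi> by (auto simp: is_duhamel_integral_def L2_represents_def)
    then have th: "tdist h \<phi> = (LINT s|lebesgue. indicator {t1<..<t2} s *\<^sub>R (LINT x|lborel. F (v s x) * schrodinger (t2 - s) \<phi> x))"
      using t(2) by (simp add: interval_lebesgue_integral_def set_lebesgue_integral_def einterval_eq G)
    let ?S = "schrodinger_L2 (t2 - t1) (u t1)"
    have S: "?S \<in> Lp 2" "tdist (u t1) (schrodinger (t2 - t1) \<phi>) = tdist ?S \<phi>"
      using schrodinger_L2_represents[OF uL[OF t(1)], of "t2 - t1"] \<phi> by (auto simp: L2_represents_def schrodinger_dist_def)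
    obtain S' where S': "S' \<in> borel_measurable borel" "AE x in lborel. ?S x = S' x"
      using lebesgue_borel_representative S(1) Lp2_iff by metis
    obtain h' where h': "h' \<in> borel_measurable borel" "AE x in lborel. h x = h' x"
      using lebesgue_borel_representative hL Lp2_iff by metis
    have fin: "nsq S' < top" "nsq h' < top"
      using S(1) hL nsq_cong_AE[OF S'(2)] nsq_cong_AE[OF h'(2)] by (auto simp: Lp2_iff)
    have "AE x in lborel. u t2 x = ?S x - \<i> * h x" using h(2) by (simp only: AE_completion_iff)
    with v(2)[OF t2] S'(2) h'(2) have ae: "AE x in lborel. v t2 x = S' x - \<i> * h' x"
      by eventually_elim simp
    have "(LINT x|lborel. v t2 x * \<phi> x) = (LINT x|lborel. S' x * \<phi> x - \<i> * (h' x * \<phi> x))"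
    proof (rule integral_cong_AE)
      show "AE x in lborel. v t2 x * \<phi> x = S' x * \<phi> x - \<i> * (h' x * \<phi> x)"
        using ae by eventually_elim (simp only: left_diff_distrib mult.assoc)
    qed (use v(1)[OF t2] S'(1) h'(1) in simp_all)
    also have "\<dots> = (LINT x|lborel. S' x * \<phi> x) - \<i> * (LINT x|lborel. h' x * \<phi> x)"
      using integrable_mult_nsq(1)[OF S'(1) \<phi>m fin(1) schwartz_nsq[OF \<phi>]] integrable_mult_nsq(1)[OF h'(1) \<phi>m fin(2) schwartz_nsq[OF \<phi>]]
      by simp
    also have "(LINT x|lborel. S' x * \<phi> x) = tdist ?S \<phi>"
      using S(1) by (intro tdist_borel[symmetric] S' \<phi>m) (simp add: Lp2_iff)
    also have "\<dots> = (LINT x|lborel. v t1 x * schrodinger (t2 - t1) \<phi> x)"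
      unfolding S(2)[symmetric] using uL[OF t(1)] by (intro tdist_borel v t(1)) (simp_all add: Lp2_iff)
    also have "(LINT x|lborel. h' x * \<phi> x) = tdist h \<phi>"
      using hL by (intro tdist_borel[symmetric] h' \<phi>m) (simp add: Lp2_iff)
    finally show "(LINT x|lborel. v t2 x * \<phi> x) = (LINT x|lborel. v t1 x * schrodinger (t2 - t1) \<phi> x)
       - \<i> * (LINT s|lebesgue. indicator {t1<..<t2} s *\<^sub>R (LINT x|lborel. F (v s x) * schrodinger (t2 - s) \<phi> x))"
      unfolding th .
  qed
  have W0: "AE x in lborel. fourier_L2 u_plus x = 0"
    using profile_vanishes W(2) by eventually_elim simp
  have "AE x in lborel. u_plus x = 0"
  proof (rule fourier_injective[OF assms(6)])
    fix \<phi> :: "'a \<Rightarrow> complex" assume \<phi>: "\<phi> \<in> schwartz"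
    have "tdist u_plus (fourier \<phi>) = tdist (fourier_L2 u_plus) \<phi>"
      using FL \<phi> by (simp add: L2_represents_def)
    also have "\<dots> = (LINT x|lborel. 0 * \<phi> x)"
      using FL by (intro tdist_borel[OF _ _ W0 schwartz_measurable[OF \<phi>]]) (simp_all add: L2_represents_def Lp2_iff)
    finally show "tdist u_plus (fourier \<phi>) = 0" by simp
  qed
  then show ?thesis by (rule AE_completion)
qed

end
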